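(* Let $M$ be a finitely generated abelian group and let $\mathcal N=\{N_\tau\}_{\tau\in\mathscr A}$ be a nonempty set of fine submonoids of $M$ such that $N_\tau^{\mathrm{gp}}=N_{\tau'}^{\mathrm{gp}}$ for all $\tau,\tau'\in\mathscr A$; denote this common subgroup of $M$ by $\mathcal N^{\mathrm{gp}}$. Then the diagram consisting of all the morphisms $$D(\mathcal N^{\mathrm{gp}})\longrightarrow A(N_\tau),\qquad \tau\in\mathscr A,$$ admits a colimit in the category of schemes. (This colimit is denoted by $A(\mathcal N)$.)
   Context: All monoids are commutative with unit. A monoid is fine if it is finitely generated and integral (cancellative). For a submonoid $N\subset M$, $N^{\mathrm{gp}}\subset M$ is the subgroup generated by $N$. For a commutative monoid $N$, $A(N)=\operatorname{Spec}(\mathbb Z[N])$, where $\mathbb Z[N]$ is the monoid algebra; if $N$ is an abelian group, $A(N)$ with its group scheme structure is denoted $D(N)$. The morphism $D(\mathcal N^{\mathrm{gp}})\to A(N_\tau)$ is the one dual to the inclusion $N_\tau\subset \mathcal N^{\mathrm{gp}}$; it is an open immersion. The diagram has one object $D(\mathcal N^{\mathrm{gp}})$ and one object $A(N_\tau)$ for each $\tau\in\mathscr A$, with one arrow $D(\mathcal N^{\mathrm{gp}})\to A(N_\tau)$ for each $\tau$. *)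

theory Defs
  imports
    "HOL-Analysis.Abstract_Topology"
    "HOL-Algebra.Ideal"
    "HOL-Library.FuncSet"
    "HOL-Library.Poly_Mapping"
    "HOL-Computational_Algebra.Group_Closure"
begin

section \<open>Local rings and localization\<close>

definition local_ring :: "('r, 'x) ring_scheme \<Rightarrow> bool" where
  "local_ring R \<longleftrightarrow> cring R \<and> (\<exists>!m. maximalideal m R)"

definition local_ring_hom ::
    "('r, 'x) ring_scheme \<Rightarrow> ('s, 'y) ring_scheme \<Rightarrow> ('r \<Rightarrow> 's) set" where
  "local_ring_hom R S = {\<phi> \<in> ring_hom R S.
     \<forall>m. maximalideal m S \<longrightarrow> maximalideal {r \<in> carrier R. \<phi> r \<in> m} R}"

text \<open>The fraction \<open>a / s\<close> in the localization of \<open>R\<close> at the prime ideal \<open>p\<close>, as an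
  equivalence class of pairs.\<close>

definition fraction :: "('r, 'x) ring_scheme \<Rightarrow> 'r set \<Rightarrow> 'r \<Rightarrow> 'r \<Rightarrow> ('r \<times> 'r) set" where
  "fraction R p a s = {(b, t). b \<in> carrier R \<and> t \<in> carrier R - p \<and>
     (\<exists>u \<in> carrier R - p. u \<otimes>\<^bsub>R\<^esub> (a \<otimes>\<^bsub>R\<^esub> t) = u \<otimes>\<^bsub>R\<^esub> (b \<otimes>\<^bsub>R\<^esub> s))}"

text \<open>In the operations below (as in the factor rings of \<open>HOL-Algebra\<close>) the unions
  range over representatives and all their members coincide.\<close>

definition localization :: "('r, 'x) ring_scheme \<Rightarrow> 'r set \<Rightarrow> ('r \<times> 'r) set ring" where
  "localization R p =
    \<lparr>carrier = {fraction R p a s | a s. a \<in> carrier R \<and> s \<in> carrier R - p},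
     mult = (\<lambda>A B. \<Union>(a, s) \<in> A. \<Union>(b, t) \<in> B. fraction R p (a \<otimes>\<^bsub>R\<^esub> b) (s \<otimes>\<^bsub>R\<^esub> t)),
     one = fraction R p \<one>\<^bsub>R\<^esub> \<one>\<^bsub>R\<^esub>,
     zero = fraction R p \<zero>\<^bsub>R\<^esub> \<one>\<^bsub>R\<^esub>,
     add = (\<lambda>A B. \<Union>(a, s) \<in> A. \<Union>(b, t) \<in> B.
       fraction R p (a \<otimes>\<^bsub>R\<^esub> t \<oplus>\<^bsub>R\<^esub> b \<otimes>\<^bsub>R\<^esub> s) (s \<otimes>\<^bsub>R\<^esub> t))\<rparr>"

text \<open>The map \<open>R\<^bsub>\<phi>\<inverse>(p)\<^esub> \<rightarrow> S\<^bsub>p\<^esub>\<close> induced by a ring homomorphism \<open>\<phi> : R \<rightarrow> S\<close>.\<close>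

definition localization_map ::
    "('s, 'y) ring_scheme \<Rightarrow> 's set \<Rightarrow> ('r \<Rightarrow> 's) \<Rightarrow> ('r \<times> 'r) set \<Rightarrow> ('s \<times> 's) set" where
  "localization_map S p \<phi> A = (\<Union>(a, s) \<in> A. fraction S p (\<phi> a) (\<phi> s))"


section \<open>Locally ringed spaces\<close>

text \<open>\<open>sec X U\<close> is the ring of sections over \<open>U\<close>, and \<open>res X U V\<close> is the restriction map
  from \<open>U\<close> to \<open>V \<subseteq> U\<close>; only their values on open sets are relevant.\<close>

record ('a, 'b) ringed =
  base :: "'a topology"
  sec :: "'a set \<Rightarrow> 'b ring"
  res :: "'a set \<Rightarrow> 'a set \<Rightarrow> 'b \<Rightarrow> 'b"

locale ringed_space =
  fixes X :: "('a, 'b) ringed"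
  assumes sec_cring: "openin (base X) U \<Longrightarrow> cring (sec X U)"
    and res_hom: "\<lbrakk>openin (base X) U; openin (base X) V; V \<subseteq> U\<rbrakk>
      \<Longrightarrow> res X U V \<in> ring_hom (sec X U) (sec X V)"
    and res_id: "\<lbrakk>openin (base X) U; s \<in> carrier (sec X U)\<rbrakk> \<Longrightarrow> res X U U s = s"
    and res_res: "\<lbrakk>openin (base X) U; openin (base X) V; openin (base X) W;
        W \<subseteq> V; V \<subseteq> U; s \<in> carrier (sec X U)\<rbrakk>
      \<Longrightarrow> res X V W (res X U V s) = res X U W s"
    and locality: "\<lbrakk>\<And>V. V \<in> C \<Longrightarrow> openin (base X) V;
        s \<in> carrier (sec X (\<Union>C)); t \<in> carrier (sec X (\<Union>C));
        \<And>V. V \<in> C \<Longrightarrow> res X (\<Union>C) V s = res X (\<Union>C) V t\<rbrakk>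
      \<Longrightarrow> s = t"
    and gluing: "\<lbrakk>\<And>V. V \<in> C \<Longrightarrow> openin (base X) V;
        \<And>V. V \<in> C \<Longrightarrow> \<sigma> V \<in> carrier (sec X V);
        \<And>V W. \<lbrakk>V \<in> C; W \<in> C\<rbrakk> \<Longrightarrow> res X V (V \<inter> W) (\<sigma> V) = res X W (V \<inter> W) (\<sigma> W)\<rbrakk>
      \<Longrightarrow> \<exists>s \<in> carrier (sec X (\<Union>C)). \<forall>V \<in> C. res X (\<Union>C) V s = \<sigma> V"

definition germ :: "('a, 'b) ringed \<Rightarrow> 'a \<Rightarrow> 'a set \<Rightarrow> 'b \<Rightarrow> ('a set \<times> 'b) set" where
  "germ X x U s = {(V, t). openin (base X) V \<and> x \<in> V \<and> t \<in> carrier (sec X V) \<and>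
     (\<exists>W. openin (base X) W \<and> x \<in> W \<and> W \<subseteq> U \<inter> V \<and> res X U W s = res X V W t)}"

definition stalk :: "('a, 'b) ringed \<Rightarrow> 'a \<Rightarrow> ('a set \<times> 'b) set ring" where
  "stalk X x =
    \<lparr>carrier = {germ X x U s | U s. openin (base X) U \<and> x \<in> U \<and> s \<in> carrier (sec X U)},
     mult = (\<lambda>A B. \<Union>(U, s) \<in> A. \<Union>(V, t) \<in> B.
       germ X x (U \<inter> V) (res X U (U \<inter> V) s \<otimes>\<^bsub>sec X (U \<inter> V)\<^esub> res X V (U \<inter> V) t)),
     one = germ X x (topspace (base X)) \<one>\<^bsub>sec X (topspace (base X))\<^esub>,
     zero = germ X x (topspace (base X)) \<zero>\<^bsub>sec X (topspace (base X))\<^esub>,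
     add = (\<lambda>A B. \<Union>(U, s) \<in> A. \<Union>(V, t) \<in> B.
       germ X x (U \<inter> V) (res X U (U \<inter> V) s \<oplus>\<^bsub>sec X (U \<inter> V)\<^esub> res X V (U \<inter> V) t))\<rparr>"

locale locally_ringed_space = ringed_space +
  assumes local_ring_stalk: "x \<in> topspace (base X) \<Longrightarrow> local_ring (stalk X x)"


section \<open>Morphisms of locally ringed spaces\<close>

text \<open>A morphism from \<open>X\<close> to \<open>Y\<close> is a pair \<open>(f, F)\<close> of a map of points and, for each open
  set \<open>V\<close> of \<open>Y\<close>, a ring homomorphism \<open>F V\<close> from the sections over \<open>V\<close> to the sections over
  the preimage of \<open>V\<close>. All functions involved are extensional, so that equality of morphisms
  is equality in HOL.\<close>

type_synonym ('a, 'b, 'c, 'd) mor = "('a \<Rightarrow> 'c) \<times> ('c set \<Rightarrow> 'd \<Rightarrow> 'b)"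

definition preim :: "('a, 'b) ringed \<Rightarrow> ('a \<Rightarrow> 'c) \<Rightarrow> 'c set \<Rightarrow> 'a set" where
  "preim X f V = {x \<in> topspace (base X). f x \<in> V}"

definition stalk_map ::
    "('a, 'b) ringed \<Rightarrow> ('a, 'b, 'c, 'd) mor \<Rightarrow> 'a \<Rightarrow> ('c set \<times> 'd) set \<Rightarrow> ('a set \<times> 'b) set" where
  "stalk_map X \<phi> x A = (\<Union>(V, t) \<in> A. germ X x (preim X (fst \<phi>) V) (snd \<phi> V t))"

definition Hom ::
    "('a, 'b) ringed \<Rightarrow> ('c, 'd) ringed \<Rightarrow> ('a, 'b, 'c, 'd) mor set" where
  "Hom X Y = {(f, F).
     continuous_map (base X) (base Y) f \<and>
     f \<in> extensional (topspace (base X)) \<and>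
     F \<in> extensional {V. openin (base Y) V} \<and>
     (\<forall>V. openin (base Y) V \<longrightarrow>
        F V \<in> ring_hom (sec Y V) (sec X (preim X f V)) \<and>
        F V \<in> extensional (carrier (sec Y V))) \<and>
     (\<forall>V W. openin (base Y) V \<and> openin (base Y) W \<and> W \<subseteq> V \<longrightarrow>
        (\<forall>t \<in> carrier (sec Y V).
           F W (res Y V W t) = res X (preim X f V) (preim X f W) (F V t))) \<and>
     (\<forall>x \<in> topspace (base X).
        stalk_map X (f, F) x \<in> local_ring_hom (stalk Y (f x)) (stalk X x))}"

definition mor_id :: "('a, 'b) ringed \<Rightarrow> ('a, 'b, 'a, 'b) mor" where
  "mor_id X = ((\<lambda>x \<in> topspace (base X). x),
     (\<lambda>V \<in> {V. openin (base X) V}. \<lambda>t \<in> carrier (sec X V). t))"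

text \<open>The composite of \<open>\<phi> : X \<rightarrow> Y\<close> and \<open>\<psi> : Y \<rightarrow> Z\<close>.\<close>

definition mor_comp :: "('a, 'b) ringed \<Rightarrow> ('c, 'd) ringed \<Rightarrow> ('e, 'f) ringed \<Rightarrow>
    ('c, 'd, 'e, 'f) mor \<Rightarrow> ('a, 'b, 'c, 'd) mor \<Rightarrow> ('a, 'b, 'e, 'f) mor" where
  "mor_comp X Y Z \<psi> \<phi> = (compose (topspace (base X)) (fst \<psi>) (fst \<phi>),
     (\<lambda>W \<in> {W. openin (base Z) W}.
        compose (carrier (sec Z W)) (snd \<phi> (preim Y (fst \<psi>) W)) (snd \<psi> W)))"

definition isomorphic :: "('a, 'b) ringed \<Rightarrow> ('c, 'd) ringed \<Rightarrow> bool" where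
  "isomorphic X Y \<longleftrightarrow> (\<exists>\<phi> \<in> Hom X Y. \<exists>\<psi> \<in> Hom Y X.
     mor_comp X Y X \<psi> \<phi> = mor_id X \<and> mor_comp Y X Y \<phi> \<psi> = mor_id Y)"

definition open_subspace :: "('a, 'b) ringed \<Rightarrow> 'a set \<Rightarrow> ('a, 'b) ringed" where
  "open_subspace X U = X\<lparr>base := subtopology (base X) U\<rparr>"


section \<open>Affine schemes and schemes\<close>

definition spec_open :: "('r, 'x) ring_scheme \<Rightarrow> 'r set \<Rightarrow> 'r set set" where
  "spec_open R E = {p. primeideal p R \<and> \<not> E \<subseteq> p}"

definition zariski :: "('r, 'x) ring_scheme \<Rightarrow> 'r set topology" where
  "zariski R = topology (\<lambda>U. \<exists>E \<subseteq> carrier R. U = spec_open R E)"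

lemma openin_zariski: "openin (zariski R) U \<longleftrightarrow> (\<exists>E \<subseteq> carrier R. U = spec_open R E)"
proof -
  have inter: "p \<in> spec_open R E \<inter> spec_open R E' \<longleftrightarrow>
      p \<in> spec_open R ((\<lambda>(a, b). a \<otimes>\<^bsub>R\<^esub> b) ` (E \<times> E'))"
    if "E \<subseteq> carrier R" "E' \<subseteq> carrier R" for E E' p
  proof (cases "primeideal p R")
    case True
    then interpret primeideal p R .
    have "a \<otimes>\<^bsub>R\<^esub> b \<in> p \<longleftrightarrow> a \<in> p \<or> b \<in> p" if "a \<in> E" "b \<in> E'" for a b
    proof -
      have "a \<in> carrier R" "b \<in> carrier R"
        using that \<open>E \<subseteq> carrier R\<close> \<open>E' \<subseteq> carrier R\<close> by blast+
      then show ?thesis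
        using I_prime[of a b] I_r_closed[of a b] I_l_closed[of b a] by metis
    qed
    then have "(\<forall>a\<in>E. \<forall>b\<in>E'. a \<otimes>\<^bsub>R\<^esub> b \<in> p) \<longleftrightarrow> (\<forall>a\<in>E. \<forall>b\<in>E'. a \<in> p \<or> b \<in> p)"
      by simp
    also have "\<dots> \<longleftrightarrow> E \<subseteq> p \<or> E' \<subseteq> p"
      by blast
    finally have "(\<lambda>(a, b). a \<otimes>\<^bsub>R\<^esub> b) ` (E \<times> E') \<subseteq> p \<longleftrightarrow> E \<subseteq> p \<or> E' \<subseteq> p"
      by (simp add: image_subset_iff)
    with True show ?thesis by (simp add: spec_open_def)
  qed (simp add: spec_open_def)
  have "istopology (\<lambda>U. \<exists>E \<subseteq> carrier R. U = spec_open R E)"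
    unfolding istopology_def
  proof (intro conjI allI impI)
    fix S T assume "\<exists>E\<subseteq>carrier R. S = spec_open R E" "\<exists>E\<subseteq>carrier R. T = spec_open R E"
    then obtain E E' where E: "E \<subseteq> carrier R" "S = spec_open R E"
      "E' \<subseteq> carrier R" "T = spec_open R E'" by blast
    show "\<exists>E\<subseteq>carrier R. S \<inter> T = spec_open R E"
    proof (cases "S \<inter> T = {}")
      case True
      then show ?thesis by (intro exI[of _ "{}"]) (simp add: spec_open_def)
    next
      case False
      then obtain p where "primeideal p R"
        using E(2) by (fastforce simp: spec_open_def)
      then interpret primeideal p R .
      have "a \<otimes>\<^bsub>R\<^esub> b \<in> carrier R" if "a \<in> E" "b \<in> E'" for a b
        using that E(1,3) by (intro m_closed) blast+
      then have "(\<lambda>(a, b). a \<otimes>\<^bsub>R\<^esub> b) ` (E \<times> E') \<subseteq> carrier R"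
        by (simp add: image_subset_iff)
      moreover have "S \<inter> T = spec_open R ((\<lambda>(a, b). a \<otimes>\<^bsub>R\<^esub> b) ` (E \<times> E'))"
        unfolding E(2,4) by (rule Set.set_eqI) (rule inter[OF E(1,3)])
      ultimately show ?thesis by blast
    qed
  next
    fix K assume "\<forall>U\<in>K. \<exists>E\<subseteq>carrier R. U = spec_open R E"
    then have "\<exists>e. \<forall>U\<in>K. e U \<subseteq> carrier R \<and> U = spec_open R (e U)"
      by (intro bchoice) blast
    then obtain e where e: "\<forall>U\<in>K. e U \<subseteq> carrier R \<and> U = spec_open R (e U)" ..
    have "(\<Union>U\<in>K. spec_open R (e U)) = spec_open R (\<Union>U\<in>K. e U)"
      unfolding spec_open_def by blast
    moreover have "(\<Union>U\<in>K. spec_open R (e U)) = (\<Union>U\<in>K. U)"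
      using e by (intro SUP_cong) simp_all
    ultimately have "\<Union>K = spec_open R (\<Union>U\<in>K. e U)" by simp
    moreover have "(\<Union>U\<in>K. e U) \<subseteq> carrier R" using e by blast
    ultimately show "\<exists>E\<subseteq>carrier R. \<Union>K = spec_open R E" by blast
  qed
  then show ?thesis by (simp add: zariski_def)
qed

lemma topspace_zariski: "topspace (zariski R) = {p. primeideal p R}"
proof (rule equalityI)
  have "\<not> carrier R \<subseteq> p" if "primeideal p R" for p
  proof -
    interpret primeideal p R by (rule that)
    show ?thesis using I_notcarr a_subset by blast
  qed
  then have "{p. primeideal p R} = spec_open R (carrier R)"
    unfolding spec_open_def by blast
  then have "openin (zariski R) {p. primeideal p R}"
    unfolding openin_zariski by blast
  then show "{p. primeideal p R} \<subseteq> topspace (zariski R)"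
    by (rule openin_subset)
  have "openin (zariski R) (topspace (zariski R))" by simp
  then show "topspace (zariski R) \<subseteq> {p. primeideal p R}"
    unfolding openin_zariski spec_open_def by blast
qed

text \<open>A section of the structure sheaf over \<open>U\<close> is a function assigning to each \<open>p \<in> U\<close> an
  element of the localization at \<open>p\<close> that is locally given by a single fraction \<open>a / g\<close>.\<close>

type_synonym 'r spec_section = "'r set \<Rightarrow> ('r \<times> 'r) set"

definition spec_sections ::
    "('r, 'x) ring_scheme \<Rightarrow> 'r set set \<Rightarrow> 'r spec_section ring" where
  "spec_sections R U =
    \<lparr>carrier = {s \<in> (\<Pi>\<^sub>E p \<in> U. carrier (localization R p)).
       \<forall>p \<in> U. \<exists>V. openin (zariski R) V \<and> p \<in> V \<and> V \<subseteq> U \<and>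
         (\<exists>a \<in> carrier R. \<exists>g \<in> carrier R. \<forall>q \<in> V. g \<notin> q \<and> s q = fraction R q a g)},
     mult = (\<lambda>s t. \<lambda>p \<in> U. s p \<otimes>\<^bsub>localization R p\<^esub> t p),
     one = (\<lambda>p \<in> U. \<one>\<^bsub>localization R p\<^esub>),
     zero = (\<lambda>p \<in> U. \<zero>\<^bsub>localization R p\<^esub>),
     add = (\<lambda>s t. \<lambda>p \<in> U. s p \<oplus>\<^bsub>localization R p\<^esub> t p)\<rparr>"

definition Spec :: "('r, 'x) ring_scheme \<Rightarrow> ('r set, 'r spec_section) ringed" where
  "Spec R = \<lparr>base = zariski R, sec = spec_sections R, res = (\<lambda>U V s. restrict s V)\<rparr>"

text \<open>The morphism \<open>Spec S \<rightarrow> Spec R\<close> induced by a ring homomorphism \<open>\<phi> : R \<rightarrow> S\<close>.\<close>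

definition Spec_map :: "('r, 'x) ring_scheme \<Rightarrow> ('s, 'y) ring_scheme \<Rightarrow> ('r \<Rightarrow> 's) \<Rightarrow>
    ('s set, 's spec_section, 'r set, 'r spec_section) mor" where
  "Spec_map R S \<phi> =
    (let f = (\<lambda>p \<in> topspace (zariski S). {r \<in> carrier R. \<phi> r \<in> p})
     in (f, (\<lambda>V \<in> {V. openin (zariski R) V}. \<lambda>s \<in> carrier (spec_sections R V).
               \<lambda>p \<in> preim (Spec S) f V. localization_map S p \<phi> (s (f p)))))"

text \<open>Requiring the ring \<open>R\<close> below to have elements of type \<^typ>\<open>'b\<close> is no restriction: if
  \<open>open_subspace X U\<close> is isomorphic to \<open>Spec R\<close> for a ring \<open>R\<close> over any type, then \<open>R\<close> is
  isomorphic to \<open>sec X U\<close>.\<close>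

locale scheme = locally_ringed_space X for X :: "('a, 'b) ringed" +
  assumes locally_affine: "x \<in> topspace (base X) \<Longrightarrow>
    \<exists>U. openin (base X) U \<and> x \<in> U \<and>
      (\<exists>R :: 'b ring. cring R \<and> isomorphic (open_subspace X U) (Spec R))"


section \<open>Diagrams of schemes and their colimits\<close>

text \<open>Diagrams indexed by a graph.\<close>

record ('v, 'e, 'a, 'b) diagram =
  verts :: "'v set"
  edges :: "'e set"
  src :: "'e \<Rightarrow> 'v"
  tgt :: "'e \<Rightarrow> 'v"
  obj :: "'v \<Rightarrow> ('a, 'b) ringed"
  arr :: "'e \<Rightarrow> ('a, 'b, 'a, 'b) mor"

definition scheme_diagram :: "('v, 'e, 'a, 'b) diagram \<Rightarrow> bool" where
  "scheme_diagram \<Delta> \<longleftrightarrow>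
     (\<forall>v \<in> verts \<Delta>. scheme (obj \<Delta> v)) \<and>
     (\<forall>e \<in> edges \<Delta>. src \<Delta> e \<in> verts \<Delta> \<and> tgt \<Delta> e \<in> verts \<Delta> \<and>
        arr \<Delta> e \<in> Hom (obj \<Delta> (src \<Delta> e)) (obj \<Delta> (tgt \<Delta> e)))"

definition cocone :: "('v, 'e, 'a, 'b) diagram \<Rightarrow> ('c, 'd) ringed \<Rightarrow>
    ('v \<Rightarrow> ('a, 'b, 'c, 'd) mor) \<Rightarrow> bool" where
  "cocone \<Delta> T \<kappa> \<longleftrightarrow>
     scheme T \<and>
     (\<forall>v \<in> verts \<Delta>. \<kappa> v \<in> Hom (obj \<Delta> v) T) \<and>
     (\<forall>e \<in> edges \<Delta>.
        mor_comp (obj \<Delta> (src \<Delta> e)) (obj \<Delta> (tgt \<Delta> e)) T (\<kappa> (tgt \<Delta> e)) (arr \<Delta> e)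
          = \<kappa> (src \<Delta> e))"

text \<open>\<open>is_colimit TYPE('c) TYPE('d) \<Delta> X \<iota>\<close>: the scheme \<open>X\<close> with the morphisms \<open>\<iota> v\<close> is a
  cocone on \<open>\<Delta>\<close>, universal among all cocones whose apex has points of type \<^typ>\<open>'c\<close> and
  sections of type \<^typ>\<open>'d\<close>. (A quantifier inside a formula cannot range over types.)\<close>

definition is_colimit :: "'c itself \<Rightarrow> 'd itself \<Rightarrow> ('v, 'e, 'a, 'b) diagram \<Rightarrow>
    ('p, 'q) ringed \<Rightarrow> ('v \<Rightarrow> ('a, 'b, 'p, 'q) mor) \<Rightarrow> bool" where
  "is_colimit _ _ \<Delta> X \<iota> \<longleftrightarrow>
     scheme_diagram \<Delta> \<and> cocone \<Delta> X \<iota> \<and>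
     (\<forall>(T :: ('c, 'd) ringed) \<kappa>. cocone \<Delta> T \<kappa> \<longrightarrow>
        (\<exists>!h. h \<in> Hom X T \<and> (\<forall>v \<in> verts \<Delta>. mor_comp (obj \<Delta> v) X T h (\<iota> v) = \<kappa> v)))"


section \<open>Monoids and monoid algebras\<close>

definition add_submonoid :: "'m::comm_monoid_add set \<Rightarrow> bool" where
  "add_submonoid N \<longleftrightarrow> 0 \<in> N \<and> (\<forall>x \<in> N. \<forall>y \<in> N. x + y \<in> N)"

text \<open>Cancellativity is automatic for submonoids of a group.\<close>

definition fine_submonoid :: "'m::comm_monoid_add set \<Rightarrow> bool" where
  "fine_submonoid N \<longleftrightarrow> add_submonoid N \<and>
     (\<exists>S. finite S \<and> N = add_submonoid hull S) \<and>
     (\<forall>x \<in> N. \<forall>y \<in> N. \<forall>z \<in> N. x + z = y + z \<longrightarrow> x = y)"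

text \<open>\<open>\<int>[N]\<close> for a submonoid \<open>N\<close> of \<^typ>\<open>'m\<close>, as a subring of \<open>\<int>[M]\<close>: multiplication on
  \<^typ>\<open>'m \<Rightarrow>\<^sub>0 int\<close> is convolution.\<close>

definition monoid_algebra :: "'m::comm_monoid_add set \<Rightarrow> ('m \<Rightarrow>\<^sub>0 int) ring" where
  "monoid_algebra N =
    \<lparr>carrier = {p. Poly_Mapping.keys p \<subseteq> N}, mult = (*), one = 1, zero = 0, add = (+)\<rparr>"

definition A_scheme :: "'m::comm_monoid_add set \<Rightarrow>
    (('m \<Rightarrow>\<^sub>0 int) set, ('m \<Rightarrow>\<^sub>0 int) spec_section) ringed" where
  "A_scheme N = Spec (monoid_algebra N)"

text \<open>The scheme underlying the diagonalizable group \<open>D(G)\<close>; the group structure plays no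
  role in a diagram of schemes.\<close>

definition D_scheme :: "'m::ab_group_add set \<Rightarrow>
    (('m \<Rightarrow>\<^sub>0 int) set, ('m \<Rightarrow>\<^sub>0 int) spec_section) ringed" where
  "D_scheme G = A_scheme G"

text \<open>The diagram of the morphisms \<open>D(G) \<rightarrow> A(N\<^sub>\<tau>)\<close> dual to the inclusions \<open>N\<^sub>\<tau> \<subseteq> G\<close>:
  the vertex \<open>None\<close> carries \<open>D(G)\<close> and the vertex \<open>Some \<tau>\<close> carries \<open>A(N\<^sub>\<tau>)\<close>.\<close>

definition gluing_diagram :: "'i set \<Rightarrow> ('i \<Rightarrow> 'm set) \<Rightarrow> 'm::ab_group_add set \<Rightarrow>
    ('i option, 'i, ('m \<Rightarrow>\<^sub>0 int) set, ('m \<Rightarrow>\<^sub>0 int) spec_section) diagram" where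
  "gluing_diagram I N G =
    \<lparr>verts = insert None (Some ` I),
     edges = I,
     src = (\<lambda>\<tau>. None),
     tgt = Some,
     obj = (\<lambda>v. case v of None \<Rightarrow> D_scheme G | Some \<tau> \<Rightarrow> A_scheme (N \<tau>)),
     arr = (\<lambda>\<tau>. Spec_map (monoid_algebra (N \<tau>)) (monoid_algebra G) (\<lambda>x. x))\<rparr>"

text \<open>Types for the points and the sections of a colimit of a diagram with vertices \<^typ>\<open>'v\<close>
  of schemes with points \<^typ>\<open>'a\<close> and sections \<^typ>\<open>'b\<close>: a point is represented by a
  point of some object, a section by a family of sections on the objects.

  To say that \<open>X\<close> is a colimit among the schemes of all types, one states \<open>is_colimit\<close> both
  for the types of \<open>X\<close> itself and for arbitrary type variables \<^typ>\<open>'c\<close> and \<^typ>\<open>'d\<close>. The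
  first part determines \<open>X\<close> with its cocone up to unique isomorphism, so that the choice of
  \<open>X\<close> does not depend on \<^typ>\<open>'c\<close> and \<^typ>\<open>'d\<close>.\<close>

type_synonym ('v, 'a) glued_point = "'v \<times> 'a"
type_synonym ('v, 'b) glued_section = "'v \<Rightarrow> 'b"

end

(*
  A fine monoid N with group N^gp is generated by a finite set; if f is the sum of the generators,
  then Z[N^gp] is the localization of Z[N] at the character of f, so D(N^gp) -> A(N) is an open
  immersion.  The colimit is obtained by gluing all the A(N_tau) along D(N^gp): its sections over
  an open set are the compatible families of sections over the pieces.  The insertions are open
  immersions, hence isomorphisms on stalks, so the glued space is a scheme, and a morphism out of
  it is local as soon as its restrictions to the pieces are.
*)
theory Submission
  imports Defs "HOL-Algebra.Weak_Morphisms"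
begin

text \<open>Any two pieces meet in the same open subscheme D(N^gp), so no cocycle condition arises:
  a family of points, sections or morphisms on the pieces is compatible as soon as all its members
  have the same trace on D(N^gp). D(N^gp) itself counts as a piece, attached by its identity; it
  supplies the vertex \<open>None\<close> and a distinguished name for every identified point.

  The multiplicative set actually inverted is the set of all characters of N, whereas openness of
  the image requires a single element. The link is that a prime avoiding the character of f avoids
  all characters, because the generators divide f in N.

  The types shape the chart argument: a chart ring must live on the type of sections of the space,
  but sections of the glued space are families of functions. Chart rings are therefore copied along
  an injection of types, and a ring isomorphism is treated as the localization at one, so that a
  single theorem on open immersions of spectra covers both uses.\<close>

lemma UN_pair_const:
  assumes "(u, s) \<in> A" "\<And>u s. (u, s) \<in> A \<Longrightarrow> G u s = c"
  shows "(\<Union>(u, s) \<in> A. G u s) = c"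
  using assms by fast

text \<open>The ring laws hold in every factor, so only closure is left to check. This serves the
  sections of \<open>Spec\<close>, computed in localizations, and those of the glued space, computed
  in the pieces. Negatives appear as an explicit pointwise formula because the inverse operation of
  \<open>S\<close> is meaningful only once \<open>S\<close> is known to be a group.\<close>

lemma cring_pointwise:
  fixes S :: "('i \<Rightarrow> 'r) ring"
  assumes L: "\<And>i. i \<in> A \<Longrightarrow> cring (L i)"
    and sub: "carrier S \<subseteq> (\<Pi>\<^sub>E i \<in> A. carrier (L i))"
    and ops: "\<one>\<^bsub>S\<^esub> = (\<lambda>i \<in> A. \<one>\<^bsub>L i\<^esub>)" "\<zero>\<^bsub>S\<^esub> = (\<lambda>i \<in> A. \<zero>\<^bsub>L i\<^esub>)"
      "\<And>s t. s \<otimes>\<^bsub>S\<^esub> t = (\<lambda>i \<in> A. s i \<otimes>\<^bsub>L i\<^esub> t i)" "\<And>s t. s \<oplus>\<^bsub>S\<^esub> t = (\<lambda>i \<in> A. s i \<oplus>\<^bsub>L i\<^esub> t i)"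
    and closed: "\<one>\<^bsub>S\<^esub> \<in> carrier S" "\<zero>\<^bsub>S\<^esub> \<in> carrier S"
      "\<And>s t. \<lbrakk>s \<in> carrier S; t \<in> carrier S\<rbrakk> \<Longrightarrow> s \<otimes>\<^bsub>S\<^esub> t \<in> carrier S"
      "\<And>s t. \<lbrakk>s \<in> carrier S; t \<in> carrier S\<rbrakk> \<Longrightarrow> s \<oplus>\<^bsub>S\<^esub> t \<in> carrier S"
      "\<And>s. s \<in> carrier S \<Longrightarrow> (\<lambda>i \<in> A. \<ominus>\<^bsub>L i\<^esub> s i) \<in> carrier S"
  shows "cring S"
proof -
  have L': "monoid (L i)" "abelian_monoid (L i)" "abelian_group (L i)" if "i \<in> A" for i
    using L[OF that] by (auto simp: cring_def ring_def abelian_group_def)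
  have val: "s i \<in> carrier (L i)" if "s \<in> carrier S" "i \<in> A" for s i
    using sub that by blast
  have ext: "s \<in> extensional A" if "s \<in> carrier S" for s
    using subsetD[OF sub that] by (simp add: PiE_iff)
  have eqI: "s = t" if "s \<in> carrier S" "t \<in> carrier S" "\<And>i. i \<in> A \<Longrightarrow> s i = t i" for s t
    by (rule extensionalityI[OF ext[OF that(1)] ext[OF that(2)] that(3)])
  note simps = ops val cring.cring_simprules[OF L] monoid.r_one[OF L'(1)]
    abelian_monoid.r_zero[OF L'(2)] abelian_group.r_neg[OF L'(3)]
  show ?thesis
  proof (intro cringI abelian_groupI comm_monoidI)
    fix s assume "s \<in> carrier S"
    then show "\<exists>t \<in> carrier S. t \<oplus>\<^bsub>S\<^esub> s = \<zero>\<^bsub>S\<^esub>"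
      by (intro bexI[of _ "\<lambda>i \<in> A. \<ominus>\<^bsub>L i\<^esub> s i"] eqI closed) (simp_all add: simps)
  qed (intro closed; assumption | (rule eqI, (intro closed; assumption | assumption)+, simp add: simps))+
qed

section \<open>Stalks and morphisms of ringed spaces\<close>

context ringed_space
begin

lemma res_closed:
  "\<lbrakk>openin (base X) U; openin (base X) V; V \<subseteq> U; s \<in> carrier (sec X U)\<rbrakk>
    \<Longrightarrow> res X U V s \<in> carrier (sec X V)"
  by (rule ring_hom_closed[OF res_hom])

lemma germ_self:
  "\<lbrakk>openin (base X) U; x \<in> U; s \<in> carrier (sec X U)\<rbrakk> \<Longrightarrow> (U, s) \<in> germ X x U s"
  unfolding germ_def by blast

text \<open>This is transitivity of agreement near x: a third section that agrees with s on some W'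
  agrees with t on the intersection of W and W'. As an inclusion it can be used twice, by symmetry,
  to get equality of classes.\<close>

lemma germ_subset:
  assumes U: "openin (base X) U" "s \<in> carrier (sec X U)"
    and V: "openin (base X) V" "t \<in> carrier (sec X V)"
    and W: "openin (base X) W" "x \<in> W" "W \<subseteq> U \<inter> V" "res X U W s = res X V W t"
  shows "germ X x U s \<subseteq> germ X x V t"
proof (rule subrelI)
  fix V' t' assume "(V', t') \<in> germ X x U s"
  then obtain W' where V': "openin (base X) V'" "x \<in> V'" "t' \<in> carrier (sec X V')"
    and W': "openin (base X) W'" "x \<in> W'" "W' \<subseteq> U \<inter> V'" "res X U W' s = res X V' W' t'"
    unfolding germ_def by blast
  let ?W = "W \<inter> W'"
  have o: "openin (base X) ?W" using W W' by blast
  have "res X V ?W t = res X W ?W (res X V W t)"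
    using res_res[of V W ?W t] V W o by simp
  also have "\<dots> = res X U ?W s"
    using res_res[of U W ?W s] U W o by simp
  also have "\<dots> = res X W' ?W (res X U W' s)"
    using res_res[of U W' ?W s] U W' o by simp
  also have "\<dots> = res X V' ?W t'"
    using res_res[of V' W' ?W t'] V' W' o by simp
  finally show "(V', t') \<in> germ X x V t"
    unfolding germ_def using V' W W' o by blast
qed

lemma germ_eqI:
  assumes "openin (base X) U" "s \<in> carrier (sec X U)"
    and "openin (base X) V" "t \<in> carrier (sec X V)"
    and "openin (base X) W" "x \<in> W" "W \<subseteq> U \<inter> V" "res X U W s = res X V W t"
  shows "germ X x U s = germ X x V t"
  using assms by (intro equalityI germ_subset[of _ _ _ _ W]) auto

lemma germ_eqD:
  assumes "openin (base X) V" "x \<in> V" "t \<in> carrier (sec X V)"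
    and "germ X x U s = germ X x V t"
  obtains W where "openin (base X) W" "x \<in> W" "W \<subseteq> U" "W \<subseteq> V" "res X U W s = res X V W t"
proof -
  have "(V, t) \<in> germ X x U s" using assms germ_self by simp
  then show ?thesis using that unfolding germ_def by auto
qed

lemma germ_res:
  assumes "openin (base X) U" "openin (base X) W" "x \<in> W" "W \<subseteq> U" "s \<in> carrier (sec X U)"
  shows "germ X x W (res X U W s) = germ X x U s"
proof (rule germ_eqI[of _ _ _ _ W])
  show "res X W W (res X U W s) = res X U W s"
    using assms res_id res_closed by blast
qed (use assms res_closed in auto)

lemma stalk_carrierI:
  "\<lbrakk>openin (base X) U; x \<in> U; s \<in> carrier (sec X U)\<rbrakk> \<Longrightarrow> germ X x U s \<in> carrier (stalk X x)"
  unfolding stalk_def by auto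

lemma stalk_carrierE:
  assumes "A \<in> carrier (stalk X x)"
  obtains U s where "openin (base X) U" "x \<in> U" "s \<in> carrier (sec X U)" "A = germ X x U s"
  using assms unfolding stalk_def by auto

text \<open>On one neighbourhood carrying all three representatives, a ring identity between germs
  becomes the same identity in a single ring of sections.\<close>

lemma stalk_carrierE3:
  assumes "A \<in> carrier (stalk X x)" "B \<in> carrier (stalk X x)" "C \<in> carrier (stalk X x)"
  obtains U s t r where "openin (base X) U" "x \<in> U"
    "s \<in> carrier (sec X U)" "t \<in> carrier (sec X U)" "r \<in> carrier (sec X U)"
    "A = germ X x U s" "B = germ X x U t" "C = germ X x U r"
proof -
  obtain U s V t W r where U: "openin (base X) U" "x \<in> U" "s \<in> carrier (sec X U)" "A = germ X x U s"
    and V: "openin (base X) V" "x \<in> V" "t \<in> carrier (sec X V)" "B = germ X x V t"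
    and W: "openin (base X) W" "x \<in> W" "r \<in> carrier (sec X W)" "C = germ X x W r"
    using assms by (elim stalk_carrierE) (rule that)
  let ?I = "U \<inter> V \<inter> W"
  have "openin (base X) ?I" "x \<in> ?I" "?I \<subseteq> U" "?I \<subseteq> V" "?I \<subseteq> W" using U V W by auto
  then show thesis
    using U V W that[of ?I "res X U ?I s" "res X V ?I t" "res X W ?I r"]
    by (simp add: res_closed germ_res)
qed

lemma stalk_carrierE2:
  assumes "A \<in> carrier (stalk X x)" "B \<in> carrier (stalk X x)"
  obtains U s t where "openin (base X) U" "x \<in> U" "s \<in> carrier (sec X U)" "t \<in> carrier (sec X U)"
    "A = germ X x U s" "B = germ X x U t"
  using assms(1,2,2) by (rule stalk_carrierE3) (rule that)

text \<open>Stated for an arbitrary operation so as to cover addition and multiplication at once.\<close>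

lemma germ_binop:
  assumes closed: "\<And>U s t. \<lbrakk>openin (base X) U; s \<in> carrier (sec X U); t \<in> carrier (sec X U)\<rbrakk>
      \<Longrightarrow> f (sec X U) s t \<in> carrier (sec X U)"
    and natural: "\<And>U V s t. \<lbrakk>openin (base X) U; openin (base X) V; V \<subseteq> U;
        s \<in> carrier (sec X U); t \<in> carrier (sec X U)\<rbrakk>
      \<Longrightarrow> res X U V (f (sec X U) s t) = f (sec X V) (res X U V s) (res X U V t)"
    and U: "openin (base X) U" "x \<in> U" "s \<in> carrier (sec X U)" "t \<in> carrier (sec X U)"
  shows "(\<Union>(U', s') \<in> germ X x U s. \<Union>(V', t') \<in> germ X x U t.
      germ X x (U' \<inter> V') (f (sec X (U' \<inter> V')) (res X U' (U' \<inter> V') s') (res X V' (U' \<inter> V') t')))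
    = germ X x U (f (sec X U) s t)"
proof -
  have *: "germ X x (U' \<inter> V')
      (f (sec X (U' \<inter> V')) (res X U' (U' \<inter> V') s') (res X V' (U' \<inter> V') t'))
      = germ X x U (f (sec X U) s t)"
    if s': "(U', s') \<in> germ X x U s" and t': "(V', t') \<in> germ X x U t" for U' s' V' t'
  proof -
    obtain W1 where U': "openin (base X) U'" "x \<in> U'" "s' \<in> carrier (sec X U')"
      and W1: "openin (base X) W1" "x \<in> W1" "W1 \<subseteq> U \<inter> U'" "res X U W1 s = res X U' W1 s'"
      using s' unfolding germ_def by blast
    obtain W2 where V': "openin (base X) V'" "x \<in> V'" "t' \<in> carrier (sec X V')"
      and W2: "openin (base X) W2" "x \<in> W2" "W2 \<subseteq> U \<inter> V'" "res X U W2 t = res X V' W2 t'"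
      using t' unfolding germ_def by blast
    \<comment> \<open>The definition of the stalk operations combines the new representatives on
      \<open>?I\<close>; on \<open>?W\<close> they agree with the old ones s and t.\<close>
    let ?W = "W1 \<inter> W2" and ?I = "U' \<inter> V'"
    have o: "openin (base X) ?W" "openin (base X) ?I" using W1 W2 U' V' by auto
    have s1: "res X U ?W s = res X U' ?W s'"
      using res_res[of U W1 ?W s] res_res[of U' W1 ?W s'] U U' W1 o by simp
    have t1: "res X U ?W t = res X V' ?W t'"
      using res_res[of U W2 ?W t] res_res[of V' W2 ?W t'] U V' W2 o by simp
    have cl: "res X U' ?I s' \<in> carrier (sec X ?I)" "res X V' ?I t' \<in> carrier (sec X ?I)"
      using U' V' o by (auto intro!: res_closed)
    show ?thesis
    proof (rule germ_eqI[of _ _ _ _ ?W])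
      have "?W \<subseteq> ?I" "?W \<subseteq> U" using W1 W2 by auto
      then show "res X ?I ?W (f (sec X ?I) (res X U' ?I s') (res X V' ?I t'))
          = res X U ?W (f (sec X U) s t)"
        using natural[OF o(2,1) _ cl] natural[OF U(1) o(1) _ U(3,4)] s1 t1
          res_res[OF U'(1) o(2,1) _ _ U'(3)] res_res[OF V'(1) o(2,1) _ _ V'(3)] by simp
    qed (use U W1 W2 o cl closed in auto)
  qed
  have "(U, s) \<in> germ X x U s" "(U, t) \<in> germ X x U t" using germ_self U by auto
  with * show ?thesis by (intro UN_pair_const)
qed

lemma
  assumes "openin (base X) U" "x \<in> U" "s \<in> carrier (sec X U)" "t \<in> carrier (sec X U)"
  shows stalk_mult: "germ X x U s \<otimes>\<^bsub>stalk X x\<^esub> germ X x U t = germ X x U (s \<otimes>\<^bsub>sec X U\<^esub> t)"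
    and stalk_add: "germ X x U s \<oplus>\<^bsub>stalk X x\<^esub> germ X x U t = germ X x U (s \<oplus>\<^bsub>sec X U\<^esub> t)"
proof -
  have closed: "s \<otimes>\<^bsub>sec X U\<^esub> t \<in> carrier (sec X U)" "s \<oplus>\<^bsub>sec X U\<^esub> t \<in> carrier (sec X U)"
    if "openin (base X) U" "s \<in> carrier (sec X U)" "t \<in> carrier (sec X U)" for U s t
    using that cring.cring_simprules(1,5)[OF sec_cring] by blast+
  show "germ X x U s \<otimes>\<^bsub>stalk X x\<^esub> germ X x U t = germ X x U (s \<otimes>\<^bsub>sec X U\<^esub> t)"
    using germ_binop[of mult, OF closed(1) ring_hom_mult[OF res_hom] assms] by (simp add: stalk_def)
  show "germ X x U s \<oplus>\<^bsub>stalk X x\<^esub> germ X x U t = germ X x U (s \<oplus>\<^bsub>sec X U\<^esub> t)"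
    using germ_binop[of add, OF closed(2) ring_hom_add[OF res_hom] assms] by (simp add: stalk_def)
qed

lemma res_one:
  "\<lbrakk>openin (base X) U; openin (base X) V; V \<subseteq> U\<rbrakk> \<Longrightarrow> res X U V \<one>\<^bsub>sec X U\<^esub> = \<one>\<^bsub>sec X V\<^esub>"
  by (rule ring_hom_one[OF res_hom])

lemma res_zero:
  assumes "openin (base X) U" "openin (base X) V" "V \<subseteq> U"
  shows "res X U V \<zero>\<^bsub>sec X U\<^esub> = \<zero>\<^bsub>sec X V\<^esub>"
proof -
  interpret ring_hom_cring "sec X U" "sec X V" "res X U V"
    using assms sec_cring res_hom by (simp add: ring_hom_cring_def ring_hom_cring_axioms_def)
  show ?thesis by (rule hom_zero)
qed

text \<open>The definition of the stalk takes its neutral elements over the whole space. Restricting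
  them to an arbitrary neighbourhood makes them comparable with sections that exist only
  there.\<close>

lemma
  assumes "openin (base X) U" "x \<in> U"
  shows stalk_one: "\<one>\<^bsub>stalk X x\<^esub> = germ X x U \<one>\<^bsub>sec X U\<^esub>"
    and stalk_zero: "\<zero>\<^bsub>stalk X x\<^esub> = germ X x U \<zero>\<^bsub>sec X U\<^esub>"
proof -
  let ?T = "topspace (base X)"
  interpret cring "sec X ?T" by (simp add: sec_cring)
  show "\<one>\<^bsub>stalk X x\<^esub> = germ X x U \<one>\<^bsub>sec X U\<^esub>" "\<zero>\<^bsub>stalk X x\<^esub> = germ X x U \<zero>\<^bsub>sec X U\<^esub>"
    using germ_res[of ?T U x "\<one>\<^bsub>sec X ?T\<^esub>"] germ_res[of ?T U x "\<zero>\<^bsub>sec X ?T\<^esub>"] res_one[of ?T U]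
      res_zero[of ?T U] openin_subset[OF assms(1)] assms by (simp_all add: stalk_def)
qed

lemma stalk_cring:
  assumes x: "x \<in> topspace (base X)"
  shows "cring (stalk X x)"
proof (intro cringI abelian_groupI comm_monoidI)
  interpret top: cring "sec X (topspace (base X))" by (simp add: sec_cring)
  show "\<one>\<^bsub>stalk X x\<^esub> \<in> carrier (stalk X x)" "\<zero>\<^bsub>stalk X x\<^esub> \<in> carrier (stalk X x)"
    using x by (auto simp: stalk_one[of "topspace (base X)"] stalk_zero[of "topspace (base X)"]
        intro!: stalk_carrierI)
next
  fix A assume "A \<in> carrier (stalk X x)"
  then obtain U s where U: "openin (base X) U" "x \<in> U" "s \<in> carrier (sec X U)" "A = germ X x U s"
    by (rule stalk_carrierE)
  interpret cring "sec X U" using U sec_cring by blast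
  show "\<one>\<^bsub>stalk X x\<^esub> \<otimes>\<^bsub>stalk X x\<^esub> A = A" "\<zero>\<^bsub>stalk X x\<^esub> \<oplus>\<^bsub>stalk X x\<^esub> A = A"
    using U by (simp_all add: stalk_one[of U] stalk_zero[of U] stalk_mult stalk_add)
  have "germ X x U (\<ominus>\<^bsub>sec X U\<^esub> s) \<oplus>\<^bsub>stalk X x\<^esub> A = \<zero>\<^bsub>stalk X x\<^esub>"
    using U by (simp add: stalk_zero[of U] stalk_add l_neg)
  then show "\<exists>B \<in> carrier (stalk X x). B \<oplus>\<^bsub>stalk X x\<^esub> A = \<zero>\<^bsub>stalk X x\<^esub>"
    using U stalk_carrierI by blast
next
  fix A B assume "A \<in> carrier (stalk X x)" "B \<in> carrier (stalk X x)"
  then obtain U s t where U: "openin (base X) U" "x \<in> U" "s \<in> carrier (sec X U)"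
    "t \<in> carrier (sec X U)" "A = germ X x U s" "B = germ X x U t"
    by (rule stalk_carrierE2)
  interpret cring "sec X U" using U sec_cring by blast
  show "A \<otimes>\<^bsub>stalk X x\<^esub> B \<in> carrier (stalk X x)" "A \<oplus>\<^bsub>stalk X x\<^esub> B \<in> carrier (stalk X x)"
    "A \<otimes>\<^bsub>stalk X x\<^esub> B = B \<otimes>\<^bsub>stalk X x\<^esub> A" "A \<oplus>\<^bsub>stalk X x\<^esub> B = B \<oplus>\<^bsub>stalk X x\<^esub> A"
    using U by (simp_all add: stalk_mult stalk_add stalk_carrierI m_comm a_comm)
next
  fix A B C
  assume "A \<in> carrier (stalk X x)" "B \<in> carrier (stalk X x)" "C \<in> carrier (stalk X x)"
  then obtain U s t r where U: "openin (base X) U" "x \<in> U" "s \<in> carrier (sec X U)"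
    "t \<in> carrier (sec X U)" "r \<in> carrier (sec X U)"
    "A = germ X x U s" "B = germ X x U t" "C = germ X x U r"
    by (rule stalk_carrierE3)
  interpret cring "sec X U" using U sec_cring by blast
  show "A \<otimes>\<^bsub>stalk X x\<^esub> B \<otimes>\<^bsub>stalk X x\<^esub> C = A \<otimes>\<^bsub>stalk X x\<^esub> (B \<otimes>\<^bsub>stalk X x\<^esub> C)"
    "A \<oplus>\<^bsub>stalk X x\<^esub> B \<oplus>\<^bsub>stalk X x\<^esub> C = A \<oplus>\<^bsub>stalk X x\<^esub> (B \<oplus>\<^bsub>stalk X x\<^esub> C)"
    "(A \<oplus>\<^bsub>stalk X x\<^esub> B) \<otimes>\<^bsub>stalk X x\<^esub> C
      = A \<otimes>\<^bsub>stalk X x\<^esub> C \<oplus>\<^bsub>stalk X x\<^esub> B \<otimes>\<^bsub>stalk X x\<^esub> C"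
    using U by (simp_all add: stalk_mult stalk_add m_assoc a_assoc l_distr)
qed

end

section \<open>Ring isomorphisms and local rings\<close>

text \<open>For a general homomorphism the preimage of a maximal ideal need not be maximal. Here an
  ideal J above the preimage is pulled back along the inverse of h to an ideal above m, where
  maximality of m decides.\<close>

lemma ring_iso_maximalideal_vimage:
  assumes R: "cring R" and S: "cring S" and h: "h \<in> ring_iso R S" and m: "maximalideal m S"
  shows "maximalideal {r \<in> carrier R. h r \<in> m} R"
proof -
  interpret m: maximalideal m S by fact
  have hom: "h \<in> ring_hom R S" and bij: "bij_betw h (carrier R) (carrier S)"
    using h by (auto simp: ring_iso_def)
  interpret h: ring_hom_ring R S h
    using R S hom by (simp add: ring_hom_ring_def ring_hom_ring_axioms_def cring_def)
  define g where "g = inv_into (carrier R) h"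
  have g: "g \<in> ring_iso S R"
    unfolding g_def using h ring_iso_set_sym[of R] R cring.axioms(1) by blast
  interpret g: ring_hom_ring S R g
    using R S g by (simp add: ring_hom_ring_def ring_hom_ring_axioms_def cring_def ring_iso_def)
  have gh: "g (h r) = r" if "r \<in> carrier R" for r
    using bij that by (simp add: g_def bij_betw_def)
  have hg: "h (g s) = s" if "s \<in> carrier S" for s
    using bij that by (simp add: g_def bij_betw_inv_into_right)
  show ?thesis
  proof (rule maximalidealI)
    show "ideal {r \<in> carrier R. h r \<in> m} R"
      by (rule h.ideal_vimage) (rule m.ideal_axioms)
    obtain s where "s \<in> carrier S" "s \<notin> m" using m.I_notcarr m.a_subset by auto
    then have "g s \<in> carrier R" "h (g s) \<notin> m" using hg g.hom_closed by auto
    then show "carrier R \<noteq> {r \<in> carrier R. h r \<in> m}" by blast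
    fix J assume J: "ideal J R" "{r \<in> carrier R. h r \<in> m} \<subseteq> J" "J \<subseteq> carrier R"
    let ?K = "{s \<in> carrier S. g s \<in> J}"
    have "ideal ?K S" by (rule g.ideal_vimage) fact
    moreover have "m \<subseteq> ?K" using J(2) m.a_subset hg g.hom_closed by fastforce
    ultimately have "?K = m \<or> ?K = carrier S" by (rule m.I_maximal) blast
    then show "J = {r \<in> carrier R. h r \<in> m} \<or> J = carrier R"
    proof
      assume K: "?K = m"
      have "r \<in> J \<longleftrightarrow> h r \<in> m" if "r \<in> carrier R" for r
        unfolding K[symmetric] using that gh by simp
      then show ?thesis using J(3) by blast
    next
      assume K: "?K = carrier S"
      have "r \<in> J" if "r \<in> carrier R" for r
      proof -
        have "h r \<in> ?K" unfolding K using that by simp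
        then show ?thesis using gh that by simp
      qed
      then show ?thesis using J(3) by blast
    qed
  qed
qed

lemma local_ring_iso:
  assumes S: "cring S" and R: "local_ring R" and h: "h \<in> ring_iso R S"
  shows "local_ring S"
proof -
  have R': "cring R" using R by (simp add: local_ring_def)
  obtain m where m: "maximalideal m R" and u: "\<And>m'. maximalideal m' R \<Longrightarrow> m' = m"
    using R unfolding local_ring_def by blast
  have bij: "bij_betw h (carrier R) (carrier S)" using h by (simp add: ring_iso_def)
  have g: "inv_into (carrier R) h \<in> ring_iso S R" (is "?g \<in> _")
    using h ring_iso_set_sym[of R] R' cring.axioms(1) by blast
  have 1: "maximalideal {s \<in> carrier S. ?g s \<in> m} S"
    by (rule ring_iso_maximalideal_vimage[OF S R' g m])
  have "n = {s \<in> carrier S. ?g s \<in> m}" if n: "maximalideal n S" for n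
  proof -
    interpret n: maximalideal n S by fact
    have "{r \<in> carrier R. h r \<in> n} = m"
      by (intro u ring_iso_maximalideal_vimage[OF R' S h n])
    moreover have "h (?g s) = s" "?g s \<in> carrier R" if "s \<in> carrier S" for s
      using bij that by (auto simp: bij_betw_inv_into_right bij_betw_def inv_into_into)
    ultimately show ?thesis using n.a_subset by fastforce
  qed
  with 1 show ?thesis unfolding local_ring_def using S by blast
qed

lemma ring_iso_local_ring_hom:
  "\<lbrakk>cring R; cring S; h \<in> ring_iso R S\<rbrakk> \<Longrightarrow> h \<in> local_ring_hom R S"
  unfolding local_ring_hom_def
  using ring_iso_maximalideal_vimage by (auto simp: ring_iso_def)

text \<open>In the universal property j is the inverse of the stalk map of an insertion. The
  equation is asked only on the carrier, since stalk maps are not extensional.\<close>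

lemma local_ring_hom_iso_comp:
  assumes h: "h \<in> local_ring_hom A R" and j: "j \<in> ring_iso R S" and "cring R" "cring S"
    and g: "g \<in> ring_hom A S" "\<And>x. x \<in> carrier A \<Longrightarrow> g x = j (h x)"
  shows "g \<in> local_ring_hom A S"
proof -
  have hom: "h \<in> ring_hom A R" using h by (simp add: local_ring_hom_def)
  have "maximalideal {x \<in> carrier A. g x \<in> m} A" if m: "maximalideal m S" for m
  proof -
    have "maximalideal {r \<in> carrier R. j r \<in> m} R" using assms(3,4) j m by (rule ring_iso_maximalideal_vimage)
    then have "maximalideal {x \<in> carrier A. h x \<in> {r \<in> carrier R. j r \<in> m}} A"
      using h unfolding local_ring_hom_def by fast
    also have "{x \<in> carrier A. h x \<in> {r \<in> carrier R. j r \<in> m}} = {x \<in> carrier A. g x \<in> m}"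
      using g(2) ring_hom_closed[OF hom] by auto
    finally show ?thesis .
  qed
  then show ?thesis using g(1) by (simp add: local_ring_hom_def)
qed

section \<open>Morphisms of ringed spaces\<close>

text \<open>These are the conditions of \<open>Hom\<close> except locality on stalks, which
  \<open>Hom_iff\<close> adds back. Separating them allows composition and gluing to be settled
  first and locality to be deduced afterwards from isomorphisms of stalks.\<close>

locale ringed_mor = X: ringed_space X + Y: ringed_space Y
  for X :: "('a, 'b) ringed" and Y :: "('c, 'd) ringed" +
  fixes f :: "'a \<Rightarrow> 'c" and F :: "'c set \<Rightarrow> 'd \<Rightarrow> 'b"
  assumes cont: "continuous_map (base X) (base Y) f"
    and f_ext: "f \<in> extensional (topspace (base X))"
    and F_ext: "F \<in> extensional {V. openin (base Y) V}"
    and F_hom: "openin (base Y) V \<Longrightarrow> F V \<in> ring_hom (sec Y V) (sec X (preim X f V))"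
    and FV_ext: "openin (base Y) V \<Longrightarrow> F V \<in> extensional (carrier (sec Y V))"
    and F_res: "\<lbrakk>openin (base Y) V; openin (base Y) W; W \<subseteq> V; t \<in> carrier (sec Y V)\<rbrakk>
      \<Longrightarrow> F W (res Y V W t) = res X (preim X f V) (preim X f W) (F V t)"
begin

lemma preim_open: "openin (base Y) V \<Longrightarrow> openin (base X) (preim X f V)"
  unfolding preim_def by (rule openin_continuous_map_preimage[OF cont])

lemma f_closed: "x \<in> topspace (base X) \<Longrightarrow> f x \<in> topspace (base Y)"
  using cont by (auto simp: continuous_map_def)

lemma preim_mono: "V \<subseteq> W \<Longrightarrow> preim X f V \<subseteq> preim X f W"
  by (auto simp: preim_def)

lemma F_closed:
  "\<lbrakk>openin (base Y) V; t \<in> carrier (sec Y V)\<rbrakk> \<Longrightarrow> F V t \<in> carrier (sec X (preim X f V))"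
  by (rule ring_hom_closed[OF F_hom])

lemma stalk_map_germ:
  assumes x: "x \<in> topspace (base X)"
    and V: "openin (base Y) V" "f x \<in> V" "t \<in> carrier (sec Y V)"
  shows "stalk_map X (f, F) x (germ Y (f x) V t) = germ X x (preim X f V) (F V t)"
proof -
  have *: "germ X x (preim X f V') (F V' t') = germ X x (preim X f V) (F V t)"
    if mem: "(V', t') \<in> germ Y (f x) V t" for V' t'
  proof -
    obtain W where V': "openin (base Y) V'" "t' \<in> carrier (sec Y V')"
      and W: "openin (base Y) W" "f x \<in> W" "W \<subseteq> V \<inter> V'" "res Y V W t = res Y V' W t'"
      using mem unfolding germ_def by blast
    have "res X (preim X f V') (preim X f W) (F V' t') = res X (preim X f V) (preim X f W) (F V t)"
      using F_res[of V W t] F_res[of V' W t'] V V' W by simp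
    moreover have "x \<in> preim X f W" "preim X f W \<subseteq> preim X f V' \<inter> preim X f V"
      using x W by (auto simp: preim_def)
    ultimately show ?thesis
      using V V' W
      by (intro X.germ_eqI[of _ _ _ _ "preim X f W"]) (simp_all add: preim_open F_closed)
  qed
  have "(V, t) \<in> germ Y (f x) V t" using V Y.germ_self by blast
  then show ?thesis
    unfolding stalk_map_def fst_conv snd_conv using * by (rule UN_pair_const)
qed

lemma stalk_map_hom:
  assumes x: "x \<in> topspace (base X)"
  shows "stalk_map X (f, F) x \<in> ring_hom (stalk Y (f x)) (stalk X x)"
proof (rule ring_hom_memI)
  have xp: "x \<in> preim X f V" if "f x \<in> V" for V using x that by (simp add: preim_def)
  {
    fix A assume "A \<in> carrier (stalk Y (f x))"
    then obtain V t where V: "openin (base Y) V" "f x \<in> V" "t \<in> carrier (sec Y V)"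
      "A = germ Y (f x) V t"
      by (rule Y.stalk_carrierE)
    then show "stalk_map X (f, F) x A \<in> carrier (stalk X x)"
      using x by (simp add: stalk_map_germ X.stalk_carrierI preim_open xp F_closed)
  next
    fix A B assume "A \<in> carrier (stalk Y (f x))" "B \<in> carrier (stalk Y (f x))"
    then obtain V s t where V: "openin (base Y) V" "f x \<in> V" "s \<in> carrier (sec Y V)"
      "t \<in> carrier (sec Y V)" and A: "A = germ Y (f x) V s" "B = germ Y (f x) V t"
      by (rule Y.stalk_carrierE2)
    interpret cring "sec Y V" using V Y.sec_cring by blast
    note h = F_hom[OF V(1)]
    show "stalk_map X (f, F) x (A \<otimes>\<^bsub>stalk Y (f x)\<^esub> B)
        = stalk_map X (f, F) x A \<otimes>\<^bsub>stalk X x\<^esub> stalk_map X (f, F) x B"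
      unfolding A using V x
      by (simp add: Y.stalk_mult stalk_map_germ X.stalk_mult preim_open xp F_closed
          ring_hom_mult[OF h])
    show "stalk_map X (f, F) x (A \<oplus>\<^bsub>stalk Y (f x)\<^esub> B)
        = stalk_map X (f, F) x A \<oplus>\<^bsub>stalk X x\<^esub> stalk_map X (f, F) x B"
      unfolding A using V x
      by (simp add: Y.stalk_add stalk_map_germ X.stalk_add preim_open xp F_closed
          ring_hom_add[OF h])
  }
  let ?T = "topspace (base Y)"
  interpret cring "sec Y ?T" by (simp add: Y.sec_cring)
  have "\<one>\<^bsub>stalk Y (f x)\<^esub> = germ Y (f x) ?T \<one>\<^bsub>sec Y ?T\<^esub>"
    using f_closed[OF x] by (simp add: Y.stalk_one)
  then show "stalk_map X (f, F) x \<one>\<^bsub>stalk Y (f x)\<^esub> = \<one>\<^bsub>stalk X x\<^esub>"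
    using x f_closed[OF x] ring_hom_one[OF F_hom[of ?T]] X.stalk_one[of "preim X f ?T" x]
    by (simp add: stalk_map_germ preim_open xp)
qed

end

lemma Hom_iff:
  assumes "ringed_space X" "ringed_space Y"
  shows "(f, F) \<in> Hom X Y \<longleftrightarrow> ringed_mor X Y f F \<and>
    (\<forall>x \<in> topspace (base X). stalk_map X (f, F) x \<in> local_ring_hom (stalk Y (f x)) (stalk X x))"
  using assms by (auto simp: Hom_def ringed_mor_def ringed_mor_axioms_def)

section \<open>Open immersions\<close>

text \<open>An intrinsic form of "isomorphism onto an open subspace": the image carries the topology
  of X, and the sheaf map is bijective over every open set inside the image. No subspace has to be
  named, which keeps composition easy.\<close>

locale open_immersion = ringed_mor +
  assumes inj: "inj_on f (topspace (base X))"
    and open_image: "openin (base X) U \<Longrightarrow> openin (base Y) (f ` U)"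
    and F_bij: "\<lbrakk>openin (base Y) V; V \<subseteq> f ` topspace (base X)\<rbrakk>
      \<Longrightarrow> bij_betw (F V) (carrier (sec Y V)) (carrier (sec X (preim X f V)))"
begin

lemma preim_image:
  assumes "U \<subseteq> topspace (base X)" shows "preim X f (f ` U) = U"
  using assms inj by (auto simp: preim_def inj_on_def)

lemma image_preim: "V \<subseteq> f ` topspace (base X) \<Longrightarrow> f ` preim X f V = V"
  by (auto simp: preim_def)

lemma image_bij:
  assumes "openin (base X) U"
  shows "bij_betw (F (f ` U)) (carrier (sec Y (f ` U))) (carrier (sec X U))"
  using F_bij[of "f ` U"] open_image[OF assms] openin_subset[OF assms]
  by (simp add: preim_image image_mono)

text \<open>Small neighbourhoods W of x correspond to the neighbourhoods f(W) of f(x), over which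
  the sheaf map is bijective. Injectivity there gives injectivity on germs, and a section over U
  lifts to f(U).\<close>

lemma stalk_map_iso:
  assumes x: "x \<in> topspace (base X)"
  shows "stalk_map X (f, F) x \<in> ring_iso (stalk Y (f x)) (stalk X x)"
proof -
  have "inj_on (stalk_map X (f, F) x) (carrier (stalk Y (f x)))"
  proof (rule inj_onI)
    fix A B assume AB: "A \<in> carrier (stalk Y (f x))" "B \<in> carrier (stalk Y (f x))"
      and eq: "stalk_map X (f, F) x A = stalk_map X (f, F) x B"
    obtain V s t where V: "openin (base Y) V" "f x \<in> V" "s \<in> carrier (sec Y V)"
      "t \<in> carrier (sec Y V)" and A: "A = germ Y (f x) V s" "B = germ Y (f x) V t"
      using AB by (rule Y.stalk_carrierE2)
    have "germ X x (preim X f V) (F V s) = germ X x (preim X f V) (F V t)"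
      using eq unfolding A using x V by (simp add: stalk_map_germ)
    moreover have "x \<in> preim X f V" using x V by (simp add: preim_def)
    ultimately obtain W where W: "openin (base X) W" "x \<in> W" "W \<subseteq> preim X f V"
      and r: "res X (preim X f V) W (F V s) = res X (preim X f V) W (F V t)"
      using X.germ_eqD V preim_open F_closed by metis
    have fW: "openin (base Y) (f ` W)" "f ` W \<subseteq> V" "f x \<in> f ` W" "preim X f (f ` W) = W"
      using W open_image preim_image[OF openin_subset[OF W(1)]] by (auto simp: preim_def)
    have "F (f ` W) (res Y V (f ` W) s) = F (f ` W) (res Y V (f ` W) t)"
      using F_res[of V "f ` W" s] F_res[of V "f ` W" t] V fW r by simp
    then have "res Y V (f ` W) s = res Y V (f ` W) t"
      using image_bij[OF W(1)] V fW Y.res_closed by (auto simp: bij_betw_def inj_on_def)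
    then show "A = B"
      unfolding A using V fW by (intro Y.germ_eqI[of _ _ _ _ "f ` W"]) auto
  qed
  moreover have "A \<in> stalk_map X (f, F) x ` carrier (stalk Y (f x))"
    if A: "A \<in> carrier (stalk X x)" for A
  proof -
    obtain U s where U: "openin (base X) U" "x \<in> U" "s \<in> carrier (sec X U)" "A = germ X x U s"
      using A by (rule X.stalk_carrierE)
    then obtain t where t: "t \<in> carrier (sec Y (f ` U))" "s = F (f ` U) t"
      using image_bij[OF U(1)] by (auto simp: bij_betw_def)
    have "stalk_map X (f, F) x (germ Y (f x) (f ` U) t) = A"
      using U t x open_image openin_subset[OF U(1)] by (simp add: stalk_map_germ preim_image)
    then show ?thesis using U t open_image Y.stalk_carrierI by blast
  qed
  ultimately show ?thesis
    using stalk_map_hom[OF x] by (auto simp: ring_iso_def bij_betw_def ring_hom_closed)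
qed

text \<open>Locality comes for free, an isomorphism of stalks being a local homomorphism.\<close>

lemma in_Hom: "(f, F) \<in> Hom X Y"
  using Hom_iff[OF X.ringed_space_axioms Y.ringed_space_axioms] ringed_mor_axioms
    ring_iso_local_ring_hom stalk_map_iso X.stalk_cring Y.stalk_cring f_closed by blast

lemma local_ring_stalk_iff:
  assumes x: "x \<in> topspace (base X)"
  shows "local_ring (stalk Y (f x)) \<longleftrightarrow> local_ring (stalk X x)"
  using local_ring_iso stalk_map_iso[OF x] X.stalk_cring[OF x] Y.stalk_cring[OF f_closed[OF x]]
    ring_iso_set_sym[of "stalk Y (f x)"] cring.axioms(1) by metis

end

section \<open>Composition of morphisms\<close>

lemma preim_compose:
  assumes "ringed_mor X Y f F"
  shows "preim X (compose (topspace (base X)) g f) W = preim X f (preim Y g W)"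
  using ringed_mor.f_closed[OF assms] by (auto simp: preim_def compose_def)

text \<open>The locales take the two components of a morphism as separate parameters, so a composite
  is always given by names h and H together with this equation.\<close>

lemma mor_comp_eqD:
  assumes "mor_comp X Y Z (g, G) (f, F) = (h, H)"
  shows "h = compose (topspace (base X)) g f"
    and "H = (\<lambda>W \<in> {W. openin (base Z) W}. compose (carrier (sec Z W)) (F (preim Y g W)) (G W))"
  using assms by (auto simp: mor_comp_def)

lemma ringed_mor_comp:
  assumes f: "ringed_mor X Y f F" and g: "ringed_mor Y Z g G"
    and h: "mor_comp X Y Z (g, G) (f, F) = (h, H)"
  shows "ringed_mor X Z h H"
proof -
  interpret f: ringed_mor X Y f F by fact
  interpret g: ringed_mor Y Z g G by fact
  note hh = mor_comp_eqD(1)[OF h] and HH = mor_comp_eqD(2)[OF h]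
  have p: "preim X h W = preim X f (preim Y g W)" for W
    unfolding hh by (rule preim_compose[OF f])
  show ?thesis
  proof unfold_locales
    have "continuous_map (base X) (base Z) (g \<circ> f)"
      using f.cont g.cont by (rule continuous_map_compose)
    then show "continuous_map (base X) (base Z) h"
      by (rule continuous_map_eq) (simp add: hh compose_def)
    show "h \<in> extensional (topspace (base X))" "H \<in> extensional {V. openin (base Z) V}"
      by (simp_all add: hh HH)
    fix W assume W: "openin (base Z) W"
    then have H: "H W = compose (carrier (sec Z W)) (F (preim Y g W)) (G W)" by (simp add: HH)
    show "H W \<in> extensional (carrier (sec Z W))" by (simp add: H)
    interpret cring "sec Z W" using W g.Y.sec_cring by blast
    have FG: "F (preim Y g W) \<circ> G W \<in> ring_hom (sec Z W) (sec X (preim X h W))"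
      unfolding p by (rule ring_hom_trans[OF g.F_hom[OF W] f.F_hom]) (rule g.preim_open[OF W])
    show "H W \<in> ring_hom (sec Z W) (sec X (preim X h W))"
      by (rule ring_hom_restrict[OF FG]) (simp add: H compose_def)
    fix V t assume V: "openin (base Z) V" "V \<subseteq> W" and t: "t \<in> carrier (sec Z W)"
    have "H V (res Z W V t) = F (preim Y g V) (res Y (preim Y g W) (preim Y g V) (G W t))"
      using V W t by (simp add: HH compose_def g.Y.res_closed g.F_res)
    also have "\<dots> = res X (preim X h W) (preim X h V) (H W t)"
      unfolding p using V W t
      by (subst f.F_res) (auto simp: g.preim_open g.preim_mono g.F_closed H compose_def)
    finally show "H V (res Z W V t) = res X (preim X h W) (preim X h V) (H W t)" .
  qed
qed

lemma stalk_map_comp: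
  assumes f: "ringed_mor X Y f F" and g: "ringed_mor Y Z g G"
    and h: "mor_comp X Y Z (g, G) (f, F) = (h, H)"
    and x: "x \<in> topspace (base X)" and A: "A \<in> carrier (stalk Z (g (f x)))"
  shows "stalk_map X (h, H) x A = stalk_map X (f, F) x (stalk_map Y (g, G) (f x) A)"
proof -
  interpret f: ringed_mor X Y f F by fact
  interpret g: ringed_mor Y Z g G by fact
  interpret h: ringed_mor X Z h H by (rule ringed_mor_comp[OF assms(1-3)])
  note hh = mor_comp_eqD(1)[OF h] and HH = mor_comp_eqD(2)[OF h]
  have hx: "h x = g (f x)" using x by (simp add: hh compose_def)
  have p: "preim X h W = preim X f (preim Y g W)" for W
    unfolding hh by (rule preim_compose[OF f])
  obtain W t where W: "openin (base Z) W" "g (f x) \<in> W" "t \<in> carrier (sec Z W)"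
    "A = germ Z (g (f x)) W t"
    using A by (rule g.Y.stalk_carrierE)
  have "f x \<in> preim Y g W" using W f.f_closed[OF x] by (simp add: preim_def)
  moreover have "stalk_map X (h, H) x A = germ X x (preim X h W) (H W t)"
    unfolding W(4) hx[symmetric] by (rule h.stalk_map_germ) (use W x hx in auto)
  ultimately show ?thesis
    using W x f.f_closed[OF x]
    by (simp add: g.stalk_map_germ f.stalk_map_germ g.preim_open g.F_closed HH compose_def p)
qed

lemma open_immersion_comp:
  assumes f: "open_immersion X Y f F" and g: "open_immersion Y Z g G"
    and h: "mor_comp X Y Z (g, G) (f, F) = (h, H)"
  shows "open_immersion X Z h H"
proof -
  interpret f: open_immersion X Y f F by fact
  interpret g: open_immersion Y Z g G by fact
  interpret h: ringed_mor X Z h H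
    by (rule ringed_mor_comp[OF f.ringed_mor_axioms g.ringed_mor_axioms h])
  note hh = mor_comp_eqD(1)[OF h] and HH = mor_comp_eqD(2)[OF h]
  have p: "preim X h W = preim X f (preim Y g W)" for W
    unfolding hh by (rule preim_compose[OF f.ringed_mor_axioms])
  have im: "h ` U = g ` f ` U" if "U \<subseteq> topspace (base X)" for U
    using that by (auto simp: hh compose_def image_iff)
  show ?thesis
  proof unfold_locales
    show "inj_on h (topspace (base X))"
    proof (rule inj_onI)
      fix x y assume xy: "x \<in> topspace (base X)" "y \<in> topspace (base X)" "h x = h y"
      then have "f x = f y"
        using g.inj f.f_closed by (auto simp: hh compose_def dest: inj_onD)
      with xy show "x = y" using f.inj by (auto dest: inj_onD)
    qed
    fix U assume "openin (base X) U"
    then show "openin (base Z) (h ` U)"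
      using f.open_image g.open_image im openin_subset by metis
  next
    fix W assume W: "openin (base Z) W" "W \<subseteq> h ` topspace (base X)"
    have W1: "W \<subseteq> g ` f ` topspace (base X)" using W(2) im by simp
    then have W2: "W \<subseteq> g ` topspace (base Y)" using f.f_closed by blast
    \<comment> \<open>W lies in the image of the composite and g is injective, so its preimage
      cannot leave the image of f. This is what allows \<open>f.F_bij\<close> to be applied to
      it.\<close>
    have "preim Y g W \<subseteq> f ` topspace (base X)"
    proof
      fix y assume y: "y \<in> preim Y g W"
      then obtain x where x: "x \<in> topspace (base X)" "g y = g (f x)"
        using W1 by (auto simp: preim_def)
      then have "y = f x" using y g.inj f.f_closed by (auto simp: preim_def inj_on_def)
      with x show "y \<in> f ` topspace (base X)" by blast
    qed
    then have "bij_betw (F (preim Y g W) \<circ> G W) (carrier (sec Z W))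
        (carrier (sec X (preim X h W)))"
      unfolding p by (intro bij_betw_trans[OF g.F_bij[OF W(1) W2] f.F_bij] g.preim_open[OF W(1)])
    moreover have "H W t = (F (preim Y g W) \<circ> G W) t" if "t \<in> carrier (sec Z W)" for t
      using W that by (simp add: HH compose_def)
    ultimately show "bij_betw (H W) (carrier (sec Z W)) (carrier (sec X (preim X h W)))"
      using bij_betw_cong[of "carrier (sec Z W)" "H W"] by blast
  qed
qed

section \<open>Open subspaces and isomorphisms onto them\<close>

text \<open>Over a surjective f every section map is bijective and can be inverted. The inverse pair
  is shown to be an open immersion too, which yields its locality through \<open>in_Hom\<close>. The
  orientation of the conclusion is the one that \<open>scheme\<close> asks for, with X an affine
  chart and Y an open subspace.\<close>

lemma open_immersion_isomorphic:
  assumes f: "open_immersion X Y f F" and surj: "f ` topspace (base X) = topspace (base Y)"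
  shows "isomorphic Y X"
proof -
  interpret f: open_immersion X Y f F by fact
  define g where "g = restrict (inv_into (topspace (base X)) f) (topspace (base Y))"
  define G where "G = (\<lambda>U \<in> {U. openin (base X) U}. \<lambda>s \<in> carrier (sec X U).
    inv_into (carrier (sec Y (f ` U))) (F (f ` U)) s)"
  have gf: "g (f x) = x" if "x \<in> topspace (base X)" for x
    using that f.f_closed f.inj by (simp add: g_def)
  have fg: "f (g y) = y" "g y \<in> topspace (base X)" if "y \<in> topspace (base Y)" for y
    using that surj by (simp_all add: g_def f_inv_into_f inv_into_into)
  have pg: "preim Y g U = f ` U" if "U \<subseteq> topspace (base X)" for U
  proof (intro equalityI subsetI)
    fix y assume "y \<in> preim Y g U"
    then have "f (g y) = y" "g y \<in> U" using fg by (auto simp: preim_def)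
    then show "y \<in> f ` U" by (metis imageI)
  qed (use that gf f.f_closed in \<open>auto simp: preim_def\<close>)
  have ig: "g ` V = preim X f V" if "V \<subseteq> topspace (base Y)" for V
  proof (intro equalityI subsetI)
    fix x assume "x \<in> preim X f V"
    then have "g (f x) = x" "f x \<in> V" using gf by (auto simp: preim_def)
    then show "x \<in> g ` V" by (metis imageI)
  qed (use that fg in \<open>auto simp: preim_def\<close>)
  have F_iso: "F (f ` U) \<in> ring_iso (sec Y (f ` U)) (sec X U)" if "openin (base X) U" for U
    using f.F_hom[OF f.open_image[OF that]] f.image_bij[OF that] openin_subset[OF that]
    by (simp add: ring_iso_def f.preim_image)
  have G_iso: "inv_into (carrier (sec Y (f ` U))) (F (f ` U)) \<in> ring_iso (sec X U) (sec Y (f ` U))"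
    if "openin (base X) U" for U
    by (intro ring_iso_set_sym F_iso that cring.axioms(1) f.Y.sec_cring f.open_image)
  have FG: "F (f ` U) (G U s) = s" "G U s \<in> carrier (sec Y (f ` U))"
    if "openin (base X) U" "s \<in> carrier (sec X U)" for U s
    using that f.image_bij[OF that(1)]
    by (auto simp: G_def bij_betw_def f_inv_into_f inv_into_into)
  have GF: "G (preim X f V) (F V t) = t" if V: "openin (base Y) V" "t \<in> carrier (sec Y V)" for V t
  proof -
    have "f ` preim X f V = V" by (rule f.image_preim) (simp add: surj openin_subset V)
    then show ?thesis
      using V f.preim_open f.F_closed f.F_bij[OF V(1)] openin_subset[OF V(1)] surj
      by (simp add: G_def bij_betw_def)
  qed
  interpret g: open_immersion Y X g G
  proof unfold_locales
    show "continuous_map (base Y) (base X) g"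
      unfolding continuous_map_def
    proof (intro conjI allI impI)
      show "g \<in> topspace (base Y) \<rightarrow> topspace (base X)" using fg by blast
      fix U assume U: "openin (base X) U"
      have "{y \<in> topspace (base Y). g y \<in> U} = f ` U"
        using pg[OF openin_subset[OF U]] by (simp add: preim_def)
      then show "openin (base Y) {y \<in> topspace (base Y). g y \<in> U}"
        using f.open_image[OF U] by simp
    qed
    show "g \<in> extensional (topspace (base Y))" "G \<in> extensional {U. openin (base X) U}"
      by (simp_all add: g_def G_def)
    show "inj_on g (topspace (base Y))"
      using fg(1) by (rule inj_on_inverseI)
    fix U assume U: "openin (base X) U"
    note p = pg[OF openin_subset[OF U]]
    interpret ring "sec X U" by (intro cring.axioms(1) f.X.sec_cring U)
    show "G U \<in> extensional (carrier (sec X U))" using U by (simp add: G_def)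
    have G_iso': "G U \<in> ring_iso (sec X U) (sec Y (preim Y g U))"
      unfolding p by (rule ring_iso_restrict[OF G_iso[OF U]]) (use U in \<open>simp add: G_def\<close>)
    then show "G U \<in> ring_hom (sec X U) (sec Y (preim Y g U))"
      "bij_betw (G U) (carrier (sec X U)) (carrier (sec Y (preim Y g U)))"
      by (simp_all add: ring_iso_def)
    fix W s assume W: "openin (base X) W" "W \<subseteq> U" and s: "s \<in> carrier (sec X U)"
    have fW: "openin (base Y) (f ` W)" "openin (base Y) (f ` U)" "f ` W \<subseteq> f ` U"
      using U W f.open_image by auto
    \<comment> \<open>\<open>G\<close> commutes with restriction because \<open>F\<close> does: both
      sides are compared after the injective map \<open>F\<close> over the image of W has been
      applied.\<close>
    have "F (f ` W) (res Y (f ` U) (f ` W) (G U s)) = res X U W (F (f ` U) (G U s))"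
      using f.F_res[OF fW(2,1,3) FG(2)[OF U s]] openin_subset[OF U] openin_subset[OF W(1)]
      by (simp add: f.preim_image)
    also have "\<dots> = F (f ` W) (G W (res X U W s))"
      using FG U W s f.X.res_closed by simp
    finally have eq: "F (f ` W) (res Y (f ` U) (f ` W) (G U s)) = F (f ` W) (G W (res X U W s))" .
    have "res Y (f ` U) (f ` W) (G U s) = G W (res X U W s)"
    proof (rule inj_onD)
      show "inj_on (F (f ` W)) (carrier (sec Y (f ` W)))"
        using f.image_bij[OF W(1)] by (simp add: bij_betw_def)
      show "F (f ` W) (res Y (f ` U) (f ` W) (G U s)) = F (f ` W) (G W (res X U W s))" by (rule eq)
    qed (use FG U W s fW f.X.res_closed f.Y.res_closed in auto)
    then show "G W (res X U W s) = res Y (preim Y g U) (preim Y g W) (G U s)"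
      using p pg[OF openin_subset[OF W(1)]] by simp
  next
    fix V assume V: "openin (base Y) V"
    then show "openin (base X) (g ` V)"
      using ig[OF openin_subset[OF V]] f.preim_open by simp
  qed
  have "mor_comp Y X Y (f, F) (g, G) = mor_id Y"
    unfolding mor_comp_def mor_id_def fst_conv snd_conv
  proof (intro arg_cong2[where f = Pair] restrict_ext)
    show "compose (topspace (base Y)) f g = (\<lambda>x \<in> topspace (base Y). x)"
      using fg by (auto simp: compose_def)
    fix V assume "V \<in> {V. openin (base Y) V}"
    then show "compose (carrier (sec Y V)) (G (preim X f V)) (F V) = (\<lambda>t \<in> carrier (sec Y V). t)"
      using GF by (auto simp: compose_def)
  qed
  moreover have "mor_comp X Y X (g, G) (f, F) = mor_id X"
    unfolding mor_comp_def mor_id_def fst_conv snd_conv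
  proof (intro arg_cong2[where f = Pair] restrict_ext)
    show "compose (topspace (base X)) g f = (\<lambda>x \<in> topspace (base X). x)"
      using gf by (auto simp: compose_def)
    fix U assume U: "U \<in> {U. openin (base X) U}"
    then have "preim Y g U = f ` U" by (intro pg openin_subset) simp
    with U show "compose (carrier (sec X U)) (F (preim Y g U)) (G U) = (\<lambda>s \<in> carrier (sec X U). s)"
      using FG by (auto simp: compose_def)
  qed
  ultimately show ?thesis
    unfolding isomorphic_def using f.in_Hom g.in_Hom by blast
qed

lemma openin_open_subspace:
  assumes "openin (base X) U"
  shows "openin (base (open_subspace X U)) V \<longleftrightarrow> openin (base X) V \<and> V \<subseteq> U"
  using assms by (simp add: open_subspace_def openin_open_subtopology)

lemma open_subspace_simps [simp]:
  "sec (open_subspace X U) = sec X" "res (open_subspace X U) = res X"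
  by (simp_all add: open_subspace_def)

lemma topspace_open_subspace:
  "openin (base X) U \<Longrightarrow> topspace (base (open_subspace X U)) = U"
  using openin_subset by (fastforce simp: open_subspace_def)

lemma (in ringed_space) ringed_space_open_subspace:
  assumes "openin (base X) U"
  shows "ringed_space (open_subspace X U)"
proof (rule ringed_space.intro; unfold open_subspace_simps openin_open_subspace[OF assms])
  show "s = t"
    if "\<And>V. V \<in> C \<Longrightarrow> openin (base X) V \<and> V \<subseteq> U" "s \<in> carrier (sec X (\<Union>C))"
      "t \<in> carrier (sec X (\<Union>C))" "\<And>V. V \<in> C \<Longrightarrow> res X (\<Union>C) V s = res X (\<Union>C) V t" for C s t
    using that by (intro locality[of C s t]) simp_all
  show "\<exists>s \<in> carrier (sec X (\<Union>C)). \<forall>V \<in> C. res X (\<Union>C) V s = \<sigma> V"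
    if "\<And>V. V \<in> C \<Longrightarrow> openin (base X) V \<and> V \<subseteq> U" "\<And>V. V \<in> C \<Longrightarrow> \<sigma> V \<in> carrier (sec X V)"
      "\<And>V W. \<lbrakk>V \<in> C; W \<in> C\<rbrakk> \<Longrightarrow> res X V (V \<inter> W) (\<sigma> V) = res X W (V \<inter> W) (\<sigma> W)" for C \<sigma>
    using that by (intro gluing[of C \<sigma>]) simp_all
qed (simp_all add: sec_cring res_hom res_id res_res)

lemma open_immersion_isomorphic_image:
  assumes f: "open_immersion Z X f F"
  shows "isomorphic (open_subspace X (f ` topspace (base Z))) Z"
proof -
  interpret f: open_immersion Z X f F by fact
  let ?U = "f ` topspace (base Z)"
  let ?Y = "open_subspace X ?U"
  have U: "openin (base X) ?U" by (intro f.open_image) simp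
  note o = openin_open_subspace[OF U]
  interpret Y: ringed_space ?Y by (rule f.Y.ringed_space_open_subspace[OF U])
  \<comment> \<open>Corestricting f changes neither preimages nor section maps. Only the extensional
    domain of \<open>F\<close> shrinks, to the open sets contained in the image.\<close>
  let ?G = "restrict F {V. openin (base ?Y) V}"
  have "open_immersion Z ?Y f ?G"
  proof unfold_locales
    have "continuous_map (base Z) (subtopology (base X) ?U) f"
      by (intro continuous_map_into_subtopology f.cont) auto
    then show "continuous_map (base Z) (base ?Y) f" by (simp add: open_subspace_def)
    show "openin (base ?Y) (f ` V)" if "openin (base Z) V" for V
      using that f.open_image openin_subset[OF that] by (auto simp: o)
  qed (use f.f_ext f.F_hom f.FV_ext f.F_res f.inj f.F_bij topspace_open_subspace[OF U]
      in \<open>simp_all add: o\<close>)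
  then show ?thesis
    by (rule open_immersion_isomorphic) (simp add: topspace_open_subspace[OF U])
qed

section \<open>Localization and affine schemes\<close>

context primeideal
begin

lemma one_notin: "\<one> \<notin> I"
  using I_notcarr one_imp_carrier by blast

lemma mult_notin: "\<lbrakk>a \<in> carrier R - I; b \<in> carrier R - I\<rbrakk> \<Longrightarrow> a \<otimes> b \<notin> I"
  using I_prime by blast

lemma fraction_self: "\<lbrakk>a \<in> carrier R; s \<in> carrier R - I\<rbrakk> \<Longrightarrow> (a, s) \<in> fraction R I a s"
  using one_notin by (auto simp: fraction_def intro!: bexI[of _ \<one>])

lemma fraction_subset:
  assumes "a \<in> carrier R" "s \<in> carrier R - I" "b \<in> carrier R" "t \<in> carrier R - I"
    and u: "u \<in> carrier R - I" "u \<otimes> (a \<otimes> t) = u \<otimes> (b \<otimes> s)"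
  shows "fraction R I a s \<subseteq> fraction R I b t"
proof (rule subrelI)
  fix c v assume "(c, v) \<in> fraction R I a s"
  then obtain w where cv: "c \<in> carrier R" "v \<in> carrier R - I"
    and w: "w \<in> carrier R - I" "w \<otimes> (a \<otimes> v) = w \<otimes> (c \<otimes> s)"
    unfolding fraction_def by blast
  have c: "a \<in> carrier R" "s \<in> carrier R" "b \<in> carrier R" "t \<in> carrier R" "u \<in> carrier R"
    "c \<in> carrier R" "v \<in> carrier R" "w \<in> carrier R"
    using assms cv w by auto
  \<comment> \<open>Eliminating the middle fraction a/s from the two equations costs the factor s
    besides their witnesses u and w; all three lie outside the prime.\<close>
  let ?z = "u \<otimes> w \<otimes> s"
  have "?z \<otimes> (b \<otimes> v) = (u \<otimes> (b \<otimes> s)) \<otimes> (w \<otimes> v)" using c by (simp add: m_ac)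
  also have "\<dots> = (w \<otimes> (a \<otimes> v)) \<otimes> (u \<otimes> t)" unfolding u(2)[symmetric] using c by (simp add: m_ac)
  also have "\<dots> = ?z \<otimes> (c \<otimes> t)" unfolding w(2) using c by (simp add: m_ac)
  finally have "?z \<otimes> (b \<otimes> v) = ?z \<otimes> (c \<otimes> t)" .
  moreover have "?z \<in> carrier R - I" using assms w mult_notin by simp
  ultimately show "(c, v) \<in> fraction R I b t" using cv unfolding fraction_def by blast
qed

lemma fraction_eq_iff:
  assumes "a \<in> carrier R" "s \<in> carrier R - I" "b \<in> carrier R" "t \<in> carrier R - I"
  shows "fraction R I a s = fraction R I b t \<longleftrightarrow>
    (\<exists>u \<in> carrier R - I. u \<otimes> (a \<otimes> t) = u \<otimes> (b \<otimes> s))"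
proof
  assume "fraction R I a s = fraction R I b t"
  then have "(b, t) \<in> fraction R I a s" using assms fraction_self by simp
  then show "\<exists>u \<in> carrier R - I. u \<otimes> (a \<otimes> t) = u \<otimes> (b \<otimes> s)" unfolding fraction_def by blast
next
  assume "\<exists>u \<in> carrier R - I. u \<otimes> (a \<otimes> t) = u \<otimes> (b \<otimes> s)"
  then obtain u where "u \<in> carrier R - I" "u \<otimes> (a \<otimes> t) = u \<otimes> (b \<otimes> s)" by blast
  then show "fraction R I a s = fraction R I b t"
    using assms by (intro equalityI fraction_subset[of _ _ _ _ u]) auto
qed

lemma fraction_eqI':
  assumes "a \<in> carrier R" "s \<in> carrier R - I" "b \<in> carrier R" "t \<in> carrier R - I"
    and "u \<in> carrier R - I" "u \<otimes> (a \<otimes> t) = u \<otimes> (b \<otimes> s)"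
  shows "fraction R I a s = fraction R I b t"
  unfolding fraction_eq_iff[OF assms(1-4)] using assms(5,6) by (rule bexI[rotated])

lemma fraction_eqI:
  assumes "a \<in> carrier R" "s \<in> carrier R - I" "b \<in> carrier R" "t \<in> carrier R - I"
    and "a \<otimes> t = b \<otimes> s"
  shows "fraction R I a s = fraction R I b t"
  unfolding fraction_eq_iff[OF assms(1-4)] using assms one_notin by (auto intro!: bexI[of _ \<one>])

lemma fraction_closed:
  "\<lbrakk>a \<in> carrier R; s \<in> carrier R - I\<rbrakk> \<Longrightarrow> fraction R I a s \<in> carrier (localization R I)"
  by (auto simp: localization_def)

lemma localizationE:
  assumes "A \<in> carrier (localization R I)"
  obtains a s where "a \<in> carrier R" "s \<in> carrier R - I" "A = fraction R I a s"
  using assms by (auto simp: localization_def)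

lemma
  assumes "a \<in> carrier R" "s \<in> carrier R - I" "b \<in> carrier R" "t \<in> carrier R - I"
  shows fraction_mult: "fraction R I a s \<otimes>\<^bsub>localization R I\<^esub> fraction R I b t
      = fraction R I (a \<otimes> b) (s \<otimes> t)"
    and fraction_add: "fraction R I a s \<oplus>\<^bsub>localization R I\<^esub> fraction R I b t
      = fraction R I (a \<otimes> t \<oplus> b \<otimes> s) (s \<otimes> t)"
proof -
  have *: "fraction R I (a' \<otimes> b') (s' \<otimes> t') = fraction R I (a \<otimes> b) (s \<otimes> t)"
    "fraction R I (a' \<otimes> t' \<oplus> b' \<otimes> s') (s' \<otimes> t') = fraction R I (a \<otimes> t \<oplus> b \<otimes> s) (s \<otimes> t)"
    if as: "(a', s') \<in> fraction R I a s" and bt: "(b', t') \<in> fraction R I b t" for a' s' b' t'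
  proof -
    obtain u v where "u \<in> carrier R - I" "v \<in> carrier R - I"
      and c': "a' \<in> carrier R" "s' \<in> carrier R - I" "b' \<in> carrier R" "t' \<in> carrier R - I"
      and u: "u \<otimes> (a \<otimes> s') = u \<otimes> (a' \<otimes> s)" and v: "v \<otimes> (b \<otimes> t') = v \<otimes> (b' \<otimes> t)"
      using as bt unfolding fraction_def by blast
    then have uv: "u \<otimes> v \<in> carrier R - I" and uv': "u \<in> carrier R" "v \<in> carrier R"
      using mult_notin by auto
    have "(u \<otimes> v) \<otimes> ((a' \<otimes> b') \<otimes> (s \<otimes> t)) = (u \<otimes> (a' \<otimes> s)) \<otimes> (v \<otimes> (b' \<otimes> t))"
      using assms c' uv' by (simp add: m_ac)
    also have "\<dots> = (u \<otimes> v) \<otimes> ((a \<otimes> b) \<otimes> (s' \<otimes> t'))"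
      unfolding u[symmetric] v[symmetric] using assms c' uv' by (simp add: m_ac)
    finally show "fraction R I (a' \<otimes> b') (s' \<otimes> t') = fraction R I (a \<otimes> b) (s \<otimes> t)"
      using assms c' uv by (intro fraction_eqI'[of _ _ _ _ "u \<otimes> v"]) (simp_all add: mult_notin)
    have "(u \<otimes> v) \<otimes> ((a' \<otimes> t' \<oplus> b' \<otimes> s') \<otimes> (s \<otimes> t))
        = (u \<otimes> (a' \<otimes> s)) \<otimes> (v \<otimes> (t \<otimes> t')) \<oplus> (v \<otimes> (b' \<otimes> t)) \<otimes> (u \<otimes> (s \<otimes> s'))"
      using assms c' uv' by (simp add: m_ac l_distr r_distr)
    also have "\<dots> = (u \<otimes> v) \<otimes> ((a \<otimes> t \<oplus> b \<otimes> s) \<otimes> (s' \<otimes> t'))"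
      unfolding u[symmetric] v[symmetric] using assms c' uv' by (simp add: m_ac l_distr r_distr)
    finally show "fraction R I (a' \<otimes> t' \<oplus> b' \<otimes> s') (s' \<otimes> t')
        = fraction R I (a \<otimes> t \<oplus> b \<otimes> s) (s \<otimes> t)"
      using assms c' uv by (intro fraction_eqI'[of _ _ _ _ "u \<otimes> v"]) (simp_all add: mult_notin)
  qed
  have self: "(a, s) \<in> fraction R I a s" "(b, t) \<in> fraction R I b t" using assms fraction_self by auto
  show "fraction R I a s \<otimes>\<^bsub>localization R I\<^esub> fraction R I b t = fraction R I (a \<otimes> b) (s \<otimes> t)"
    using self *(1) unfolding localization_def monoid.simps by (intro UN_pair_const)
  show "fraction R I a s \<oplus>\<^bsub>localization R I\<^esub> fraction R I b t
      = fraction R I (a \<otimes> t \<oplus> b \<otimes> s) (s \<otimes> t)"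
    using self *(2) unfolding localization_def ring.simps by (intro UN_pair_const)
qed

lemma localization_one: "\<one>\<^bsub>localization R I\<^esub> = fraction R I \<one> \<one>"
  and localization_zero: "\<zero>\<^bsub>localization R I\<^esub> = fraction R I \<zero> \<one>"
  by (simp_all add: localization_def)

lemma fraction_add_same:
  assumes "a \<in> carrier R" "s \<in> carrier R - I" "b \<in> carrier R"
  shows "fraction R I a s \<oplus>\<^bsub>localization R I\<^esub> fraction R I b s = fraction R I (a \<oplus> b) s"
  using assms
  by (simp add: fraction_add mult_notin) (rule fraction_eqI; simp add: mult_notin m_ac l_distr r_distr)

text \<open>Over a common denominator addition acts on numerators alone, as in
  \<open>fraction_add_same\<close>.\<close>

lemma localizationE2:
  assumes "A \<in> carrier (localization R I)" "B \<in> carrier (localization R I)"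
  obtains a b s where "a \<in> carrier R" "b \<in> carrier R" "s \<in> carrier R - I"
    "A = fraction R I a s" "B = fraction R I b s"
proof -
  obtain a s b t where *: "a \<in> carrier R" "s \<in> carrier R - I" "A = fraction R I a s"
    "b \<in> carrier R" "t \<in> carrier R - I" "B = fraction R I b t"
    using assms localizationE by metis
  show thesis
  proof (rule that)
    show "A = fraction R I (a \<otimes> t) (s \<otimes> t)" "B = fraction R I (b \<otimes> s) (s \<otimes> t)"
      unfolding *(3,6)
      by (rule fraction_eqI; use * in \<open>simp add: m_ac mult_notin\<close>)+
  qed (use * mult_notin in auto)
qed

lemma cring_localization: "cring (localization R I)"
proof (intro cringI abelian_groupI comm_monoidI)
  let ?L = "localization R I"
  note frac = fraction_mult fraction_add localization_one localization_zero mult_notin one_notin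
  have one: "\<one> \<in> carrier R - I" using one_notin by simp
  show "\<one>\<^bsub>?L\<^esub> \<in> carrier ?L" "\<zero>\<^bsub>?L\<^esub> \<in> carrier ?L"
    using one by (simp_all add: localization_one localization_zero fraction_closed)
  {
    fix A assume "A \<in> carrier ?L"
    then obtain a s where A: "a \<in> carrier R" "s \<in> carrier R - I" "A = fraction R I a s"
      by (rule localizationE)
    show "\<one>\<^bsub>?L\<^esub> \<otimes>\<^bsub>?L\<^esub> A = A" "\<zero>\<^bsub>?L\<^esub> \<oplus>\<^bsub>?L\<^esub> A = A"
      using A one by (simp_all add: frac)
    have "fraction R I (\<ominus> a) s \<oplus>\<^bsub>?L\<^esub> A = \<zero>\<^bsub>?L\<^esub>"
      unfolding A(3) localization_zero using A(1,2) one
      by (subst fraction_add_same) (simp_all add: l_neg, rule fraction_eqI, simp_all)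
    then show "\<exists>B \<in> carrier ?L. B \<oplus>\<^bsub>?L\<^esub> A = \<zero>\<^bsub>?L\<^esub>"
      using A fraction_closed by blast
  next
    fix A B assume "A \<in> carrier ?L" "B \<in> carrier ?L"
    then obtain a b s where AB: "a \<in> carrier R" "b \<in> carrier R" "s \<in> carrier R - I"
      "A = fraction R I a s" "B = fraction R I b s"
      by (rule localizationE2)
    then show "A \<otimes>\<^bsub>?L\<^esub> B \<in> carrier ?L" "A \<oplus>\<^bsub>?L\<^esub> B \<in> carrier ?L"
      "A \<otimes>\<^bsub>?L\<^esub> B = B \<otimes>\<^bsub>?L\<^esub> A" "A \<oplus>\<^bsub>?L\<^esub> B = B \<oplus>\<^bsub>?L\<^esub> A"
      by (simp_all add: fraction_mult fraction_add_same fraction_closed mult_notin m_comm a_comm)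
    fix C assume "C \<in> carrier ?L"
    then obtain c t where C: "c \<in> carrier R" "t \<in> carrier R - I" "C = fraction R I c t"
      by (rule localizationE)
    show "A \<otimes>\<^bsub>?L\<^esub> B \<otimes>\<^bsub>?L\<^esub> C = A \<otimes>\<^bsub>?L\<^esub> (B \<otimes>\<^bsub>?L\<^esub> C)"
      using AB C by (simp add: fraction_mult mult_notin m_assoc)
    show "A \<oplus>\<^bsub>?L\<^esub> B \<oplus>\<^bsub>?L\<^esub> C = A \<oplus>\<^bsub>?L\<^esub> (B \<oplus>\<^bsub>?L\<^esub> C)"
      using AB C by (simp add: fraction_add mult_notin m_ac l_distr r_distr a_ac)
    show "(A \<oplus>\<^bsub>?L\<^esub> B) \<otimes>\<^bsub>?L\<^esub> C = A \<otimes>\<^bsub>?L\<^esub> C \<oplus>\<^bsub>?L\<^esub> B \<otimes>\<^bsub>?L\<^esub> C"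
      using AB C by (simp add: fraction_mult fraction_add_same mult_notin l_distr)
  }
qed

lemma fraction_neg:
  assumes "a \<in> carrier R" "s \<in> carrier R - I"
  shows "\<ominus>\<^bsub>localization R I\<^esub> fraction R I a s = fraction R I (\<ominus> a) s"
proof -
  interpret L: cring "localization R I" by (rule cring_localization)
  have "fraction R I (\<ominus> a) s \<oplus>\<^bsub>localization R I\<^esub> fraction R I a s = \<zero>\<^bsub>localization R I\<^esub>"
    unfolding localization_zero using assms one_notin
    by (subst fraction_add_same) (simp_all add: l_neg, rule fraction_eqI, simp_all)
  then show ?thesis using assms by (intro L.minus_equality) (auto simp: fraction_closed)
qed

text \<open>The extension of the prime to its localization, which is the unique maximal ideal
  there.\<close>

definition localization_ideal :: "('a \<times> 'a) set set" where
  "localization_ideal = {fraction R I a s | a s. a \<in> I \<and> s \<in> carrier R - I}"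

text \<open>If a/s equals b/t with b in the prime, then u a t lies in the prime while u and t do
  not, so a does. Membership can thus be read off any representative.\<close>

lemma fraction_in_localization_ideal_iff:
  assumes "a \<in> carrier R" "s \<in> carrier R - I"
  shows "fraction R I a s \<in> localization_ideal \<longleftrightarrow> a \<in> I"
proof
  assume "fraction R I a s \<in> localization_ideal"
  then obtain b t where b: "b \<in> I" "t \<in> carrier R - I" "fraction R I a s = fraction R I b t"
    unfolding localization_ideal_def by blast
  then obtain u where u: "u \<in> carrier R - I" "u \<otimes> (a \<otimes> t) = u \<otimes> (b \<otimes> s)"
    using fraction_eq_iff[OF assms Icarr[OF b(1)] b(2)] by auto
  then have "u \<otimes> (a \<otimes> t) \<in> I"
    using b assms by (simp add: I_l_closed I_r_closed Icarr)
  then show "a \<in> I"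
    using I_prime[of u "a \<otimes> t"] I_prime[of a t] u b assms by blast
qed (use assms in \<open>auto simp: localization_ideal_def\<close>)

lemma ideal_localization_ideal: "ideal localization_ideal (localization R I)"
proof (rule idealI)
  let ?L = "localization R I"
  interpret L: cring ?L by (rule cring_localization)
  show "ring ?L" by (rule L.ring_axioms)
  note iff = fraction_in_localization_ideal_iff
  have sub: "localization_ideal \<subseteq> carrier ?L"
    using Icarr by (auto simp: localization_ideal_def intro: fraction_closed)
  have one: "\<one> \<in> carrier R - I" using one_notin by simp
  show "subgroup localization_ideal (add_monoid ?L)"
  proof (rule L.add.subgroupI)
    show "localization_ideal \<subseteq> carrier ?L" by (rule sub)
    show "localization_ideal \<noteq> {}"
      using iff[of \<zero> \<one>] one additive_subgroup.zero_closed[OF additive_subgroup_axioms] by auto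
    fix A assume A: "A \<in> localization_ideal"
    then obtain a s where a: "a \<in> I" "s \<in> carrier R - I" "A = fraction R I a s"
      unfolding localization_ideal_def by blast
    then show "\<ominus>\<^bsub>?L\<^esub> A \<in> localization_ideal"
      by (simp add: fraction_neg iff Icarr a_inv_closed)
    fix B assume B: "B \<in> localization_ideal"
    then obtain b t where "b \<in> I" "t \<in> carrier R - I" "B = fraction R I b t"
      unfolding localization_ideal_def by blast
    with a show "A \<oplus>\<^bsub>?L\<^esub> B \<in> localization_ideal"
      by (simp add: fraction_add iff Icarr I_r_closed mult_notin)
  qed
  fix A B assume A: "A \<in> localization_ideal" and B: "B \<in> carrier ?L"
  obtain a s where "a \<in> I" "s \<in> carrier R - I" "A = fraction R I a s"
    using A unfolding localization_ideal_def by blast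
  moreover obtain b t where "b \<in> carrier R" "t \<in> carrier R - I" "B = fraction R I b t"
    using B by (rule localizationE)
  ultimately show "B \<otimes>\<^bsub>?L\<^esub> A \<in> localization_ideal" "A \<otimes>\<^bsub>?L\<^esub> B \<in> localization_ideal"
    by (simp_all add: fraction_mult iff Icarr I_r_closed I_l_closed mult_notin)
qed

end

text \<open>A proper ideal contains no unit. If everything outside m is a unit, m therefore contains
  every proper ideal, hence is maximal and the only maximal ideal.\<close>

lemma local_ringI:
  fixes R (structure)
  assumes R: "cring R" and m: "ideal m R" "\<one> \<notin> m"
    and unit: "\<And>a. \<lbrakk>a \<in> carrier R; a \<notin> m\<rbrakk> \<Longrightarrow> \<exists>b \<in> carrier R. a \<otimes> b = \<one>"
  shows "local_ring R"
proof -
  interpret cring R by fact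
  have proper: "J \<subseteq> m" if J: "ideal J R" "\<one> \<notin> J" for J
  proof
    interpret J: ideal J R by fact
    fix a assume a: "a \<in> J"
    show "a \<in> m"
    proof (rule ccontr)
      assume "a \<notin> m"
      then obtain b where "b \<in> carrier R" "a \<otimes> b = \<one>" using unit a J.Icarr by blast
      then show False using J.I_r_closed[OF a] J(2) by force
    qed
  qed
  have "maximalideal m R"
  proof (rule maximalidealI)
    show "carrier R \<noteq> m" using m(2) by auto
    fix J assume J: "ideal J R" "m \<subseteq> J" "J \<subseteq> carrier R"
    show "J = m \<or> J = carrier R"
      using proper[OF J(1)] J(2) ideal.one_imp_carrier[OF J(1)] by blast
  qed (rule m)
  moreover have "n = m" if "maximalideal n R" for n
  proof -
    interpret n: maximalideal n R by fact
    have "n \<subseteq> m"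
      using n.I_notcarr n.one_imp_carrier by (intro proper n.ideal_axioms) blast
    then have "m = n \<or> m = carrier R"
      using m(1) ideal.Icarr[OF m(1)] by (intro n.I_maximal) auto
    then show "n = m" using m(2) by auto
  qed
  ultimately show ?thesis unfolding local_ring_def using R by blast
qed

section \<open>The structure sheaf of a spectrum and its stalks\<close>

lemma zariski_open_prime: "\<lbrakk>openin (zariski R) U; p \<in> U\<rbrakk> \<Longrightarrow> primeideal p R"
  by (auto simp: openin_zariski spec_open_def)

lemma openin_zariski_basic:
  "a \<in> carrier R \<Longrightarrow> openin (zariski R) {p. primeideal p R \<and> a \<notin> p}"
  unfolding openin_zariski by (rule exI[of _ "{a}"]) (auto simp: spec_open_def)

lemma spec_sections_simps [simp]:
  "\<one>\<^bsub>spec_sections R U\<^esub> = (\<lambda>p \<in> U. \<one>\<^bsub>localization R p\<^esub>)"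
  "\<zero>\<^bsub>spec_sections R U\<^esub> = (\<lambda>p \<in> U. \<zero>\<^bsub>localization R p\<^esub>)"
  "s \<otimes>\<^bsub>spec_sections R U\<^esub> t = (\<lambda>p \<in> U. s p \<otimes>\<^bsub>localization R p\<^esub> t p)"
  "s \<oplus>\<^bsub>spec_sections R U\<^esub> t = (\<lambda>p \<in> U. s p \<oplus>\<^bsub>localization R p\<^esub> t p)"
  by (simp_all add: spec_sections_def)

lemma Spec_simps [simp]:
  "base (Spec R) = zariski R" "sec (Spec R) = spec_sections R"
  "res (Spec R) = (\<lambda>U V s. restrict s V)"
  by (simp_all add: Spec_def)

lemma spec_sectionE:
  assumes "s \<in> carrier (spec_sections R U)" "p \<in> U"
  obtains V a g where "openin (zariski R) V" "p \<in> V" "V \<subseteq> U" "a \<in> carrier R" "g \<in> carrier R"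
    "\<forall>q \<in> V. g \<notin> q" "\<forall>q \<in> V. s q = fraction R q a g"
proof -
  have "\<exists>V. openin (zariski R) V \<and> p \<in> V \<and> V \<subseteq> U \<and>
      (\<exists>a \<in> carrier R. \<exists>g \<in> carrier R. \<forall>q \<in> V. g \<notin> q \<and> s q = fraction R q a g)"
    using assms by (simp add: spec_sections_def)
  then obtain V a g where "openin (zariski R) V" "p \<in> V" "V \<subseteq> U" "a \<in> carrier R" "g \<in> carrier R"
    "\<forall>q \<in> V. g \<notin> q \<and> s q = fraction R q a g"
    by (elim exE conjE bexE) (rule that)
  then show ?thesis by (intro that[of V a g]) simp_all
qed

lemma spec_section_ext: "s \<in> carrier (spec_sections R U) \<Longrightarrow> s \<in> extensional U"
  by (auto simp: spec_sections_def PiE_def)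

lemma spec_section_value:
  "\<lbrakk>s \<in> carrier (spec_sections R U); p \<in> U\<rbrakk> \<Longrightarrow> s p \<in> carrier (localization R p)"
  by (auto simp: spec_sections_def)

lemma spec_section_eqI:
  "\<lbrakk>s \<in> carrier (spec_sections R U); t \<in> carrier (spec_sections R U);
    \<And>p. p \<in> U \<Longrightarrow> s p = t p\<rbrakk> \<Longrightarrow> s = t"
  using spec_section_ext extensionalityI by metis

abbreviation locally_fraction ::
    "('r, 'x) ring_scheme \<Rightarrow> 'r set set \<Rightarrow> 'r spec_section \<Rightarrow> 'r set \<Rightarrow> bool" where
  "locally_fraction R U s p \<equiv> \<exists>V a g. openin (zariski R) V \<and> p \<in> V \<and> V \<subseteq> U \<and>
    a \<in> carrier R \<and> g \<in> carrier R \<and> (\<forall>q \<in> V. g \<notin> q \<and> s q = fraction R q a g)"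

text \<open>That the values lie in the localizations follows from the local presentation as
  fractions, so only the latter has to be supplied.\<close>

lemma spec_sectionI:
  assumes ext: "s \<in> extensional U"
    and local: "\<And>p. p \<in> U \<Longrightarrow> locally_fraction R U s p"
  shows "s \<in> carrier (spec_sections R U)"
proof -
  have "s p \<in> carrier (localization R p)" if p: "p \<in> U" for p
  proof -
    obtain V a g where V: "openin (zariski R) V" "p \<in> V" "V \<subseteq> U" "a \<in> carrier R"
      "g \<in> carrier R" "\<forall>q \<in> V. g \<notin> q \<and> s q = fraction R q a g"
      using local[OF p] by (elim exE conjE) (rule that)
    interpret primeideal p R by (rule zariski_open_prime[OF V(1,2)])
    show ?thesis using V by (simp add: fraction_closed)
  qed
  moreover have "\<exists>V. openin (zariski R) V \<and> p \<in> V \<and> V \<subseteq> U \<and>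
      (\<exists>a \<in> carrier R. \<exists>g \<in> carrier R. \<forall>q \<in> V. g \<notin> q \<and> s q = fraction R q a g)"
    if "p \<in> U" for p
    using local[OF that] by (elim exE conjE) (intro exI conjI bexI; assumption)
  ultimately show ?thesis
    using ext by (simp add: spec_sections_def PiE_iff)
qed

lemma local_fractionI:
  assumes "openin (zariski R) V" "p \<in> V" "V \<subseteq> U" "a \<in> carrier R" "g \<in> carrier R"
    and "\<And>q. q \<in> V \<Longrightarrow> g \<notin> q" "\<And>q. q \<in> V \<Longrightarrow> s q = fraction R q a g"
  shows "locally_fraction R U s p"
  using assms by (intro exI[of _ V] exI[of _ a] exI[of _ g]) simp

lemma fraction_spec_section:
  assumes "openin (zariski R) V" "a \<in> carrier R" "g \<in> carrier R" "\<And>q. q \<in> V \<Longrightarrow> g \<notin> q"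
  shows "(\<lambda>q \<in> V. fraction R q a g) \<in> carrier (spec_sections R V)"
  using assms by (intro spec_sectionI local_fractionI[of _ V _ _ a g]) simp_all

lemma restrict_spec_section:
  assumes "openin (zariski R) V" "V \<subseteq> U" "s \<in> carrier (spec_sections R U)"
  shows "restrict s V \<in> carrier (spec_sections R V)"
proof (rule spec_sectionI)
  fix p assume p: "p \<in> V"
  then have pU: "p \<in> U" using assms(2) by blast
  obtain W a g where W: "openin (zariski R) W" "p \<in> W" "W \<subseteq> U" "a \<in> carrier R" "g \<in> carrier R"
    "\<forall>q \<in> W. g \<notin> q" "\<forall>q \<in> W. s q = fraction R q a g"
    by (rule spec_sectionE[OF assms(3) pU])
  then show "locally_fraction R V (restrict s V) p"
    using p assms by (intro local_fractionI[of _ "V \<inter> W" _ _ a g]) (simp_all add: openin_Int subset_iff)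
qed simp

text \<open>Sum and product both multiply the denominators and differ only in the numerator n. On
  the intersection of the two local domains, one numerator and one denominator present the result at
  all primes simultaneously.\<close>

lemma spec_section_binop:
  assumes s: "s \<in> carrier (spec_sections R U)" and t: "t \<in> carrier (spec_sections R U)"
    and f: "\<And>q a g b h. \<lbrakk>primeideal q R; a \<in> carrier R; g \<in> carrier R - q; b \<in> carrier R;
        h \<in> carrier R - q\<rbrakk>
      \<Longrightarrow> f q (fraction R q a g) (fraction R q b h) = fraction R q (n a g b h) (g \<otimes>\<^bsub>R\<^esub> h)"
    and n: "\<And>a g b h. \<lbrakk>a \<in> carrier R; g \<in> carrier R; b \<in> carrier R; h \<in> carrier R\<rbrakk>
      \<Longrightarrow> n a g b h \<in> carrier R"
  shows "(\<lambda>p \<in> U. f p (s p) (t p)) \<in> carrier (spec_sections R U)"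
proof (rule spec_sectionI)
  fix p assume p: "p \<in> U"
  obtain V a g where V: "openin (zariski R) V" "p \<in> V" "V \<subseteq> U" "a \<in> carrier R" "g \<in> carrier R"
    "\<forall>q \<in> V. g \<notin> q" "\<forall>q \<in> V. s q = fraction R q a g"
    by (rule spec_sectionE[OF s p])
  obtain W b h where W: "openin (zariski R) W" "p \<in> W" "W \<subseteq> U" "b \<in> carrier R" "h \<in> carrier R"
    "\<forall>q \<in> W. h \<notin> q" "\<forall>q \<in> W. t q = fraction R q b h"
    by (rule spec_sectionE[OF t p])
  have "g \<otimes>\<^bsub>R\<^esub> h \<in> carrier R \<and> g \<otimes>\<^bsub>R\<^esub> h \<notin> q \<and>
      f q (s q) (t q) = fraction R q (n a g b h) (g \<otimes>\<^bsub>R\<^esub> h)"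
    if "q \<in> V \<inter> W" for q
  proof -
    interpret q: primeideal q R using that V zariski_open_prime by blast
    show ?thesis using that V W f[OF q.primeideal_axioms] q.I_prime[of g h] by auto
  qed
  then show "locally_fraction R U (\<lambda>p \<in> U. f p (s p) (t p)) p"
    using V W n[of a g b h]
    by (intro local_fractionI[of _ "V \<inter> W" _ _ "n a g b h" "g \<otimes>\<^bsub>R\<^esub> h"]) (simp_all add: openin_Int subset_iff)
qed simp

lemma
  assumes "cring R" "s \<in> carrier (spec_sections R U)" "t \<in> carrier (spec_sections R U)"
  shows spec_sections_mult_closed: "s \<otimes>\<^bsub>spec_sections R U\<^esub> t \<in> carrier (spec_sections R U)"
    and spec_sections_add_closed: "s \<oplus>\<^bsub>spec_sections R U\<^esub> t \<in> carrier (spec_sections R U)"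
proof -
  interpret cring R by fact
  note binop = spec_section_binop[OF assms(2,3)]
  show "s \<otimes>\<^bsub>spec_sections R U\<^esub> t \<in> carrier (spec_sections R U)"
    unfolding spec_sections_simps
    by (rule binop[where n = "\<lambda>a g b h. a \<otimes>\<^bsub>R\<^esub> b"]) (auto simp: primeideal.fraction_mult)
  show "s \<oplus>\<^bsub>spec_sections R U\<^esub> t \<in> carrier (spec_sections R U)"
    unfolding spec_sections_simps
    by (rule binop[where n = "\<lambda>a g b h. a \<otimes>\<^bsub>R\<^esub> h \<oplus>\<^bsub>R\<^esub> b \<otimes>\<^bsub>R\<^esub> g"])
      (auto simp: primeideal.fraction_add)
qed

lemma
  assumes "cring R" and U: "openin (zariski R) U"
  shows spec_sections_one_closed: "\<one>\<^bsub>spec_sections R U\<^esub> \<in> carrier (spec_sections R U)"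
    and spec_sections_zero_closed: "\<zero>\<^bsub>spec_sections R U\<^esub> \<in> carrier (spec_sections R U)"
proof -
  interpret cring R by fact
  have "\<one>\<^bsub>R\<^esub> \<notin> p" if "p \<in> U" for p
    using primeideal.one_notin[OF zariski_open_prime[OF U that]] .
  then show "\<one>\<^bsub>spec_sections R U\<^esub> \<in> carrier (spec_sections R U)"
    "\<zero>\<^bsub>spec_sections R U\<^esub> \<in> carrier (spec_sections R U)"
    using fraction_spec_section[OF U one_closed one_closed] fraction_spec_section[OF U zero_closed one_closed]
    by (simp_all add: localization_def)
qed

lemma spec_sections_neg_closed:
  assumes "cring R" "openin (zariski R) U" "s \<in> carrier (spec_sections R U)"
  shows "(\<lambda>p \<in> U. \<ominus>\<^bsub>localization R p\<^esub> s p) \<in> carrier (spec_sections R U)"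
proof (rule spec_sectionI)
  interpret cring R by fact
  fix p assume p: "p \<in> U"
  obtain V a g where V: "openin (zariski R) V" "p \<in> V" "V \<subseteq> U" "a \<in> carrier R" "g \<in> carrier R"
    "\<forall>q \<in> V. g \<notin> q" "\<forall>q \<in> V. s q = fraction R q a g"
    by (rule spec_sectionE[OF assms(3) p])
  have "\<ominus>\<^bsub>localization R q\<^esub> s q = fraction R q (\<ominus>\<^bsub>R\<^esub> a) g" if "q \<in> V" for q
    using that V zariski_open_prime[OF V(1)] by (simp add: primeideal.fraction_neg)
  then show "locally_fraction R U (\<lambda>p \<in> U. \<ominus>\<^bsub>localization R p\<^esub> s p) p"
    using V by (intro local_fractionI[of _ V _ _ "\<ominus>\<^bsub>R\<^esub> a" g]) (simp_all add: openin_Int subset_iff)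
qed simp

lemma cring_spec_sections:
  assumes R: "cring R" and U: "openin (zariski R) U"
  shows "cring (spec_sections R U)"
proof (rule cring_pointwise[of U "localization R"])
  show "cring (localization R p)" if "p \<in> U" for p
    using primeideal.cring_localization[OF zariski_open_prime[OF U that]] .
  show "carrier (spec_sections R U) \<subseteq> (\<Pi>\<^sub>E p \<in> U. carrier (localization R p))"
    by (auto simp: spec_sections_def)
qed (rule spec_sections_simps spec_sections_mult_closed[OF R] spec_sections_add_closed[OF R]
    spec_sections_one_closed[OF R U] spec_sections_zero_closed[OF R U]
    spec_sections_neg_closed[OF R U]; assumption)+

text \<open>Sections are functions subject to a local condition, so locality and gluing are those of
  functions. The local presentation of a glued section near p is taken from any member of the cover
  containing p.\<close>

lemma ringed_space_Spec:
  assumes R: "cring R"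
  shows "ringed_space (Spec R)"
proof (rule ringed_space.intro; (unfold Spec_simps)?)
  show "cring (spec_sections R U)" if "openin (zariski R) U" for U
    using R that by (rule cring_spec_sections)
  show "(\<lambda>s. restrict s V) \<in> ring_hom (spec_sections R U) (spec_sections R V)"
    if "openin (zariski R) U" "openin (zariski R) V" "V \<subseteq> U" for U V
    using that
    by (intro ring_hom_memI) (auto simp: restrict_spec_section Int_absorb1 intro!: restrict_ext)
  show "restrict s U = s" if "openin (zariski R) U" "s \<in> carrier (spec_sections R U)" for U s
    using that spec_section_ext extensional_restrict by blast
  show "restrict (restrict s V) W = restrict s W"
    if "openin (zariski R) U" "openin (zariski R) V" "openin (zariski R) W" "W \<subseteq> V" "V \<subseteq> U"
      "s \<in> carrier (spec_sections R U)" for U V W s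
    using that by (simp add: Int_absorb1)
  show "s = t"
    if "\<And>V. V \<in> C \<Longrightarrow> openin (zariski R) V" "s \<in> carrier (spec_sections R (\<Union>C))"
      "t \<in> carrier (spec_sections R (\<Union>C))" "\<And>V. V \<in> C \<Longrightarrow> restrict s V = restrict t V" for C s t
  proof (rule spec_section_eqI[OF that(2,3)])
    fix p assume "p \<in> \<Union>C"
    then obtain V where "V \<in> C" "p \<in> V" by blast
    then show "s p = t p" using that(4)[of V] by (metis restrict_apply')
  qed
  show "\<exists>s \<in> carrier (spec_sections R (\<Union>C)). \<forall>V \<in> C. restrict s V = \<sigma> V"
    if C: "\<And>V. V \<in> C \<Longrightarrow> openin (zariski R) V"
      and \<sigma>: "\<And>V. V \<in> C \<Longrightarrow> \<sigma> V \<in> carrier (spec_sections R V)"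
      and agree: "\<And>V W. \<lbrakk>V \<in> C; W \<in> C\<rbrakk> \<Longrightarrow> restrict (\<sigma> V) (V \<inter> W) = restrict (\<sigma> W) (V \<inter> W)"
    for C \<sigma>
  proof -
    \<comment> \<open>The choice is harmless: by agreement on overlaps every member of the cover
      containing p gives the same value there.\<close>
    define s where "s = (\<lambda>p \<in> \<Union>C. \<sigma> (SOME V. V \<in> C \<and> p \<in> V) p)"
    have s: "s p = \<sigma> V p" if "V \<in> C" "p \<in> V" for V p
    proof -
      let ?W = "SOME V. V \<in> C \<and> p \<in> V"
      have W: "?W \<in> C \<and> p \<in> ?W" by (rule someI[of _ V]) (use that in simp)
      then have "restrict (\<sigma> ?W) (?W \<inter> V) p = restrict (\<sigma> V) (?W \<inter> V) p"
        using agree[of ?W V] that by simp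
      then show ?thesis using W that by (auto simp: s_def)
    qed
    have "s \<in> carrier (spec_sections R (\<Union>C))"
    proof (rule spec_sectionI)
      fix p assume "p \<in> \<Union>C"
      then obtain V where V: "V \<in> C" "p \<in> V" by blast
      obtain W a g where W: "openin (zariski R) W" "p \<in> W" "W \<subseteq> V" "a \<in> carrier R" "g \<in> carrier R"
        "\<forall>q \<in> W. g \<notin> q" "\<forall>q \<in> W. \<sigma> V q = fraction R q a g"
        by (rule spec_sectionE[OF \<sigma>[OF V(1)] V(2)])
      then show "locally_fraction R (\<Union>C) s p"
        using V s[OF V(1)] by (intro local_fractionI[of _ W _ _ a g]) (simp_all add: subset_iff, metis)
    qed (simp add: s_def)
    moreover have "restrict s V = \<sigma> V" if "V \<in> C" for V
      using s[OF that] spec_section_ext[OF \<sigma>[OF that]] by (intro extensionalityI[of _ V]) auto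
    ultimately show ?thesis by blast
  qed
qed

text \<open>Evaluation at p maps the stalk to the localization at p. The preimage of its maximal
  ideal is a proper ideal, and a germ outside it has near p the form a/g with a not in p, so g/a
  inverts it. An identification of the stalk with the localization is thereby avoided.\<close>

lemma local_ring_stalk_Spec:
  assumes R: "cring R" and p: "primeideal p R"
  shows "local_ring (stalk (Spec R) p)"
proof -
  interpret S: ringed_space "Spec R" by (rule ringed_space_Spec[OF R])
  interpret p: primeideal p R by (rule p)
  let ?S = "stalk (Spec R) p" and ?L = "localization R p"
  have pS: "p \<in> topspace (base (Spec R))" using p by (simp add: topspace_zariski)
  interpret L: cring ?L by (rule p.cring_localization)
  interpret St: cring ?S by (rule S.stalk_cring[OF pS])
  \<comment> \<open>A value s p is itself a set of pairs, so the union over all representatives of a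
    germ returns their common value.\<close>
  define ev where "ev A = (\<Union>(U, s) \<in> A. s p)" for A :: "('a set set \<times> 'a spec_section) set"
  have ev: "ev (germ (Spec R) p U s) = s p"
    if "openin (zariski R) U" "p \<in> U" "s \<in> carrier (spec_sections R U)" for U s
    unfolding ev_def
  proof (rule UN_pair_const)
    show "(U, s) \<in> germ (Spec R) p U s" using that by (intro S.germ_self) auto
    fix V t assume "(V, t) \<in> germ (Spec R) p U s"
    then obtain W where "p \<in> W" "restrict s W = restrict t W" unfolding germ_def by auto
    then show "t p = s p" by (metis restrict_apply')
  qed
  have "ev \<in> ring_hom ?S ?L"
  proof (rule ring_hom_memI)
    fix A assume "A \<in> carrier ?S"
    then show "ev A \<in> carrier ?L"
      by (rule S.stalk_carrierE) (use ev spec_section_value in auto)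
  next
    fix A B assume "A \<in> carrier ?S" "B \<in> carrier ?S"
    then obtain U s t where U: "openin (zariski R) U" "p \<in> U" "s \<in> carrier (spec_sections R U)"
      "t \<in> carrier (spec_sections R U)"
      and A: "A = germ (Spec R) p U s" "B = germ (Spec R) p U t"
      by (rule S.stalk_carrierE2) simp
    note c = spec_sections_mult_closed[OF R U(3,4)] spec_sections_add_closed[OF R U(3,4)]
    have "A \<otimes>\<^bsub>?S\<^esub> B = germ (Spec R) p U (s \<otimes>\<^bsub>spec_sections R U\<^esub> t)"
      "A \<oplus>\<^bsub>?S\<^esub> B = germ (Spec R) p U (s \<oplus>\<^bsub>spec_sections R U\<^esub> t)"
      using U S.stalk_mult[of U p s t] S.stalk_add[of U p s t] by (simp_all add: A)
    then have "ev (A \<otimes>\<^bsub>?S\<^esub> B) = (s \<otimes>\<^bsub>spec_sections R U\<^esub> t) p"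
      "ev (A \<oplus>\<^bsub>?S\<^esub> B) = (s \<oplus>\<^bsub>spec_sections R U\<^esub> t) p"
      using ev[OF U(1,2) c(1)] ev[OF U(1,2) c(2)] by simp_all
    then show "ev (A \<otimes>\<^bsub>?S\<^esub> B) = ev A \<otimes>\<^bsub>?L\<^esub> ev B" "ev (A \<oplus>\<^bsub>?S\<^esub> B) = ev A \<oplus>\<^bsub>?L\<^esub> ev B"
      using U(2) ev[OF U(1,2,3)] ev[OF U(1,2,4)] by (simp_all add: A)
  next
    have T: "openin (zariski R) (topspace (zariski R))" "p \<in> topspace (zariski R)"
      using pS by auto
    show "ev \<one>\<^bsub>?S\<^esub> = \<one>\<^bsub>?L\<^esub>"
      using ev[OF T spec_sections_one_closed[OF R T(1)]] T
        S.stalk_one[of "topspace (zariski R)" p] by simp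
  qed
  then interpret ev: ring_hom_ring ?S ?L ev
    by (simp add: ring_hom_ring_def ring_hom_ring_axioms_def L.ring_axioms St.ring_axioms)
  show ?thesis
  proof (rule local_ringI)
    show "ideal {A \<in> carrier ?S. ev A \<in> p.localization_ideal} ?S"
      by (rule ev.ideal_vimage) (rule p.ideal_localization_ideal)
    show "\<one>\<^bsub>?S\<^esub> \<notin> {A \<in> carrier ?S. ev A \<in> p.localization_ideal}"
      using p.fraction_in_localization_ideal_iff[of "\<one>\<^bsub>R\<^esub>" "\<one>\<^bsub>R\<^esub>"] p.one_notin
      by (simp add: p.localization_one)
    fix A assume A: "A \<in> carrier ?S" "A \<notin> {A \<in> carrier ?S. ev A \<in> p.localization_ideal}"
    obtain U s where U: "openin (zariski R) U" "p \<in> U" "s \<in> carrier (spec_sections R U)"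
      "A = germ (Spec R) p U s"
      using A(1) by (rule S.stalk_carrierE) simp
    obtain V a g where V: "openin (zariski R) V" "p \<in> V" "V \<subseteq> U" "a \<in> carrier R" "g \<in> carrier R"
      "\<forall>q \<in> V. g \<notin> q" "\<forall>q \<in> V. s q = fraction R q a g"
      by (rule spec_sectionE[OF U(3,2)])
    have "a \<notin> p"
      using A U V ev[OF U(1-3)] p.fraction_in_localization_ideal_iff[of a g] by auto
    \<comment> \<open>Besides the domain V of the presentation a/g, the inverse needs a as an
      admissible denominator.\<close>
    define W where "W = V \<inter> {q. primeideal q R \<and> a \<notin> q}"
    have W: "openin (zariski R) W" "p \<in> W" "W \<subseteq> U"
      using V p \<open>a \<notin> p\<close> by (auto simp: W_def intro: openin_zariski_basic)
    let ?t = "\<lambda>q \<in> W. fraction R q g a"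
    have t: "?t \<in> carrier (spec_sections R W)"
      using W V by (intro fraction_spec_section) (auto simp: W_def)
    have sW: "restrict s W \<in> carrier (spec_sections R W)"
      using W U by (intro restrict_spec_section[of _ _ U])
    have "restrict s W \<otimes>\<^bsub>spec_sections R W\<^esub> ?t = \<one>\<^bsub>spec_sections R W\<^esub>"
      unfolding spec_sections_simps
    proof (rule restrict_ext)
      fix q assume q: "q \<in> W"
      then interpret q: primeideal q R by (simp add: W_def)
      have "a \<in> carrier R - q" "g \<in> carrier R - q" "s q = fraction R q a g"
        using V q by (auto simp: W_def)
      then show "restrict s W q \<otimes>\<^bsub>localization R q\<^esub> ?t q = \<one>\<^bsub>localization R q\<^esub>"
        using q q.one_notin
        by (simp add: q.fraction_mult q.localization_one)
          (rule q.fraction_eqI; simp add: q.mult_notin p.m_comm)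
    qed
    then have "A \<otimes>\<^bsub>?S\<^esub> germ (Spec R) p W ?t = \<one>\<^bsub>?S\<^esub>"
      using S.germ_res[of U W p s] S.stalk_mult[of W p "restrict s W" ?t] S.stalk_one[of W p]
        U W t sW by simp
    moreover have "germ (Spec R) p W ?t \<in> carrier ?S"
      using W t by (intro S.stalk_carrierI) simp_all
    ultimately show "\<exists>B \<in> carrier ?S. A \<otimes>\<^bsub>?S\<^esub> B = \<one>\<^bsub>?S\<^esub>" by blast
  qed (rule St.is_cring)
qed

section \<open>The spectrum of a localization as an open subscheme\<close>

lemma primeideal_Units:
  assumes "primeideal q S" "u \<in> Units S"
  shows "u \<notin> q"
proof
  interpret q: primeideal q S by fact
  assume "u \<in> q"
  moreover obtain v where "v \<in> carrier S" "u \<otimes>\<^bsub>S\<^esub> v = \<one>\<^bsub>S\<^esub>"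
    using assms(2) by (auto simp: Units_def)
  ultimately have "\<one>\<^bsub>S\<^esub> \<in> q" using q.I_r_closed[of u v] by simp
  then show False using q.one_notin by simp
qed

text \<open>An injective ring homomorphism identifying \<open>S\<close> with the localization of \<open>R\<close> at \<open>T\<close>, where
  \<open>T\<close> has the same saturation as the powers of \<open>f\<close>; hence \<open>Spec S\<close> is the complement of the zeros
  of \<open>f\<close> in \<open>Spec R\<close>.\<close>

locale principal_localization = ring_hom_cring R S \<phi> for R (structure) and S (structure) and \<phi> +
  fixes T f
  assumes inj: "inj_on \<phi> (carrier R)"
    and f: "f \<in> T"
    and T_closed: "g \<in> T \<Longrightarrow> g \<in> carrier R"
    and T_mult: "\<lbrakk>g \<in> T; h \<in> T\<rbrakk> \<Longrightarrow> g \<otimes>\<^bsub>R\<^esub> h \<in> T"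
    and T_unit: "g \<in> T \<Longrightarrow> \<phi> g \<in> Units S"
    and T_prime: "\<lbrakk>primeideal p R; f \<notin> p; g \<in> T\<rbrakk> \<Longrightarrow> g \<notin> p"
    and denominator: "s \<in> carrier S \<Longrightarrow> \<exists>g \<in> T. \<exists>r \<in> carrier R. \<phi> g \<otimes>\<^bsub>S\<^esub> s = \<phi> r"
begin

abbreviation contraction :: "'c set \<Rightarrow> 'a set" where
  "contraction q \<equiv> {r \<in> carrier R. \<phi> r \<in> q}"

lemma eqD: "\<lbrakk>\<phi> r = \<phi> r'; r \<in> carrier R; r' \<in> carrier R\<rbrakk> \<Longrightarrow> r = r'"
  using inj by (rule inj_onD)

lemma ring_hom_ring: "ring_hom_ring R S \<phi>"
  using homh R.ring_axioms S.ring_axioms by (simp add: ring_hom_ring_def ring_hom_ring_axioms_def)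

lemma contraction_prime: "primeideal q S \<Longrightarrow> primeideal (contraction q) R"
  by (rule ring_hom_ring.primeideal_vimage[OF ring_hom_ring R.is_cring])

lemma T_notin: "\<lbrakk>primeideal q S; g \<in> T\<rbrakk> \<Longrightarrow> \<phi> g \<notin> q"
  by (rule primeideal_Units[OF _ T_unit])

text \<open>The factor \<open>\<phi> g\<close> is a unit, hence outside every prime: membership of s
  is decided by any of its numerators.\<close>

lemma mem_iff:
  assumes q: "primeideal q S" and g: "g \<in> T" and "s \<in> carrier S" "r \<in> carrier R"
    and eq: "\<phi> g \<otimes>\<^bsub>S\<^esub> s = \<phi> r"
  shows "s \<in> q \<longleftrightarrow> \<phi> r \<in> q"
proof -
  interpret q: primeideal q S by (rule q)
  show ?thesis
    unfolding eq[symmetric]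
    using assms T_closed T_notin[OF q g] q.I_prime[of "\<phi> g" s] q.I_l_closed[of s "\<phi> g"] by auto
qed

text \<open>Every element of S has a numerator in R, and by \<open>mem_iff\<close> the contraction
  of a prime already decides about the numerators.\<close>

lemma contraction_inj:
  assumes q: "primeideal q S" and q': "primeideal q' S" and eq: "contraction q = contraction q'"
  shows "q = q'"
proof -
  have "s \<in> q \<longleftrightarrow> s \<in> q'" if s: "s \<in> carrier S" for s
  proof -
    obtain g r where g: "g \<in> T" "r \<in> carrier R" "\<phi> g \<otimes>\<^bsub>S\<^esub> s = \<phi> r"
      using denominator[OF s] by blast
    then have "\<phi> r \<in> q \<longleftrightarrow> \<phi> r \<in> q'" using eq by blast
    then show ?thesis using mem_iff[OF q g(1) s g(2,3)] mem_iff[OF q' g(1) s g(2,3)] by simp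
  qed
  moreover have "q \<subseteq> carrier S" "q' \<subseteq> carrier S"
    using q q' by (simp_all add: primeideal_def ideal_def additive_subgroup.a_subset)
  ultimately show ?thesis by blast
qed

lemma common_denominator:
  assumes s: "s \<in> carrier S" and t: "t \<in> carrier S"
  obtains g a b where "g \<in> T" "a \<in> carrier R" "b \<in> carrier R"
    "\<phi> g \<otimes>\<^bsub>S\<^esub> s = \<phi> a" "\<phi> g \<otimes>\<^bsub>S\<^esub> t = \<phi> b"
proof -
  obtain g a where g: "g \<in> T" "a \<in> carrier R" "\<phi> g \<otimes>\<^bsub>S\<^esub> s = \<phi> a" using denominator[OF s] by blast
  obtain h b where h: "h \<in> T" "b \<in> carrier R" "\<phi> h \<otimes>\<^bsub>S\<^esub> t = \<phi> b" using denominator[OF t] by blast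
  note c = s t g(2) h(2) T_closed[OF g(1)] T_closed[OF h(1)]
  have eq: "\<phi> (g \<otimes>\<^bsub>R\<^esub> h) \<otimes>\<^bsub>S\<^esub> s = \<phi> (h \<otimes>\<^bsub>R\<^esub> a)" "\<phi> (g \<otimes>\<^bsub>R\<^esub> h) \<otimes>\<^bsub>S\<^esub> t = \<phi> (g \<otimes>\<^bsub>R\<^esub> b)"
    using c by (simp_all add: g(3)[symmetric] h(3)[symmetric] S.m_ac)
  show thesis by (rule that[OF T_mult[OF g(1) h(1)] _ _ eq]) (use c in simp_all)
qed

text \<open>The prime over p consists of the elements with a numerator in p. Two presentations of
  one element differ by denominators from \<open>T\<close>, and these avoid p by
  \<open>T_prime\<close> because f does; injectivity of \<open>\<phi>\<close> carries the comparison
  back to R.\<close>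

lemma contraction_surj:
  assumes p: "primeideal p R" and fp: "f \<notin> p"
  obtains q where "primeideal q S" "contraction q = p"
proof -
  interpret p: primeideal p R by (rule p)
  define q where "q = {s \<in> carrier S. \<exists>g \<in> T. \<exists>r \<in> p. \<phi> g \<otimes>\<^bsub>S\<^esub> s = \<phi> r}"
  have iff: "s \<in> q \<longleftrightarrow> r \<in> p"
    if g: "g \<in> T" and s: "s \<in> carrier S" and r: "r \<in> carrier R" and eq: "\<phi> g \<otimes>\<^bsub>S\<^esub> s = \<phi> r" for g s r
  proof
    assume "s \<in> q"
    then obtain h r' where h: "h \<in> T" "r' \<in> p" "\<phi> h \<otimes>\<^bsub>S\<^esub> s = \<phi> r'" by (auto simp: q_def)
    note c = s r p.Icarr[OF h(2)] T_closed[OF g] T_closed[OF h(1)]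
    have "\<phi> (h \<otimes>\<^bsub>R\<^esub> r) = \<phi> h \<otimes>\<^bsub>S\<^esub> (\<phi> g \<otimes>\<^bsub>S\<^esub> s)" using c by (simp add: eq)
    also have "\<dots> = \<phi> g \<otimes>\<^bsub>S\<^esub> (\<phi> h \<otimes>\<^bsub>S\<^esub> s)" using c by (simp add: S.m_ac)
    also have "\<dots> = \<phi> (g \<otimes>\<^bsub>R\<^esub> r')" using c by (simp add: h(3))
    finally have "h \<otimes>\<^bsub>R\<^esub> r = g \<otimes>\<^bsub>R\<^esub> r'" by (rule eqD) (use c in auto)
    then have "h \<otimes>\<^bsub>R\<^esub> r \<in> p" using p.I_l_closed[OF h(2) c(4)] by simp
    then show "r \<in> p" using p.I_prime[OF c(5,2)] T_prime[OF p fp h(1)] by blast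
  qed (use that in \<open>auto simp: q_def\<close>)
  have qS: "s \<in> carrier S" if "s \<in> q" for s using that by (simp add: q_def)
  have mult: "s \<otimes>\<^bsub>S\<^esub> t \<in> q \<longleftrightarrow> s \<in> q \<or> t \<in> q" if s: "s \<in> carrier S" and t: "t \<in> carrier S" for s t
  proof -
    obtain g a b where g: "g \<in> T" "a \<in> carrier R" "b \<in> carrier R"
      "\<phi> g \<otimes>\<^bsub>S\<^esub> s = \<phi> a" "\<phi> g \<otimes>\<^bsub>S\<^esub> t = \<phi> b"
      using common_denominator[OF s t] .
    note c = s t g(2,3) T_closed[OF g(1)]
    have "\<phi> (g \<otimes>\<^bsub>R\<^esub> g) \<otimes>\<^bsub>S\<^esub> (s \<otimes>\<^bsub>S\<^esub> t) = (\<phi> g \<otimes>\<^bsub>S\<^esub> s) \<otimes>\<^bsub>S\<^esub> (\<phi> g \<otimes>\<^bsub>S\<^esub> t)"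
      using c by (simp add: S.m_ac)
    also have "\<dots> = \<phi> (a \<otimes>\<^bsub>R\<^esub> b)" using c by (simp add: g)
    finally have "s \<otimes>\<^bsub>S\<^esub> t \<in> q \<longleftrightarrow> a \<otimes>\<^bsub>R\<^esub> b \<in> p"
      using c by (intro iff[OF T_mult[OF g(1,1)]]) auto
    also have "\<dots> \<longleftrightarrow> a \<in> p \<or> b \<in> p"
      using p.I_prime[OF g(2,3)] p.I_l_closed[OF _ g(2)] p.I_r_closed[OF _ g(3)] by blast
    finally show ?thesis using iff[OF g(1) s g(2,4)] iff[OF g(1) t g(3,5)] by simp
  qed
  have "primeideal q S"
  proof (rule primeidealI)
    \<comment> \<open>The element one is presented with f as both denominator and numerator,
      \<open>T\<close> being a set in which only f is given; the claim reduces to f not being in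
      p.\<close>
    have "\<one>\<^bsub>S\<^esub> \<notin> q"
      using iff[OF f, of "\<one>\<^bsub>S\<^esub>" f] fp T_closed[OF f] by simp
    then show "carrier S \<noteq> q" by auto
    show "ideal q S"
    proof (rule idealI)
      show "subgroup q (add_monoid S)"
      proof (rule S.add.subgroupI)
        show "q \<subseteq> carrier S" using qS by blast
        show "q \<noteq> {}"
          using iff[OF f, of "\<zero>\<^bsub>S\<^esub>" "\<zero>\<^bsub>R\<^esub>"] T_closed[OF f]
          by (auto simp: additive_subgroup.zero_closed[OF p.additive_subgroup_axioms])
        fix s assume s: "s \<in> q"
        \<comment> \<open>Negation is multiplication by minus one, so \<open>mult\<close>
          applies.\<close>
        show "\<ominus>\<^bsub>S\<^esub> s \<in> q"
          using mult[of "\<ominus>\<^bsub>S\<^esub> \<one>\<^bsub>S\<^esub>" s] s qS[OF s] by (simp add: S.l_minus)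
        fix t assume t: "t \<in> q"
        obtain g a b where g: "g \<in> T" "a \<in> carrier R" "b \<in> carrier R"
          "\<phi> g \<otimes>\<^bsub>S\<^esub> s = \<phi> a" "\<phi> g \<otimes>\<^bsub>S\<^esub> t = \<phi> b"
          using common_denominator[OF qS[OF s] qS[OF t]] .
        have "a \<oplus>\<^bsub>R\<^esub> b \<in> p"
          using iff[OF g(1) qS[OF s] g(2,4)] iff[OF g(1) qS[OF t] g(3,5)] s t p.a_closed by blast
        then show "s \<oplus>\<^bsub>S\<^esub> t \<in> q"
          using iff[OF g(1), of "s \<oplus>\<^bsub>S\<^esub> t" "a \<oplus>\<^bsub>R\<^esub> b"] qS[OF s] qS[OF t] g T_closed[OF g(1)]
          by (simp add: S.r_distr)
      qed
    qed (use mult qS S.ring_axioms in auto)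
  qed (use mult S.is_cring in auto)
  moreover have "r \<in> contraction q \<longleftrightarrow> r \<in> p" if r: "r \<in> carrier R" for r
    using iff[OF f, of "\<phi> r" "f \<otimes>\<^bsub>R\<^esub> r"] r T_closed[OF f] fp p.I_prime[of f r]
      p.I_l_closed[of r f] by auto
  then have "contraction q = p" using p.Icarr by blast
  ultimately show thesis by (rule that)
qed

lemma contraction_image: "contraction ` {q. primeideal q S} = {p. primeideal p R \<and> f \<notin> p}"
proof (intro equalityI subsetI)
  fix p assume "p \<in> {p. primeideal p R \<and> f \<notin> p}"
  then have p: "primeideal p R" "f \<notin> p" by auto
  obtain q where "primeideal q S" "contraction q = p" by (rule contraction_surj[OF p])
  then show "p \<in> contraction ` {q. primeideal q S}" by (intro image_eqI[of _ _ q]) simp_all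
qed (use contraction_prime T_notin[OF _ f] in auto)

lemma fraction_map:
  assumes q: "primeideal q S" and a: "a \<in> carrier R" and s: "s \<in> carrier R" "\<phi> s \<notin> q"
  shows "localization_map S q \<phi> (fraction R (contraction q) a s) = fraction S q (\<phi> a) (\<phi> s)"
  unfolding localization_map_def
proof (rule UN_pair_const)
  interpret q: primeideal q S by (rule q)
  interpret p: primeideal "contraction q" R by (rule contraction_prime[OF q])
  note [simp del] = p.a_Hcarr
  show "(a, s) \<in> fraction R (contraction q) a s" using a s by (intro p.fraction_self) auto
  fix b t assume "(b, t) \<in> fraction R (contraction q) a s"
  then obtain u where b: "b \<in> carrier R" "t \<in> carrier R" "\<phi> t \<notin> q" and u: "u \<in> carrier R" "\<phi> u \<notin> q"
    "u \<otimes>\<^bsub>R\<^esub> (a \<otimes>\<^bsub>R\<^esub> t) = u \<otimes>\<^bsub>R\<^esub> (b \<otimes>\<^bsub>R\<^esub> s)"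
    by (auto simp: fraction_def)
  have "\<phi> (u \<otimes>\<^bsub>R\<^esub> (a \<otimes>\<^bsub>R\<^esub> t)) = \<phi> (u \<otimes>\<^bsub>R\<^esub> (b \<otimes>\<^bsub>R\<^esub> s))" using u(3) by simp
  then have "\<phi> u \<otimes>\<^bsub>S\<^esub> (\<phi> b \<otimes>\<^bsub>S\<^esub> \<phi> s) = \<phi> u \<otimes>\<^bsub>S\<^esub> (\<phi> a \<otimes>\<^bsub>S\<^esub> \<phi> t)"
    using a b(1,2) s(1) u(1) by simp
  then show "fraction S q (\<phi> b) (\<phi> t) = fraction S q (\<phi> a) (\<phi> s)"
    using a b s u(1,2) by (intro q.fraction_eqI'[of _ _ _ _ "\<phi> u"]) auto
qed

text \<open>An equality of fractions over S is witnessed by some u outside q. Multiplying u by a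
  denominator turns it into an element r of R outside the contraction, and injectivity of
  \<open>\<phi>\<close> brings the equation down to R.\<close>

lemma localization_map_inj:
  assumes q: "primeideal q S"
  shows "inj_on (localization_map S q \<phi>) (carrier (localization R (contraction q)))"
proof (rule inj_onI)
  interpret q: primeideal q S by (rule q)
  interpret p: primeideal "contraction q" R by (rule contraction_prime[OF q])
  note [simp del] = p.a_Hcarr
  fix A B assume A: "A \<in> carrier (localization R (contraction q))"
    and B: "B \<in> carrier (localization R (contraction q))"
    and eq: "localization_map S q \<phi> A = localization_map S q \<phi> B"
  obtain a s where a: "a \<in> carrier R" "s \<in> carrier R - contraction q"
    "A = fraction R (contraction q) a s"
    using A by (rule p.localizationE)
  obtain b t where b: "b \<in> carrier R" "t \<in> carrier R - contraction q"
    "B = fraction R (contraction q) b t"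
    using B by (rule p.localizationE)
  have "fraction S q (\<phi> a) (\<phi> s) = fraction S q (\<phi> b) (\<phi> t)"
    using eq a b by (simp add: fraction_map[OF q])
  then obtain u where u: "u \<in> carrier S - q"
    "u \<otimes>\<^bsub>S\<^esub> (\<phi> a \<otimes>\<^bsub>S\<^esub> \<phi> t) = u \<otimes>\<^bsub>S\<^esub> (\<phi> b \<otimes>\<^bsub>S\<^esub> \<phi> s)"
    using q.fraction_eq_iff[of "\<phi> a" "\<phi> s" "\<phi> b" "\<phi> t"] a b by auto
  then obtain g r where g: "g \<in> T" "r \<in> carrier R" "\<phi> g \<otimes>\<^bsub>S\<^esub> u = \<phi> r"
    using denominator[of u] by auto
  note c = a(1) b(1) T_closed[OF g(1)] g(2)
  have "s \<in> carrier R" "t \<in> carrier R" "u \<in> carrier S" using a b u by auto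
  note c = this c
  have "\<phi> (r \<otimes>\<^bsub>R\<^esub> (a \<otimes>\<^bsub>R\<^esub> t)) = \<phi> g \<otimes>\<^bsub>S\<^esub> (u \<otimes>\<^bsub>S\<^esub> (\<phi> a \<otimes>\<^bsub>S\<^esub> \<phi> t))"
    using c by (simp add: g(3)[symmetric] S.m_assoc)
  also have "\<dots> = \<phi> (r \<otimes>\<^bsub>R\<^esub> (b \<otimes>\<^bsub>R\<^esub> s))"
    unfolding u(2) using c by (simp add: g(3)[symmetric] S.m_assoc)
  finally have "r \<otimes>\<^bsub>R\<^esub> (a \<otimes>\<^bsub>R\<^esub> t) = r \<otimes>\<^bsub>R\<^esub> (b \<otimes>\<^bsub>R\<^esub> s)" by (rule eqD) (use c in auto)
  moreover have "r \<in> carrier R - contraction q"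
    using mem_iff[OF q g(1) _ g(2,3)] u g by auto
  ultimately show "A = B"
    unfolding a(3) b(3) using a b by (intro p.fraction_eqI'[of _ _ _ _ r]) auto
qed

text \<open>Clearing numerator and denominator with one common h gives a pair independent of q. This
  uniformity turns a local presentation over S into one over R.\<close>

lemma fraction_descends:
  assumes "a \<in> carrier S" "g \<in> carrier S"
  obtains a' g' where "a' \<in> carrier R" "g' \<in> carrier R"
    "\<And>q. \<lbrakk>primeideal q S; g \<notin> q\<rbrakk> \<Longrightarrow> \<phi> g' \<notin> q \<and> fraction S q a g = fraction S q (\<phi> a') (\<phi> g')"
proof -
  obtain h b c where h: "h \<in> T" "b \<in> carrier R" "c \<in> carrier R"
    "\<phi> h \<otimes>\<^bsub>S\<^esub> a = \<phi> b" "\<phi> h \<otimes>\<^bsub>S\<^esub> g = \<phi> c"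
    using common_denominator[OF assms] .
  show thesis
  proof (rule that[OF h(2,3)])
    fix q assume q: "primeideal q S" "g \<notin> q"
    interpret q: primeideal q S by (rule q)
    have c: "\<phi> c \<notin> q" using mem_iff[OF q(1) h(1) assms(2) h(3,5)] q(2) by simp
    have "a \<otimes>\<^bsub>S\<^esub> \<phi> c = \<phi> b \<otimes>\<^bsub>S\<^esub> g"
      using assms T_closed[OF h(1)] by (simp add: h(4,5)[symmetric] S.m_ac)
    then have "fraction S q a g = fraction S q (\<phi> b) (\<phi> c)"
      using assms h(2,3) q(2) c by (intro q.fraction_eqI) auto
    with c show "\<phi> c \<notin> q \<and> fraction S q a g = fraction S q (\<phi> b) (\<phi> c)" by simp
  qed
qed

abbreviation point_map :: "'c set \<Rightarrow> 'a set" where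
  "point_map \<equiv> fst (Spec_map R S \<phi>)"

abbreviation section_map :: "'a set set \<Rightarrow> 'a spec_section \<Rightarrow> 'c spec_section" where
  "section_map \<equiv> snd (Spec_map R S \<phi>)"

lemma point_map_apply: "primeideal q S \<Longrightarrow> point_map q = contraction q"
  by (simp add: Spec_map_def Let_def topspace_zariski)

lemma preim_point_map: "preim (Spec S) point_map V = {q. primeideal q S \<and> contraction q \<in> V}"
  by (auto simp: preim_def topspace_zariski point_map_apply)

lemma section_map_apply:
  assumes "openin (zariski R) V" "s \<in> carrier (spec_sections R V)"
    and "primeideal q S" "contraction q \<in> V"
  shows "section_map V s q = localization_map S q \<phi> (s (contraction q))"
  using assms preim_point_map[of V]
  by (simp add: Spec_map_def Let_def topspace_zariski)

lemma point_map_image: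
  assumes "openin (zariski S) U"
  shows "point_map ` U = contraction ` U"
  by (intro image_cong refl point_map_apply zariski_open_prime[OF assms])

lemma openin_preim_point_map:
  assumes "openin (zariski R) V"
  shows "openin (zariski S) {q. primeideal q S \<and> contraction q \<in> V}"
proof -
  obtain E where E: "E \<subseteq> carrier R" "V = spec_open R E"
    using assms by (auto simp: openin_zariski)
  have "{q. primeideal q S \<and> contraction q \<in> V} = spec_open S (\<phi> ` E)"
    using E contraction_prime by (auto simp: spec_open_def)
  moreover have "\<phi> ` E \<subseteq> carrier S" using E by auto
  ultimately show ?thesis by (auto simp: openin_zariski)
qed

lemma openin_image_contraction:
  assumes "openin (zariski S) U"
  shows "openin (zariski R) (contraction ` U)"
proof -
  obtain E where E: "E \<subseteq> carrier S" "U = spec_open S E"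
    using assms by (auto simp: openin_zariski)
  \<comment> \<open>The numerators r of the elements of E cut out the right primes among the
    contractions; the factor f confines the open set to the contractions.\<close>
  define E' where "E' = {f \<otimes>\<^bsub>R\<^esub> r | r. r \<in> carrier R \<and> (\<exists>g \<in> T. \<exists>e \<in> E. \<phi> g \<otimes>\<^bsub>S\<^esub> e = \<phi> r)}"
  have fR: "f \<in> carrier R" by (rule T_closed[OF f])
  have "contraction ` U = spec_open R E'"
  proof (intro equalityI subsetI)
    fix p assume "p \<in> contraction ` U"
    then obtain q e where q: "primeideal q S" "p = contraction q" and e: "e \<in> E" "e \<notin> q"
      using E by (auto simp: spec_open_def)
    obtain g r where g: "g \<in> T" "r \<in> carrier R" "\<phi> g \<otimes>\<^bsub>S\<^esub> e = \<phi> r"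
      using denominator[of e] e E by blast
    have "e \<in> carrier S" using e E by blast
    then have "\<phi> r \<notin> q" using mem_iff[OF q(1) g(1) _ g(2,3)] e by simp
    then have "r \<notin> p" "f \<notin> p" using T_notin[OF q(1) f] by (simp_all add: q(2))
    interpret p: primeideal p R unfolding q by (rule contraction_prime[OF q(1)])
    note [simp del] = p.a_Hcarr
    from \<open>r \<notin> p\<close> \<open>f \<notin> p\<close> have "f \<otimes>\<^bsub>R\<^esub> r \<notin> p" using fR g by (intro p.mult_notin) auto
    moreover have "f \<otimes>\<^bsub>R\<^esub> r \<in> E'" using g e by (auto simp: E'_def)
    ultimately show "p \<in> spec_open R E'" using p.primeideal_axioms by (auto simp: spec_open_def)
  next
    fix p assume "p \<in> spec_open R E'"
    then obtain r g e where p: "primeideal p R" and r: "r \<in> carrier R" "f \<otimes>\<^bsub>R\<^esub> r \<notin> p"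
      and g: "g \<in> T" "e \<in> E" "\<phi> g \<otimes>\<^bsub>S\<^esub> e = \<phi> r"
      by (auto simp: spec_open_def E'_def)
    interpret p: primeideal p R by (rule p)
    note [simp del] = p.a_Hcarr
    have "f \<notin> p" "r \<notin> p" using r fR p.I_l_closed p.I_r_closed by blast+
    obtain q where q: "primeideal q S" "contraction q = p" by (rule contraction_surj[OF p \<open>f \<notin> p\<close>])
    have "\<phi> r \<notin> q" using \<open>r \<notin> p\<close> r q by auto
    then have "e \<notin> q" using mem_iff[OF q(1) g(1) _ r(1) g(3)] g E by auto
    then have "q \<in> U" using q g E by (auto simp: spec_open_def)
    then show "p \<in> contraction ` U" using q by (intro image_eqI[of _ _ q]) simp_all
  qed
  moreover have "E' \<subseteq> carrier R" using fR by (auto simp: E'_def)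
  ultimately show ?thesis by (auto simp: openin_zariski)
qed

lemma section_map_closed:
  assumes V: "openin (zariski R) V" and s: "s \<in> carrier (spec_sections R V)"
  shows "section_map V s \<in> carrier (spec_sections S (preim (Spec S) point_map V))"
proof (rule spec_sectionI)
  show "section_map V s \<in> extensional (preim (Spec S) point_map V)"
    using V s by (simp add: Spec_map_def Let_def)
  fix q assume "q \<in> preim (Spec S) point_map V"
  then have q: "primeideal q S" "contraction q \<in> V" by (auto simp: preim_point_map)
  obtain W a g where W: "openin (zariski R) W" "contraction q \<in> W" "W \<subseteq> V" "a \<in> carrier R"
    "g \<in> carrier R" "\<forall>q \<in> W. g \<notin> q" "\<forall>q \<in> W. s q = fraction R q a g"
    by (rule spec_sectionE[OF s q(2)])
  show "locally_fraction S (preim (Spec S) point_map V) (section_map V s) q"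
  proof (rule local_fractionI[of _ "preim (Spec S) point_map W" _ _ "\<phi> a" "\<phi> g"])
    show "openin (zariski S) (preim (Spec S) point_map W)"
      unfolding preim_point_map by (rule openin_preim_point_map[OF W(1)])
    fix q' assume "q' \<in> preim (Spec S) point_map W"
    then have q': "primeideal q' S" "contraction q' \<in> W" by (auto simp: preim_point_map)
    then show "\<phi> g \<notin> q'" using W by auto
    then show "section_map V s q' = fraction S q' (\<phi> a) (\<phi> g)"
      using q' W by (subst section_map_apply[OF V s]) (auto simp: fraction_map)
  qed (use q W in \<open>auto simp: preim_point_map\<close>)
qed

lemma localization_map_hom:
  assumes q: "primeideal q S"
  shows "localization_map S q \<phi> \<in> ring_hom (localization R (contraction q)) (localization S q)"
proof (rule ring_hom_memI)
  interpret q: primeideal q S by (rule q)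
  interpret p: primeideal "contraction q" R by (rule contraction_prime[OF q])
  note [simp del] = p.a_Hcarr
  let ?p = "contraction q"
  {
    fix A assume "A \<in> carrier (localization R ?p)"
    then obtain a s where a: "a \<in> carrier R" "s \<in> carrier R - ?p" "A = fraction R ?p a s"
      by (rule p.localizationE)
    then show "localization_map S q \<phi> A \<in> carrier (localization S q)"
      using q by (simp add: fraction_map q.fraction_closed)
    fix B assume "B \<in> carrier (localization R ?p)"
    then obtain b t where b: "b \<in> carrier R" "t \<in> carrier R - ?p" "B = fraction R ?p b t"
      by (rule p.localizationE)
    have st: "s \<otimes>\<^bsub>R\<^esub> t \<in> carrier R - ?p" using a b p.mult_notin by auto
    then have st': "\<phi> s \<otimes>\<^bsub>S\<^esub> \<phi> t \<notin> q" using a b by auto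
    show "localization_map S q \<phi> (A \<otimes>\<^bsub>localization R ?p\<^esub> B)
        = localization_map S q \<phi> A \<otimes>\<^bsub>localization S q\<^esub> localization_map S q \<phi> B"
      "localization_map S q \<phi> (A \<oplus>\<^bsub>localization R ?p\<^esub> B)
        = localization_map S q \<phi> A \<oplus>\<^bsub>localization S q\<^esub> localization_map S q \<phi> B"
      using a(1,2) b(1,2) st st' q unfolding a(3) b(3)
      by (simp_all add: p.fraction_mult p.fraction_add fraction_map q.fraction_mult q.fraction_add)
  }
  show "localization_map S q \<phi> \<one>\<^bsub>localization R ?p\<^esub> = \<one>\<^bsub>localization S q\<^esub>"
    using q.one_notin by (simp add: p.localization_one q.localization_one fraction_map q)
qed

text \<open>Over an open V inside the image every point of V has exactly one prime of S above it.
  Injectivity on sections is then injectivity of the localization maps, point by point. Surjectivity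
  inverts these maps pointwise, and \<open>fraction_descends\<close> together with openness of
  contraction shows that the result is locally a fraction over R.\<close>

lemma open_immersion_Spec_map:
  "open_immersion (Spec S) (Spec R) point_map section_map"
proof -
  interpret SR: ringed_space "Spec R" by (rule ringed_space_Spec) (rule R.is_cring)
  interpret SS: ringed_space "Spec S" by (rule ringed_space_Spec) (rule S.is_cring)
  let ?P = "preim (Spec S) point_map"
  show ?thesis
  proof unfold_locales
    show "continuous_map (base (Spec S)) (base (Spec R)) point_map"
      unfolding continuous_map_def
    proof (intro conjI allI impI)
      show "point_map \<in> topspace (base (Spec S)) \<rightarrow> topspace (base (Spec R))"
        using contraction_prime by (auto simp: topspace_zariski point_map_apply)
      fix V assume "openin (base (Spec R)) V"
      then show "openin (base (Spec S)) {x \<in> topspace (base (Spec S)). point_map x \<in> V}"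
        using openin_preim_point_map[of V] preim_point_map[of V] by (simp add: preim_def)
    qed
    show "point_map \<in> extensional (topspace (base (Spec S)))"
      "section_map \<in> extensional {V. openin (base (Spec R)) V}"
      by (simp_all add: Spec_map_def Let_def)
    show "inj_on point_map (topspace (base (Spec S)))"
      by (rule inj_onI) (simp add: topspace_zariski point_map_apply contraction_inj)
    show "openin (base (Spec R)) (point_map ` U)" if "openin (base (Spec S)) U" for U
      using that openin_image_contraction by (simp add: point_map_image)
    fix V assume "openin (base (Spec R)) V"
    then have V: "openin (zariski R) V" by simp
    show "section_map V \<in> extensional (carrier (sec (Spec R) V))"
      using V by (simp add: Spec_map_def Let_def)
    show "section_map V \<in> ring_hom (sec (Spec R) V) (sec (Spec S) (?P V))"
    proof (rule ring_hom_memI)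
      interpret VR: cring "spec_sections R V" by (rule cring_spec_sections[OF R.is_cring V])
      note ext = spec_section_ext[OF section_map_closed[OF V]]
      note simps = preim_point_map section_map_apply[OF V] spec_section_value
        ring_hom_mult[OF localization_map_hom] ring_hom_add[OF localization_map_hom]
        ring_hom_one[OF localization_map_hom]
      show "section_map V \<one>\<^bsub>sec (Spec R) V\<^esub> = \<one>\<^bsub>sec (Spec S) (?P V)\<^esub>"
        using ext[OF VR.one_closed] VR.one_closed
        by (intro extensionalityI[of _ "?P V"]) (simp_all add: simps)
      fix s assume "s \<in> carrier (sec (Spec R) V)"
      then have s: "s \<in> carrier (spec_sections R V)" by simp
      then show "section_map V s \<in> carrier (sec (Spec S) (?P V))"
        using section_map_closed[OF V] by simp
      fix t assume "t \<in> carrier (sec (Spec R) V)"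
      then have t: "t \<in> carrier (spec_sections R V)" by simp
      show "section_map V (s \<otimes>\<^bsub>sec (Spec R) V\<^esub> t)
          = section_map V s \<otimes>\<^bsub>sec (Spec S) (?P V)\<^esub> section_map V t"
        using ext[OF VR.m_closed[OF s t]] VR.m_closed[OF s t] s t
        by (intro extensionalityI[of _ "?P V"]) (simp_all add: simps)
      show "section_map V (s \<oplus>\<^bsub>sec (Spec R) V\<^esub> t)
          = section_map V s \<oplus>\<^bsub>sec (Spec S) (?P V)\<^esub> section_map V t"
        using ext[OF VR.a_closed[OF s t]] VR.a_closed[OF s t] s t
        by (intro extensionalityI[of _ "?P V"]) (simp_all add: simps)
    qed
    show "section_map W (res (Spec R) V W t) = res (Spec S) (?P V) (?P W) (section_map V t)"
      if W: "openin (base (Spec R)) W" "W \<subseteq> V" and t: "t \<in> carrier (sec (Spec R) V)" for W t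
    proof (rule extensionalityI[of _ "?P W"])
      have W': "openin (zariski R) W" and t': "t \<in> carrier (spec_sections R V)" using W t by auto
      note rt = restrict_spec_section[OF W' W(2) t']
      show "section_map W (res (Spec R) V W t) \<in> extensional (?P W)"
        using section_map_closed[OF W' rt] spec_section_ext by auto
      fix q assume "q \<in> ?P W"
      then have q: "primeideal q S" "contraction q \<in> W" "q \<in> ?P W" by (auto simp: preim_point_map)
      then show "section_map W (res (Spec R) V W t) q = res (Spec S) (?P V) (?P W) (section_map V t) q"
        using section_map_apply[OF W' rt q(1,2)] section_map_apply[OF V t' q(1)] W(2) by auto
    qed simp
    assume "V \<subseteq> point_map ` topspace (base (Spec S))"
    then have V': "V \<subseteq> contraction ` {q. primeideal q S}"
      by (simp add: topspace_zariski point_map_apply cong: image_cong_simp)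
    show "bij_betw (section_map V) (carrier (sec (Spec R) V)) (carrier (sec (Spec S) (?P V)))"
      unfolding bij_betw_def
    proof (intro conjI inj_onI equalityI subsetI)
      fix s t assume st: "s \<in> carrier (sec (Spec R) V)" "t \<in> carrier (sec (Spec R) V)"
        and eq: "section_map V s = section_map V t"
      then have s: "s \<in> carrier (spec_sections R V)" and t: "t \<in> carrier (spec_sections R V)" by auto
      show "s = t"
      proof (rule spec_section_eqI[OF s t])
        fix p assume p: "p \<in> V"
        then obtain q where q: "primeideal q S" "p = contraction q" using V' by blast
        have "localization_map S q \<phi> (s p) = localization_map S q \<phi> (t p)"
          using section_map_apply[OF V s q(1)] section_map_apply[OF V t q(1)] eq p q(2) by simp
        then show "s p = t p"
          by (rule inj_onD[OF localization_map_inj[OF q(1)], folded q(2)])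
            (use spec_section_value[OF s p] spec_section_value[OF t p] in auto)
      qed
    next
      fix t assume "t \<in> carrier (sec (Spec S) (?P V))"
      then have t: "t \<in> carrier (spec_sections S (?P V))" by simp
      \<comment> \<open>The only candidate: at p, the preimage of the value of t at the unique prime
        q above p.\<close>
      define s where "s = (\<lambda>p \<in> V. let q = inv_into {q. primeideal q S} (\<lambda>q. contraction q) p in
        inv_into (carrier (localization R p)) (localization_map S q \<phi>) (t q))"
      have inv: "inv_into {q. primeideal q S} (\<lambda>q. contraction q) (contraction q) = q"
        if "primeideal q S" for q
        using that contraction_inj by (intro inv_into_f_f inj_onI) auto
      \<comment> \<open>A single pair a, g from R presents t on W and s on the contraction of W.
        This gives both that s is a section and that s maps to t.\<close>
      have local: "\<exists>W a g. openin (zariski S) W \<and> q \<in> W \<and> W \<subseteq> ?P V \<and> a \<in> carrier R \<and> g \<in> carrier R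
          \<and> (\<forall>q' \<in> W. \<phi> g \<notin> q' \<and> t q' = fraction S q' (\<phi> a) (\<phi> g)
            \<and> s (contraction q') = fraction R (contraction q') a g)"
        if q: "q \<in> ?P V" for q
      proof -
        obtain W a g where W: "openin (zariski S) W" "q \<in> W" "W \<subseteq> ?P V" "a \<in> carrier S"
          "g \<in> carrier S" "\<forall>q \<in> W. g \<notin> q" "\<forall>q \<in> W. t q = fraction S q a g"
          by (rule spec_sectionE[OF t q])
        obtain a' g' where a': "a' \<in> carrier R" "g' \<in> carrier R"
          "\<And>q. \<lbrakk>primeideal q S; g \<notin> q\<rbrakk> \<Longrightarrow> \<phi> g' \<notin> q \<and> fraction S q a g = fraction S q (\<phi> a') (\<phi> g')"
          using fraction_descends[OF W(4,5)] by metis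
        have "\<phi> g' \<notin> q' \<and> t q' = fraction S q' (\<phi> a') (\<phi> g')
            \<and> s (contraction q') = fraction R (contraction q') a' g'" if q': "q' \<in> W" for q'
        proof -
          have pr: "primeideal q' S" "contraction q' \<in> V"
            using q' W(3) by (auto simp: preim_point_map)
          interpret p: primeideal "contraction q'" R by (rule contraction_prime[OF pr(1)])
          note [simp del] = p.a_Hcarr
          have 1: "\<phi> g' \<notin> q'" "t q' = fraction S q' (\<phi> a') (\<phi> g')"
            using a'(3)[OF pr(1)] W q' by auto
          then have "t q' = localization_map S q' \<phi> (fraction R (contraction q') a' g')"
            using fraction_map[OF pr(1)] a' by simp
          moreover have "fraction R (contraction q') a' g' \<in> carrier (localization R (contraction q'))"
            using a' 1 by (intro p.fraction_closed) auto
          ultimately have "s (contraction q') = fraction R (contraction q') a' g'"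
            using pr inv[OF pr(1)] localization_map_inj[OF pr(1)] by (simp add: s_def)
          with 1 show ?thesis by simp
        qed
        then show ?thesis using W(1-3) a'(1,2) by (intro exI[of _ W] exI[of _ a'] exI[of _ g']) simp
      qed
      have s: "s \<in> carrier (spec_sections R V)"
      proof (rule spec_sectionI)
        fix p assume p: "p \<in> V"
        then obtain q where q: "primeideal q S" "p = contraction q" using V' by blast
        then have qV: "q \<in> ?P V" using p by (simp add: preim_point_map)
        obtain W a g where W: "openin (zariski S) W" "q \<in> W" "W \<subseteq> ?P V" "a \<in> carrier R" "g \<in> carrier R"
          "\<forall>q' \<in> W. \<phi> g \<notin> q' \<and> t q' = fraction S q' (\<phi> a) (\<phi> g)
            \<and> s (contraction q') = fraction R (contraction q') a g"
          using local[OF qV] by (elim exE conjE) (rule that)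
        show "locally_fraction R V s p"
        proof (rule local_fractionI[of _ "contraction ` W" _ _ a g])
          show "openin (zariski R) (contraction ` W)" by (rule openin_image_contraction[OF W(1)])
          show "p \<in> contraction ` W" "contraction ` W \<subseteq> V"
            using W(2,3) q(2) by (auto simp: preim_point_map)
        qed (use W(4-6) in auto)
      qed (simp add: s_def)
      have "section_map V s = t"
      proof (rule extensionalityI[of _ "?P V"])
        show "section_map V s \<in> extensional (?P V)" "t \<in> extensional (?P V)"
          using section_map_closed[OF V s] t spec_section_ext by auto
        fix q assume q: "q \<in> ?P V"
        then have pr: "primeideal q S" "contraction q \<in> V" by (auto simp: preim_point_map)
        from local[OF q] obtain a g where "a \<in> carrier R" "g \<in> carrier R" "\<phi> g \<notin> q"
          "t q = fraction S q (\<phi> a) (\<phi> g)" "s (contraction q) = fraction R (contraction q) a g"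
          by (elim exE conjE) (drule (1) bspec, elim conjE, rule that)
        then show "section_map V s q = t q"
          using section_map_apply[OF V s pr] fraction_map[OF pr(1)] by simp
      qed
      then show "t \<in> section_map V ` carrier (sec (Spec R) V)" using s by auto
    qed (use section_map_closed[OF V] in auto)
  qed
qed

lemma image_point_map: "point_map ` topspace (zariski S) = {p. primeideal p R \<and> f \<notin> p}"
  using point_map_image[OF openin_topspace] contraction_image by (simp add: topspace_zariski)

end

section \<open>Schemes recognized from affine charts\<close>

text \<open>\<open>scheme\<close> wants chart rings whose elements have the type of the sections of
  the space. The ring is transported along e, and the resulting isomorphism is a localization with
  \<open>T\<close> consisting of one only, so \<open>open_immersion_Spec_map\<close> applies to
  it.\<close>

lemma exists_ring_copy:
  fixes R :: "'r ring" and e :: "'r \<Rightarrow> 'b"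
  assumes R: "cring R" and e: "inj e"
  obtains R' :: "'b ring" and f F where "cring R'" "open_immersion (Spec R') (Spec R) f F"
    "f ` topspace (zariski R') = topspace (zariski R)"
proof -
  interpret R: cring R by (rule R)
  define R' where "R' = image_ring e R"
  have iso: "e \<in> ring_iso R R'"
    unfolding R'_def by (intro inj_imp_image_ring_iso inj_on_subset[OF e]) simp
  have R': "cring R'"
    using R.ring_iso_imp_img_cring[OF iso]
    by (simp add: R'_def image_ring_def image_group_def monoid.defs)
  interpret R': cring R' by (rule R')
  have hom: "e \<in> ring_hom R R'" using iso by (simp add: ring_iso_def)
  interpret e: principal_localization R R' e "{\<one>\<^bsub>R\<^esub>}" "\<one>\<^bsub>R\<^esub>"
  proof unfold_locales
    show "e \<in> ring_hom R R'" by (rule hom)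
    show "inj_on e (carrier R)" using e inj_on_subset by blast
    show "e g \<in> Units R'" if "g \<in> {\<one>\<^bsub>R\<^esub>}" for g
      using that ring_hom_one[OF hom] by simp
    show "\<exists>g \<in> {\<one>\<^bsub>R\<^esub>}. \<exists>r \<in> carrier R. e g \<otimes>\<^bsub>R'\<^esub> s = e r" if "s \<in> carrier R'" for s
    proof -
      have "s \<in> e ` carrier R" using iso that by (auto simp: ring_iso_def bij_betw_def)
      then show ?thesis using that ring_hom_one[OF hom] by auto
    qed
  qed auto
  show thesis
  proof (rule that)
    show "cring R'" by (rule R')
    show "open_immersion (Spec R') (Spec R) e.point_map e.section_map"
      by (rule e.open_immersion_Spec_map)
    show "e.point_map ` topspace (zariski R') = topspace (zariski R)"
      unfolding e.image_point_map unfolding topspace_zariski using primeideal.one_notin[of _ R] by auto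
  qed
qed

text \<open>Charts may be open immersions from spectra of rings over another type, as long as that
  type injects into the type of sections. Stalks are local because the charts are isomorphisms on
  stalks, and precomposing a chart with the spectrum of a copied ring repairs the type.\<close>

lemma schemeI:
  fixes X :: "('a, 'b) ringed" and e :: "'r \<Rightarrow> 'b"
  assumes X: "ringed_space X" and e: "inj e"
    and affine: "\<And>x. x \<in> topspace (base X) \<Longrightarrow> \<exists>(R :: 'r ring) f F. cring R \<and>
      open_immersion (Spec R) X f F \<and> x \<in> f ` topspace (zariski R)"
  shows "scheme X"
proof -
  interpret ringed_space X by (rule X)
  show ?thesis
  proof unfold_locales
    fix x assume "x \<in> topspace (base X)"
    then obtain R :: "'r ring" and f F where R: "cring R" and f: "open_immersion (Spec R) X f F"
      and x: "x \<in> f ` topspace (zariski R)"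
      using affine by blast
    interpret f: open_immersion "Spec R" X f F by (rule f)
    obtain p where p: "p \<in> topspace (base (Spec R))" "x = f p" using x by auto
    then show "local_ring (stalk X x)"
      using f.local_ring_stalk_iff[OF p(1)] local_ring_stalk_Spec[OF R, of p]
      by (simp add: topspace_zariski)
    obtain R' :: "'b ring" and g G where R': "cring R'" and g: "open_immersion (Spec R') (Spec R) g G"
      and g_surj: "g ` topspace (zariski R') = topspace (zariski R)"
      using exists_ring_copy[OF R e] .
    interpret g: open_immersion "Spec R'" "Spec R" g G by (rule g)
    obtain h H where h: "mor_comp (Spec R') (Spec R) X (f, F) (g, G) = (h, H)" by fastforce
    have "open_immersion (Spec R') X h H" by (rule open_immersion_comp[OF g f h])
    then interpret h: open_immersion "Spec R'" X h H .
    have "h ` topspace (zariski R') = f ` g ` topspace (zariski R')"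
      using h by (auto simp: mor_comp_def compose_def image_iff)
    then have "x \<in> h ` topspace (zariski R')" using x by (simp add: g_surj)
    moreover have "openin (base X) (h ` topspace (zariski R'))"
      using h.open_image[of "topspace (zariski R')"] by simp
    moreover have "isomorphic (open_subspace X (h ` topspace (zariski R'))) (Spec R')"
      using open_immersion_isomorphic_image[OF h.open_immersion_axioms] by simp
    ultimately show "\<exists>U. openin (base X) U \<and> x \<in> U \<and>
        (\<exists>R :: 'b ring. cring R \<and> isomorphic (open_subspace X U) (Spec R))"
      using R' by blast
  qed
qed

section \<open>Gluing along a common open subspace\<close>

lemma (in ringed_space) locality_indexed:
  assumes "\<And>i. i \<in> C \<Longrightarrow> openin (base X) (U i)"
    and "s \<in> carrier (sec X (\<Union>i \<in> C. U i))" "t \<in> carrier (sec X (\<Union>i \<in> C. U i))"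
    and "\<And>i. i \<in> C \<Longrightarrow> res X (\<Union>i \<in> C. U i) (U i) s = res X (\<Union>i \<in> C. U i) (U i) t"
  shows "s = t"
  by (rule locality[of "U ` C"]) (use assms in auto)

text \<open>A cover of the glued space is used in each piece as an indexed family, in which distinct
  indices may give the same open set. Agreement on the intersection of an open set with itself
  forces their sections to be equal, so choosing an index for each set is harmless.\<close>

lemma (in ringed_space) gluing_indexed:
  assumes U: "\<And>i. i \<in> C \<Longrightarrow> openin (base X) (U i)"
    and \<sigma>: "\<And>i. i \<in> C \<Longrightarrow> \<sigma> i \<in> carrier (sec X (U i))"
    and agree: "\<And>i j. \<lbrakk>i \<in> C; j \<in> C\<rbrakk>
      \<Longrightarrow> res X (U i) (U i \<inter> U j) (\<sigma> i) = res X (U j) (U i \<inter> U j) (\<sigma> j)"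
  shows "\<exists>s \<in> carrier (sec X (\<Union>i \<in> C. U i)). \<forall>i \<in> C. res X (\<Union>i \<in> C. U i) (U i) s = \<sigma> i"
proof -
  define \<tau> where "\<tau> W = \<sigma> (SOME i. i \<in> C \<and> U i = W)" for W
  have \<tau>: "\<tau> (U i) = \<sigma> i" if i: "i \<in> C" for i
  proof -
    let ?j = "SOME j. j \<in> C \<and> U j = U i"
    have j: "?j \<in> C \<and> U ?j = U i" by (rule someI[of _ i]) (use i in simp)
    then have "res X (U i) (U i) (\<sigma> ?j) = res X (U i) (U i) (\<sigma> i)"
      using agree[of ?j i] i by simp
    moreover have "\<sigma> ?j \<in> carrier (sec X (U i))" using \<sigma>[of ?j] j by simp
    ultimately show ?thesis using res_id U \<sigma> i by (simp add: \<tau>_def)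
  qed
  have "\<exists>s \<in> carrier (sec X (\<Union>(U ` C))). \<forall>W \<in> U ` C. res X (\<Union>(U ` C)) W s = \<tau> W"
  proof (rule gluing)
    fix W W' assume "W \<in> U ` C" "W' \<in> U ` C"
    then show "res X W (W \<inter> W') (\<tau> W) = res X W' (W \<inter> W') (\<tau> W')"
      using agree by (auto simp: \<tau>)
  qed (use U \<sigma> in \<open>auto simp: \<tau>\<close>)
  then show ?thesis by (simp add: \<tau>)
qed

text \<open>Needed to attach D(N^gp) as a piece along itself, and to give a spectrum itself as a
  chart.\<close>

lemma open_immersion_mor_id:
  assumes "ringed_space X"
  shows "open_immersion X X (fst (mor_id X)) (snd (mor_id X))"
proof -
  interpret ringed_space X by fact
  let ?f = "\<lambda>x \<in> topspace (base X). x"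
    and ?F = "\<lambda>U \<in> {U. openin (base X) U}. \<lambda>t \<in> carrier (sec X U). t"
  have p: "preim X ?f U = U" if "openin (base X) U" for U
    using openin_subset[OF that] by (auto simp: preim_def)
  have im: "?f ` U = U" if "openin (base X) U" for U
    using openin_subset[OF that] by (auto simp: image_iff)
  show ?thesis
    unfolding mor_id_def fst_conv snd_conv
  proof unfold_locales
    show "continuous_map (base X) (base X) ?f"
      by (rule continuous_map_eq[OF continuous_map_id]) simp
    show "inj_on ?f (topspace (base X))" by (rule inj_onI) simp
    show "?F \<in> extensional {U. openin (base X) U}"
      by simp
    show "?f \<in> extensional (topspace (base X))" by simp
    show "openin (base X) (?f ` U)" if "openin (base X) U" for U
      using that im by simp
    fix U assume U: "openin (base X) U"
    show "?F U \<in> extensional (carrier (sec X U))"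
      using U by simp
    interpret cring "sec X U" by (rule sec_cring[OF U])
    show "?F U
        \<in> ring_hom (sec X U) (sec X (preim X ?f U))"
      using U by (intro ring_hom_memI) (simp_all add: p)
    show "bij_betw (?F U)
        (carrier (sec X U)) (carrier (sec X (preim X ?f U)))"
      using U by (auto simp: p bij_betw_def inj_on_def image_iff)
    fix W t assume W: "openin (base X) W" "W \<subseteq> U" "t \<in> carrier (sec X U)"
    then show "?F W (res X U W t)
        = res X (preim X ?f U) (preim X ?f W)
          (?F U t)"
      using U by (simp add: p res_closed)
  qed
qed

lemma mor_comp_mor_id:
  assumes "ringed_mor X Y f F"
  shows "mor_comp X X Y (f, F) (mor_id X) = (f, F)"
proof -
  interpret ringed_mor X Y f F by fact
  have 1: "compose (topspace (base X)) f (\<lambda>x \<in> topspace (base X). x) = f"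
    using f_ext by (intro extensionalityI[of _ "topspace (base X)"]) (auto simp: compose_def)
  have "(\<lambda>W \<in> {W. openin (base Y) W}. compose (carrier (sec Y W)) (snd (mor_id X) (preim X f W)) (F W)) = F"
  proof (rule extensionalityI[of _ "{W. openin (base Y) W}"])
    fix W assume "W \<in> {W. openin (base Y) W}"
    then have W: "openin (base Y) W" by simp
    have "compose (carrier (sec Y W)) (snd (mor_id X) (preim X f W)) (F W) = F W"
      using FV_ext[OF W] preim_open[OF W] F_closed[OF W]
      by (intro extensionalityI[of _ "carrier (sec Y W)"]) (auto simp: compose_def mor_id_def)
    then show "(\<lambda>W \<in> {W. openin (base Y) W}. compose (carrier (sec Y W))
        (snd (mor_id X) (preim X f W)) (F W)) W = F W" using W by simp
  qed (use F_ext in simp_all)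
  with 1 show ?thesis by (simp add: mor_comp_def mor_id_def)
qed

text \<open>Gluing of the spaces \<open>B v\<close> along their open subspaces \<open>D\<close>. A point of the image of \<open>D\<close> is
  represented in \<open>B v0\<close>, every other point in the unique \<open>B v\<close> containing it.\<close>

locale gluing_data =
  fixes D :: "('a, 'b) ringed" and V :: "'v set" and B :: "'v \<Rightarrow> ('a, 'b) ringed"
    and k :: "'v \<Rightarrow> 'a \<Rightarrow> 'a" and K :: "'v \<Rightarrow> 'a set \<Rightarrow> 'b \<Rightarrow> 'b" and v0 :: 'v
  assumes v0: "v0 \<in> V"
    and immersion: "v \<in> V \<Longrightarrow> open_immersion D (B v) (k v) (K v)"
begin

abbreviation pts :: "'v \<Rightarrow> 'a set" where
  "pts v \<equiv> topspace (base (B v))"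

abbreviation D_pts :: "'a set" where
  "D_pts \<equiv> topspace (base D)"

lemma D: "ringed_space D" and B: "v \<in> V \<Longrightarrow> ringed_space (B v)"
  using immersion[OF v0] immersion[of v]
  by (auto simp: open_immersion_def ringed_mor_def)

lemma mor_k: "v \<in> V \<Longrightarrow> ringed_mor D (B v) (k v) (K v)"
  using immersion by (simp add: open_immersion_def)

lemma k_closed: "\<lbrakk>v \<in> V; p \<in> D_pts\<rbrakk> \<Longrightarrow> k v p \<in> pts v"
  using ringed_mor.f_closed[OF mor_k] .

lemma k_inj: "\<lbrakk>v \<in> V; p \<in> D_pts; q \<in> D_pts; k v p = k v q\<rbrakk> \<Longrightarrow> p = q"
  using open_immersion.inj[OF immersion] by (auto dest: inj_onD)

section \<open>Points and topology of the glued space\<close>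

definition points :: "('v \<times> 'a) set" where
  "points = {(v, x). v \<in> V \<and> x \<in> pts v \<and> (v \<noteq> v0 \<longrightarrow> x \<notin> k v ` D_pts)}"

definition inc :: "'v \<Rightarrow> 'a \<Rightarrow> 'v \<times> 'a" where
  "inc v = (\<lambda>x \<in> pts v. if x \<in> k v ` D_pts then (v0, k v0 (inv_into D_pts (k v) x)) else (v, x))"

lemma inc_k:
  assumes "v \<in> V" "p \<in> D_pts"
  shows "inc v (k v p) = (v0, k v0 p)"
proof -
  have "inv_into D_pts (k v) (k v p) = p"
    using assms open_immersion.inj[OF immersion] by (intro inv_into_f_f) auto
  then show ?thesis using assms by (simp add: inc_def k_closed)
qed

lemma inc_outside: "\<lbrakk>x \<in> pts v; x \<notin> k v ` D_pts\<rbrakk> \<Longrightarrow> inc v x = (v, x)"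
  by (simp add: inc_def)

lemma inc_v0: "x \<in> pts v0 \<Longrightarrow> inc v0 x = (v0, x)"
  using inc_k[OF v0] inc_outside[of x v0] by (cases "x \<in> k v0 ` D_pts") auto

lemma inc_points: "(v, x) \<in> points \<Longrightarrow> inc v x = (v, x)"
  using inc_outside inc_v0 by (cases "v = v0") (auto simp: points_def)

lemma inc_closed:
  assumes "v \<in> V" "x \<in> pts v" shows "inc v x \<in> points"
proof (cases "x \<in> k v ` D_pts")
  case True
  then obtain p where "p \<in> D_pts" "x = k v p" by blast
  then show ?thesis using assms v0 by (simp add: inc_k points_def k_closed)
qed (use assms in \<open>simp add: inc_outside points_def\<close>)

text \<open>Injectivity of \<open>k v0\<close> recovers the point of \<open>D\<close> from the
  chosen representative. Hence points of two pieces are identified only when both come from one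
  point of \<open>D\<close>, and nothing is identified inside one piece.\<close>

lemma inc_eq_cases:
  assumes "v \<in> V" "w \<in> V" "x \<in> pts v" "y \<in> pts w" and eq: "inc v x = inc w y"
  obtains "v = w" "x = y" | p where "p \<in> D_pts" "x = k v p" "y = k w p"
proof (cases "x \<in> k v ` D_pts"; cases "y \<in> k w ` D_pts")
  assume "x \<in> k v ` D_pts" "y \<in> k w ` D_pts"
  then obtain p q where p: "p \<in> D_pts" "x = k v p" and q: "q \<in> D_pts" "y = k w q" by blast
  then have "p = q" using eq assms k_inj[OF v0] by (simp add: inc_k)
  then show thesis using that p q by blast
next
  assume "x \<in> k v ` D_pts" and y: "y \<notin> k w ` D_pts"
  then obtain p where p: "p \<in> D_pts" "x = k v p" by blast
  then have "w = v0" "y = k v0 p" using eq assms y by (auto simp: inc_k inc_outside)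
  with y p show thesis by auto
next
  assume x: "x \<notin> k v ` D_pts" and "y \<in> k w ` D_pts"
  then obtain q where q: "q \<in> D_pts" "y = k w q" by blast
  then have "v = v0" "x = k v0 q" using eq assms x by (auto simp: inc_k inc_outside)
  with x q show thesis by auto
next
  assume "x \<notin> k v ` D_pts" "y \<notin> k w ` D_pts"
  then show thesis using that eq assms by (simp add: inc_outside)
qed

lemma inc_inj: "v \<in> V \<Longrightarrow> inj_on (inc v) (pts v)"
  by (rule inj_onI) (erule inc_eq_cases[rotated 4]; simp)

abbreviation piece :: "'v \<Rightarrow> ('v \<times> 'a) set \<Rightarrow> 'a set" where
  "piece v U \<equiv> preim (B v) (inc v) U"

text \<open>The trace of U on \<open>D\<close>, read off in \<open>v0\<close> where points of
  \<open>D\<close> are represented; by \<open>preim_k_piece\<close> every v gives the same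
  set.\<close>

definition D_piece :: "('v \<times> 'a) set \<Rightarrow> 'a set" where
  "D_piece U = {p \<in> D_pts. (v0, k v0 p) \<in> U}"

lemma preim_k_piece: "v \<in> V \<Longrightarrow> preim D (k v) (piece v U) = D_piece U"
  by (auto simp: preim_def D_piece_def inc_k k_closed)

lemma piece_Un: "piece v (\<Union>C) = (\<Union>U \<in> C. piece v U)"
  by (auto simp: preim_def)

lemma piece_Int: "piece v (U \<inter> W) = piece v U \<inter> piece v W"
  by (auto simp: preim_def)

lemma piece_mono: "U \<subseteq> W \<Longrightarrow> piece v U \<subseteq> piece v W"
  by (auto simp: preim_def)

lemma D_piece_Un: "D_piece (\<Union>C) = (\<Union>U \<in> C. D_piece U)"
  by (auto simp: D_piece_def)

text \<open>The final topology for the maps \<open>inc v\<close>.\<close>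

definition space :: "('v \<times> 'a) topology" where
  "space = topology (\<lambda>U. U \<subseteq> points \<and> (\<forall>v \<in> V. openin (base (B v)) (piece v U)))"

lemma openin_space:
  "openin space U \<longleftrightarrow> U \<subseteq> points \<and> (\<forall>v \<in> V. openin (base (B v)) (piece v U))"
proof -
  have "istopology (\<lambda>U. U \<subseteq> points \<and> (\<forall>v \<in> V. openin (base (B v)) (piece v U)))"
    unfolding istopology_def
  proof (intro conjI allI impI)
    fix K assume "\<forall>U \<in> K. U \<subseteq> points \<and> (\<forall>v \<in> V. openin (base (B v)) (piece v U))"
    then show "\<Union>K \<subseteq> points" "\<forall>v \<in> V. openin (base (B v)) (piece v (\<Union>K))"
      by (auto simp: piece_Un)
  qed (auto simp: piece_Int)
  then show ?thesis by (simp add: space_def)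
qed

lemma piece_points: "v \<in> V \<Longrightarrow> piece v points = pts v"
  using inc_closed by (auto simp: preim_def)

lemma topspace_space: "topspace space = points"
proof (rule equalityI)
  have "openin space points" by (simp add: openin_space piece_points)
  then show "points \<subseteq> topspace space" by (rule openin_subset)
  have "openin space (topspace space)" by simp
  then show "topspace space \<subseteq> points" unfolding openin_space by blast
qed

lemma piece_open: "\<lbrakk>openin space U; v \<in> V\<rbrakk> \<Longrightarrow> openin (base (B v)) (piece v U)"
  by (simp add: openin_space)

lemma D_piece_open: "openin space U \<Longrightarrow> openin (base D) (D_piece U)"
  using ringed_mor.preim_open[OF mor_k[OF v0]] piece_open[OF _ v0] preim_k_piece[OF v0] by metis

text \<open>Another piece sees an open set of \<open>B v\<close> only through \<open>D\<close>. As
  the maps \<open>k w\<close> are open, this makes \<open>inc v\<close> open.\<close>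

lemma piece_image:
  assumes "v \<in> V" "w \<in> V" "U \<subseteq> pts v"
  shows "piece w (inc v ` U) = (if w = v then U else k w ` preim D (k v) U)"
proof (cases "w = v")
  case True
  then show ?thesis using assms inc_inj[OF assms(1)] by (auto simp: preim_def inj_on_def)
next
  case False
  have "y \<in> k w ` preim D (k v) U" if y: "y \<in> piece w (inc v ` U)" for y
  proof -
    from y obtain x where x: "x \<in> U" "inc v x = inc w y" "y \<in> pts w" by (auto simp: preim_def)
    then have "x \<in> pts v" using assms by blast
    from inc_eq_cases[OF assms(1,2) this x(3,2)] show ?thesis
    proof cases
      case (2 p)
      then show ?thesis using x by (auto simp: preim_def)
    qed (use False in simp)
  qed
  moreover have "y \<in> piece w (inc v ` U)" if "y \<in> k w ` preim D (k v) U" for y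
  proof -
    from that obtain p where p: "p \<in> D_pts" "k v p \<in> U" "y = k w p" by (auto simp: preim_def)
    then have "inc w y = inc v (k v p)" using assms by (simp add: inc_k)
    then show ?thesis using p assms by (auto simp: preim_def k_closed)
  qed
  ultimately show ?thesis using False by auto
qed

lemma inc_open:
  assumes v: "v \<in> V" and U: "openin (base (B v)) U"
  shows "openin space (inc v ` U)"
  unfolding openin_space
proof (intro conjI ballI)
  have sub: "U \<subseteq> pts v" by (rule openin_subset[OF U])
  then show "inc v ` U \<subseteq> points" using inc_closed[OF v] by blast
  fix w assume w: "w \<in> V"
  have "openin (base (B w)) (k w ` preim D (k v) U)"
    by (intro open_immersion.open_image[OF immersion[OF w]] ringed_mor.preim_open[OF mor_k[OF v]] U)
  then show "openin (base (B w)) (piece w (inc v ` U))"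
    using U by (simp add: piece_image[OF v w sub])
qed

text \<open>For U inside the image of one piece, the traces on all other pieces lie in the image of
  \<open>D\<close>, where the maps \<open>K w\<close> are bijective on sections.\<close>

lemma piece_subset_D:
  assumes "v \<in> V" "w \<in> V" "w \<noteq> v" "U \<subseteq> inc v ` pts v"
  shows "piece w U \<subseteq> k w ` D_pts"
proof -
  have "piece w U \<subseteq> piece w (inc v ` pts v)" using assms(4) by (rule piece_mono)
  also have "\<dots> = k w ` preim D (k v) (pts v)" using assms(1-3) by (simp add: piece_image)
  also have "\<dots> \<subseteq> k w ` D_pts" by (auto simp: preim_def)
  finally show ?thesis .
qed

section \<open>Sections of the glued space\<close>

lemma K_hom:
  "\<lbrakk>v \<in> V; openin space U\<rbrakk>
    \<Longrightarrow> K v (piece v U) \<in> ring_hom (sec (B v) (piece v U)) (sec D (D_piece U))"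
  using ringed_mor.F_hom[OF mor_k piece_open] preim_k_piece by simp

lemma K_closed:
  "\<lbrakk>v \<in> V; openin space U; s \<in> carrier (sec (B v) (piece v U))\<rbrakk>
    \<Longrightarrow> K v (piece v U) s \<in> carrier (sec D (D_piece U))"
  by (rule ring_hom_closed[OF K_hom])

lemma K_res:
  "\<lbrakk>v \<in> V; openin space U; openin space W; W \<subseteq> U; s \<in> carrier (sec (B v) (piece v U))\<rbrakk>
    \<Longrightarrow> K v (piece v W) (res (B v) (piece v U) (piece v W) s)
      = res D (D_piece U) (D_piece W) (K v (piece v U) s)"
  using ringed_mor.F_res[OF mor_k, of v "piece v U" "piece v W" s] piece_open piece_mono
  by (simp add: preim_k_piece)

text \<open>The fibre product of the rings of sections on the pieces over the ring of sections on
  the trace in \<open>D\<close>.\<close>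

definition sections :: "('v \<times> 'a) set \<Rightarrow> ('v \<Rightarrow> 'b) ring" where
  "sections U =
    \<lparr>carrier = {s \<in> (\<Pi>\<^sub>E v \<in> V. carrier (sec (B v) (piece v U))).
       \<forall>v \<in> V. \<forall>w \<in> V. K v (piece v U) (s v) = K w (piece w U) (s w)},
     mult = (\<lambda>s t. \<lambda>v \<in> V. s v \<otimes>\<^bsub>sec (B v) (piece v U)\<^esub> t v),
     one = (\<lambda>v \<in> V. \<one>\<^bsub>sec (B v) (piece v U)\<^esub>),
     zero = (\<lambda>v \<in> V. \<zero>\<^bsub>sec (B v) (piece v U)\<^esub>),
     add = (\<lambda>s t. \<lambda>v \<in> V. s v \<oplus>\<^bsub>sec (B v) (piece v U)\<^esub> t v)\<rparr>"

definition glued :: "('v \<times> 'a, 'v \<Rightarrow> 'b) ringed" where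
  "glued = \<lparr>base = space, sec = sections,
     res = (\<lambda>U W s. \<lambda>v \<in> V. res (B v) (piece v U) (piece v W) (s v))\<rparr>"

lemma glued_simps [simp]:
  "base glued = space" "sec glued = sections"
  "res glued = (\<lambda>U W s. \<lambda>v \<in> V. res (B v) (piece v U) (piece v W) (s v))"
  by (simp_all add: glued_def)

lemma sections_simps [simp]:
  "\<one>\<^bsub>sections U\<^esub> = (\<lambda>v \<in> V. \<one>\<^bsub>sec (B v) (piece v U)\<^esub>)"
  "\<zero>\<^bsub>sections U\<^esub> = (\<lambda>v \<in> V. \<zero>\<^bsub>sec (B v) (piece v U)\<^esub>)"
  "s \<otimes>\<^bsub>sections U\<^esub> t = (\<lambda>v \<in> V. s v \<otimes>\<^bsub>sec (B v) (piece v U)\<^esub> t v)"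
  "s \<oplus>\<^bsub>sections U\<^esub> t = (\<lambda>v \<in> V. s v \<oplus>\<^bsub>sec (B v) (piece v U)\<^esub> t v)"
  by (simp_all add: sections_def)

lemma sectionsI:
  assumes "s \<in> extensional V" "\<And>v. v \<in> V \<Longrightarrow> s v \<in> carrier (sec (B v) (piece v U))"
    and "\<And>v w. \<lbrakk>v \<in> V; w \<in> V\<rbrakk> \<Longrightarrow> K v (piece v U) (s v) = K w (piece w U) (s w)"
  shows "s \<in> carrier (sections U)"
  unfolding sections_def partial_object.select_convs mem_Collect_eq PiE_iff
  by (intro conjI ballI assms)

lemma sectionsD:
  assumes "s \<in> carrier (sections U)"
  shows "s \<in> extensional V"
    and "v \<in> V \<Longrightarrow> s v \<in> carrier (sec (B v) (piece v U))"
    and "\<lbrakk>v \<in> V; w \<in> V\<rbrakk> \<Longrightarrow> K v (piece v U) (s v) = K w (piece w U) (s w)"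
proof -
  have "s \<in> (\<Pi>\<^sub>E v \<in> V. carrier (sec (B v) (piece v U))) \<and>
    (\<forall>v \<in> V. \<forall>w \<in> V. K v (piece v U) (s v) = K w (piece w U) (s w))"
    using assms unfolding sections_def partial_object.select_convs mem_Collect_eq .
  note * = conjunct1[OF this] conjunct2[OF this]
  from *(1) show "s \<in> extensional V" "v \<in> V \<Longrightarrow> s v \<in> carrier (sec (B v) (piece v U))"
    by (simp_all only: PiE_iff)
  show "K v (piece v U) (s v) = K w (piece w U) (s w)" if "v \<in> V" "w \<in> V"
    by (rule bspec[OF bspec[OF *(2) that(1)] that(2)])
qed

lemma sections_eqI:
  "\<lbrakk>s \<in> carrier (sections U); t \<in> carrier (sections U); \<And>v. v \<in> V \<Longrightarrow> s v = t v\<rbrakk> \<Longrightarrow> s = t"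
  using sectionsD(1) extensionalityI by metis

lemma cring_sections:
  assumes U: "openin space U"
  shows "cring (sections U)"
proof (rule cring_pointwise[of V "\<lambda>v. sec (B v) (piece v U)"])
  let ?S = "sections U"
  have L: "cring (sec (B v) (piece v U))" if "v \<in> V" for v
    using ringed_space.sec_cring[OF B[OF that] piece_open[OF U that]] .
  then show "cring (sec (B v) (piece v U))" if "v \<in> V" for v using that .
  show "carrier ?S \<subseteq> (\<Pi>\<^sub>E v \<in> V. carrier (sec (B v) (piece v U)))"
    using sectionsD(1,2) by (intro subsetI) (simp add: PiE_iff)
  have K: "ring_hom_cring (sec (B v) (piece v U)) (sec D (D_piece U)) (K v (piece v U))"
    if "v \<in> V" for v
    using L[OF that] ringed_space.sec_cring[OF D D_piece_open[OF U]] K_hom[OF that U]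
    by (simp add: ring_hom_cring_def ring_hom_cring_axioms_def)
  note simps = ring_hom_mult[OF K_hom[OF _ U]] ring_hom_add[OF K_hom[OF _ U]]
    ring_hom_one[OF K_hom[OF _ U]] ring_hom_cring.hom_zero[OF K] ring_hom_cring.hom_a_inv[OF K]
    cring.cring_simprules[OF L] sectionsD(2)
  show "\<one>\<^bsub>?S\<^esub> \<in> carrier ?S" "\<zero>\<^bsub>?S\<^esub> \<in> carrier ?S"
    by (rule sectionsI; simp add: simps)+
  fix s assume s: "s \<in> carrier ?S"
  \<comment> \<open>All components have the same trace d on \<open>D\<close>. The trace of a
    combination of families is then the same combination of such values, independently of v.\<close>
  obtain d where d: "\<And>v. v \<in> V \<Longrightarrow> K v (piece v U) (s v) = d"
    by (rule that[OF sectionsD(3)[OF s _ v0]])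
  show "(\<lambda>v \<in> V. \<ominus>\<^bsub>sec (B v) (piece v U)\<^esub> s v) \<in> carrier ?S"
    by (rule sectionsI) (use d s in \<open>simp_all add: simps\<close>)
  fix t assume t: "t \<in> carrier ?S"
  obtain e where e: "\<And>v. v \<in> V \<Longrightarrow> K v (piece v U) (t v) = e"
    by (rule that[OF sectionsD(3)[OF t _ v0]])
  show "s \<otimes>\<^bsub>?S\<^esub> t \<in> carrier ?S" "s \<oplus>\<^bsub>?S\<^esub> t \<in> carrier ?S"
    by (rule sectionsI; use d e s t in \<open>simp add: simps\<close>)+
qed simp_all

lemma res_sections:
  assumes "openin space U" "openin space W" "W \<subseteq> U" "s \<in> carrier (sections U)"
  shows "(\<lambda>v \<in> V. res (B v) (piece v U) (piece v W) (s v)) \<in> carrier (sections W)"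
proof (rule sectionsI)
  fix v assume v: "v \<in> V"
  show "(\<lambda>v \<in> V. res (B v) (piece v U) (piece v W) (s v)) v \<in> carrier (sec (B v) (piece v W))"
    using ringed_space.res_closed[OF B[OF v] piece_open piece_open piece_mono] assms v sectionsD(2)
    by simp
  fix w assume w: "w \<in> V"
  show "K v (piece v W) ((\<lambda>v \<in> V. res (B v) (piece v U) (piece v W) (s v)) v)
      = K w (piece w W) ((\<lambda>v \<in> V. res (B v) (piece v U) (piece v W) (s v)) w)"
    using v w K_res[OF v assms(1-3) sectionsD(2)[OF assms(4) v]]
      K_res[OF w assms(1-3) sectionsD(2)[OF assms(4) w]] sectionsD(3)[OF assms(4) v w] by simp
qed simp

text \<open>Every axiom is checked component by component. The one point involving several pieces is
  that sections glued separately on the pieces are compatible again, which follows from locality on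
  \<open>D\<close>.\<close>

lemma ringed_space_glued: "ringed_space glued"
proof (rule ringed_space.intro; (unfold glued_simps)?)
  let ?r = "\<lambda>U W s. \<lambda>v \<in> V. res (B v) (piece v U) (piece v W) (s v)"
  show "cring (sections U)" if "openin space U" for U
    using that by (rule cring_sections)
  show "?r U W \<in> ring_hom (sections U) (sections W)"
    if U: "openin space U" and W: "openin space W" "W \<subseteq> U" for U W
  proof (rule ring_hom_memI)
    have h: "res (B v) (piece v U) (piece v W)
        \<in> ring_hom (sec (B v) (piece v U)) (sec (B v) (piece v W))" if "v \<in> V" for v
      using ringed_space.res_hom[OF B[OF that] piece_open piece_open piece_mono] U W that by simp
    show "?r U W s \<in> carrier (sections W)" if "s \<in> carrier (sections U)" for s
      using res_sections[OF U W that] .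
    fix s t assume s: "s \<in> carrier (sections U)" and t: "t \<in> carrier (sections U)"
    show "?r U W (s \<otimes>\<^bsub>sections U\<^esub> t) = ?r U W s \<otimes>\<^bsub>sections W\<^esub> ?r U W t"
      "?r U W (s \<oplus>\<^bsub>sections U\<^esub> t) = ?r U W s \<oplus>\<^bsub>sections W\<^esub> ?r U W t"
      using sectionsD(2)[OF s] sectionsD(2)[OF t] ring_hom_mult[OF h] ring_hom_add[OF h]
      by (auto intro!: restrict_ext)
  next
    have "res (B v) (piece v U) (piece v W) \<one>\<^bsub>sec (B v) (piece v U)\<^esub> = \<one>\<^bsub>sec (B v) (piece v W)\<^esub>"
      if "v \<in> V" for v
      using ringed_space.res_one[OF B[OF that] piece_open piece_open piece_mono] U W that by simp
    then show "?r U W \<one>\<^bsub>sections U\<^esub> = \<one>\<^bsub>sections W\<^esub>"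
      by (auto intro!: restrict_ext)
  qed
  show "?r U U s = s" if "openin space U" "s \<in> carrier (sections U)" for U s
    using that sectionsD[OF that(2)] ringed_space.res_id[OF B piece_open]
    by (intro extensionalityI[of _ V]) auto
  show "?r W Z (?r U W s) = ?r U Z s"
    if "openin space U" "openin space W" "openin space Z" "Z \<subseteq> W" "W \<subseteq> U"
      "s \<in> carrier (sections U)" for U W Z s
    using that sectionsD[OF that(6)]
      ringed_space.res_res[OF B piece_open piece_open piece_open piece_mono piece_mono]
    by (auto intro!: restrict_ext)
  show "s = t"
    if C: "\<And>W. W \<in> C \<Longrightarrow> openin space W" and s: "s \<in> carrier (sections (\<Union>C))"
      and t: "t \<in> carrier (sections (\<Union>C))"
      and eq: "\<And>W. W \<in> C \<Longrightarrow> ?r (\<Union>C) W s = ?r (\<Union>C) W t" for C s t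
  proof (rule sections_eqI[OF s t])
    fix v assume v: "v \<in> V"
    interpret Bv: ringed_space "B v" by (rule B[OF v])
    show "s v = t v"
    proof (rule Bv.locality_indexed[of C "piece v"])
      show "openin (base (B v)) (piece v W)" if "W \<in> C" for W using piece_open[OF C[OF that] v] .
      show "s v \<in> carrier (sec (B v) (\<Union>W \<in> C. piece v W))"
        "t v \<in> carrier (sec (B v) (\<Union>W \<in> C. piece v W))"
        using sectionsD(2)[OF s v] sectionsD(2)[OF t v] by (simp_all add: piece_Un)
      fix W assume "W \<in> C"
      from fun_cong[OF eq[OF this], of v]
      show "res (B v) (\<Union>W \<in> C. piece v W) (piece v W) (s v)
          = res (B v) (\<Union>W \<in> C. piece v W) (piece v W) (t v)"
        using v by (simp add: piece_Un)
    qed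
  qed
  show "\<exists>s \<in> carrier (sections (\<Union>C)). \<forall>W \<in> C. ?r (\<Union>C) W s = \<sigma> W"
    if C: "\<And>W. W \<in> C \<Longrightarrow> openin space W"
      and \<sigma>: "\<And>W. W \<in> C \<Longrightarrow> \<sigma> W \<in> carrier (sections W)"
      and agree: "\<And>W Z. \<lbrakk>W \<in> C; Z \<in> C\<rbrakk> \<Longrightarrow> ?r W (W \<inter> Z) (\<sigma> W) = ?r Z (W \<inter> Z) (\<sigma> Z)" for C \<sigma>
  proof -
    have CU: "openin space (\<Union>C)" using C by blast
    have "\<forall>v \<in> V. \<exists>t. t \<in> carrier (sec (B v) (piece v (\<Union>C))) \<and>
        (\<forall>W \<in> C. res (B v) (piece v (\<Union>C)) (piece v W) t = \<sigma> W v)"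
    proof
      fix v assume v: "v \<in> V"
      interpret Bv: ringed_space "B v" by (rule B[OF v])
      have "\<exists>t \<in> carrier (sec (B v) (\<Union>W \<in> C. piece v W)).
          \<forall>W \<in> C. res (B v) (\<Union>W \<in> C. piece v W) (piece v W) t = \<sigma> W v"
      proof (rule Bv.gluing_indexed)
        show "openin (base (B v)) (piece v W)" "\<sigma> W v \<in> carrier (sec (B v) (piece v W))"
          if "W \<in> C" for W
          using piece_open[OF C[OF that] v] sectionsD(2)[OF \<sigma>[OF that] v] by auto
        fix W Z assume "W \<in> C" "Z \<in> C"
        from fun_cong[OF agree[OF this], of v]
        show "res (B v) (piece v W) (piece v W \<inter> piece v Z) (\<sigma> W v)
            = res (B v) (piece v Z) (piece v W \<inter> piece v Z) (\<sigma> Z v)"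
          using v by (simp add: piece_Int)
      qed
      then show "\<exists>t. t \<in> carrier (sec (B v) (piece v (\<Union>C))) \<and>
          (\<forall>W \<in> C. res (B v) (piece v (\<Union>C)) (piece v W) t = \<sigma> W v)"
        unfolding piece_Un Bex_def .
    qed
    then obtain s where s: "\<And>v. v \<in> V \<Longrightarrow> s v \<in> carrier (sec (B v) (piece v (\<Union>C)))"
      "\<And>v W. \<lbrakk>v \<in> V; W \<in> C\<rbrakk> \<Longrightarrow> res (B v) (piece v (\<Union>C)) (piece v W) (s v) = \<sigma> W v"
      using bchoice by metis
    interpret D: ringed_space D by (rule D)
    have "restrict s V \<in> carrier (sections (\<Union>C))"
    proof (rule sectionsI)
      fix v w assume v: "v \<in> V" and w: "w \<in> V"
      have "K v (piece v (\<Union>C)) (s v) = K w (piece w (\<Union>C)) (s w)"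
      \<comment> \<open>On each member W of the cover both traces restrict to the trace of
        \<open>\<sigma> W\<close>, which is compatible by assumption.\<close>
      proof (rule D.locality_indexed[of C D_piece])
        show "openin (base D) (D_piece W)" if "W \<in> C" for W using D_piece_open[OF C[OF that]] .
        show "K v (piece v (\<Union>C)) (s v) \<in> carrier (sec D (\<Union>W \<in> C. D_piece W))"
          "K w (piece w (\<Union>C)) (s w) \<in> carrier (sec D (\<Union>W \<in> C. D_piece W))"
          using K_closed[OF v CU s(1)[OF v]] K_closed[OF w CU s(1)[OF w]]
          by (simp_all add: D_piece_Un)
        fix W assume W: "W \<in> C"
        have WC: "W \<subseteq> \<Union>C" using W by blast
        have "K v (piece v W) (\<sigma> W v) = K w (piece w W) (\<sigma> W w)"
          using sectionsD(3)[OF \<sigma>[OF W] v w] .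
        then show "res D (\<Union>W \<in> C. D_piece W) (D_piece W) (K v (piece v (\<Union>C)) (s v))
            = res D (\<Union>W \<in> C. D_piece W) (D_piece W) (K w (piece w (\<Union>C)) (s w))"
          unfolding D_piece_Un[symmetric] K_res[OF v CU C[OF W] WC s(1)[OF v], symmetric]
            K_res[OF w CU C[OF W] WC s(1)[OF w], symmetric] s(2)[OF v W] s(2)[OF w W] .
      qed
      then show "K v (piece v (\<Union>C)) (restrict s V v) = K w (piece w (\<Union>C)) (restrict s V w)"
        using v w by simp
    qed (use s in auto)
    moreover have "?r (\<Union>C) W (restrict s V) = \<sigma> W" if "W \<in> C" for W
      using s(2)[OF _ that] sectionsD(1)[OF \<sigma>[OF that]] by (intro extensionalityI[of _ V]) auto
    ultimately show ?thesis by blast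
  qed
qed

section \<open>Insertions of the pieces\<close>

definition inc_sec :: "'v \<Rightarrow> ('v \<times> 'a) set \<Rightarrow> ('v \<Rightarrow> 'b) \<Rightarrow> 'b" where
  "inc_sec v = (\<lambda>U \<in> {U. openin space U}. \<lambda>s \<in> carrier (sections U). s v)"

lemma inc_sec_apply:
  "\<lbrakk>openin space U; s \<in> carrier (sections U)\<rbrakk> \<Longrightarrow> inc_sec v U s = s v"
  by (simp add: inc_sec_def)

text \<open>Over U inside the image of \<open>B v\<close> the maps \<open>K w\<close> with w
  different from v are bijective. The component at v thus determines, through its trace on
  \<open>D\<close>, every other component, and the projection to it is bijective.\<close>

lemma open_immersion_inc:
  assumes v: "v \<in> V"
  shows "open_immersion (B v) glued (inc v) (inc_sec v)"
proof -
  interpret Bv: ringed_space "B v" by (rule B[OF v])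
  interpret G: ringed_space glued by (rule ringed_space_glued)
  show ?thesis
  proof unfold_locales
    show "continuous_map (base (B v)) (base glued) (inc v)"
      using inc_closed[OF v] piece_open[OF _ v]
      by (auto simp: continuous_map_def topspace_space preim_def)
    show "inc v \<in> extensional (pts v)" by (simp add: inc_def)
    show "inc_sec v \<in> extensional {U. openin (base glued) U}" by (simp add: inc_sec_def)
    show "inj_on (inc v) (pts v)" by (rule inc_inj[OF v])
    show "openin (base glued) (inc v ` U)" if "openin (base (B v)) U" for U
      using inc_open[OF v that] by simp
    fix U assume "openin (base glued) U"
    then have U: "openin space U" by simp
    interpret S: cring "sections U" by (rule cring_sections[OF U])
    show "inc_sec v U \<in> extensional (carrier (sec glued U))" using U by (simp add: inc_sec_def)
    show "inc_sec v U \<in> ring_hom (sec glued U) (sec (B v) (piece v U))"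
    proof (rule ring_hom_memI)
      show "inc_sec v U \<one>\<^bsub>sec glued U\<^esub> = \<one>\<^bsub>sec (B v) (piece v U)\<^esub>"
        using inc_sec_apply[OF U S.one_closed] v by simp
      fix s assume "s \<in> carrier (sec glued U)"
      then have s: "s \<in> carrier (sections U)" by simp
      show "inc_sec v U s \<in> carrier (sec (B v) (piece v U))"
        using inc_sec_apply[OF U s] sectionsD(2)[OF s v] by simp
      fix t assume "t \<in> carrier (sec glued U)"
      then have t: "t \<in> carrier (sections U)" by simp
      show "inc_sec v U (s \<otimes>\<^bsub>sec glued U\<^esub> t)
          = inc_sec v U s \<otimes>\<^bsub>sec (B v) (piece v U)\<^esub> inc_sec v U t"
        using inc_sec_apply[OF U S.m_closed[OF s t]] inc_sec_apply[OF U] s t v by simp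
      show "inc_sec v U (s \<oplus>\<^bsub>sec glued U\<^esub> t)
          = inc_sec v U s \<oplus>\<^bsub>sec (B v) (piece v U)\<^esub> inc_sec v U t"
        using inc_sec_apply[OF U S.a_closed[OF s t]] inc_sec_apply[OF U] s t v by simp
    qed
    show "inc_sec v W (res glued U W t) = res (B v) (piece v U) (piece v W) (inc_sec v U t)"
      if "openin (base glued) W" "W \<subseteq> U" "t \<in> carrier (sec glued U)" for W t
    proof -
      have W: "openin space W" and t: "t \<in> carrier (sections U)" using that by auto
      show ?thesis
        using v inc_sec_apply[OF U t] inc_sec_apply[OF W res_sections[OF U W that(2) t]] by simp
    qed
    assume "U \<subseteq> inc v ` pts v"
    then have sub: "piece w U \<subseteq> k w ` D_pts" if "w \<in> V" "w \<noteq> v" for w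
      using piece_subset_D[OF v that] by simp
    have bij: "bij_betw (K w (piece w U)) (carrier (sec (B w) (piece w U))) (carrier (sec D (D_piece U)))"
      if "w \<in> V" "w \<noteq> v" for w
      using open_immersion.F_bij[OF immersion[OF that(1)] piece_open[OF U that(1)] sub[OF that]]
      by (simp add: preim_k_piece that)
    show "bij_betw (inc_sec v U) (carrier (sec glued U)) (carrier (sec (B v) (piece v U)))"
      unfolding bij_betw_def glued_simps
    proof (intro conjI inj_onI equalityI subsetI)
      fix s t assume s: "s \<in> carrier (sections U)" and t: "t \<in> carrier (sections U)"
        and "inc_sec v U s = inc_sec v U t"
      then have eq: "s v = t v" using inc_sec_apply[OF U] by simp
      show "s = t"
      proof (rule sections_eqI[OF s t])
        fix w assume w: "w \<in> V"
        show "s w = t w"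
        proof (cases "w = v")
          case False
          have "K w (piece w U) (s w) = K w (piece w U) (t w)"
            using sectionsD(3)[OF s w v] sectionsD(3)[OF t w v] eq by simp
          then show ?thesis
            using bij[OF w False] sectionsD(2)[OF s w] sectionsD(2)[OF t w]
            by (auto simp: bij_betw_def dest: inj_onD)
        qed (use eq in simp)
      qed
    next
      fix a assume "a \<in> inc_sec v U ` carrier (sections U)"
      then show "a \<in> carrier (sec (B v) (piece v U))"
        using inc_sec_apply[OF U] sectionsD(2)[OF _ v] by auto
    next
      fix a assume a: "a \<in> carrier (sec (B v) (piece v U))"
      let ?d = "K v (piece v U) a"
      have d: "?d \<in> carrier (sec D (D_piece U))" by (rule K_closed[OF v U a])
      \<comment> \<open>The unique family extending a: elsewhere, the section with the same trace on
        \<open>D\<close> as a. At v itself \<open>K v\<close> need not be invertible, hence the case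
        distinction.\<close>
      define s where "s = (\<lambda>w \<in> V. if w = v then a
        else inv_into (carrier (sec (B w) (piece w U))) (K w (piece w U)) ?d)"
      have s_mem: "s w \<in> carrier (sec (B w) (piece w U))" and Ks: "K w (piece w U) (s w) = ?d"
        if w: "w \<in> V" for w
        using a d w bij[OF w]
        by (cases "w = v"; auto simp: s_def bij_betw_def inv_into_into f_inv_into_f)+
      have "s \<in> carrier (sections U)"
        by (rule sectionsI) (use s_mem Ks in \<open>auto simp: s_def\<close>)
      moreover from this have "inc_sec v U s = a" using inc_sec_apply[OF U] v by (simp add: s_def)
      ultimately show "a \<in> inc_sec v U ` carrier (sections U)" by blast
    qed
  qed
qed

definition insertion :: "'v \<Rightarrow> ('a, 'b, 'v \<times> 'a, 'v \<Rightarrow> 'b) mor" where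
  "insertion v = (inc v, inc_sec v)"

lemma insertion_Hom: "v \<in> V \<Longrightarrow> insertion v \<in> Hom (B v) glued"
  unfolding insertion_def by (rule open_immersion.in_Hom[OF open_immersion_inc])

lemma insertion_compatible:
  assumes "v \<in> V" "w \<in> V"
  shows "mor_comp D (B v) glued (insertion v) (k v, K v) = mor_comp D (B w) glued (insertion w) (k w, K w)"
  unfolding mor_comp_def insertion_def fst_conv snd_conv
proof (intro arg_cong2[where f = Pair] restrict_ext)
  show "compose D_pts (inc v) (k v) = compose D_pts (inc w) (k w)"
    using assms by (auto simp: compose_def inc_k)
  fix U assume "U \<in> {U. openin (base glued) U}"
  then have U: "openin space U" by simp
  show "compose (carrier (sec glued U)) (K v (piece v U)) (inc_sec v U)
      = compose (carrier (sec glued U)) (K w (piece w U)) (inc_sec w U)"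
    using inc_sec_apply[OF U] sectionsD(3)[OF _ assms] by (auto simp: compose_def intro!: restrict_ext)
qed

lemma points_cover: "x \<in> points \<Longrightarrow> \<exists>v \<in> V. \<exists>y \<in> pts v. x = inc v y"
  using inc_points[of "fst x" "snd x"] by (force simp: points_def)

lemma scheme_glued:
  fixes e :: "'r \<Rightarrow> ('v \<Rightarrow> 'b)"
  assumes e: "inj e"
    and affine: "\<And>v. v \<in> V \<Longrightarrow> \<exists>(R :: 'r ring) f F. cring R \<and>
      open_immersion (Spec R) (B v) f F \<and> f ` topspace (zariski R) = pts v"
  shows "scheme glued"
proof (rule schemeI[OF ringed_space_glued e])
  fix x assume "x \<in> topspace (base glued)"
  then have "x \<in> points" by (simp add: topspace_space)
  then obtain v y where v: "v \<in> V" and y: "y \<in> pts v" "x = inc v y"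
    using points_cover by blast
  obtain R :: "'r ring" and f F where R: "cring R" "open_immersion (Spec R) (B v) f F"
    "f ` topspace (zariski R) = pts v"
    using affine[OF v] by blast
  obtain h H where h: "mor_comp (Spec R) (B v) glued (inc v, inc_sec v) (f, F) = (h, H)" by fastforce
  have "open_immersion (Spec R) glued h H"
    by (rule open_immersion_comp[OF R(2) open_immersion_inc[OF v] h])
  moreover have "h ` topspace (zariski R) = inc v ` f ` topspace (zariski R)"
    using h by (auto simp: mor_comp_def compose_def image_iff)
  ultimately show "\<exists>(R :: 'r ring) f F. cring R \<and> open_immersion (Spec R) glued f F
      \<and> x \<in> f ` topspace (zariski R)"
    using R(1,3) y by (intro exI[of _ R] exI[of _ h] exI[of _ H]) simp
qed

section \<open>The universal property of the glued space\<close>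

text \<open>Points are mapped through their representatives, and a section of T goes to the family
  of its pullbacks to the pieces, compatible because the composites with \<open>D\<close> coincide.
  For uniqueness, the pieces cover the points and a section is determined by its components.\<close>

lemma glued_universal:
  fixes T :: "('c, 'd) ringed"
  assumes T: "ringed_space T"
    and \<kappa>: "\<And>v. v \<in> V \<Longrightarrow> \<kappa> v \<in> Hom (B v) T"
    and compatible: "\<And>v w. \<lbrakk>v \<in> V; w \<in> V\<rbrakk>
      \<Longrightarrow> mor_comp D (B v) T (\<kappa> v) (k v, K v) = mor_comp D (B w) T (\<kappa> w) (k w, K w)"
  shows "\<exists>!h. h \<in> Hom glued T \<and> (\<forall>v \<in> V. mor_comp (B v) glued T h (insertion v) = \<kappa> v)"
proof (rule ex_ex1I)
  interpret T: ringed_space T by (rule T)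
  interpret G: ringed_space glued by (rule ringed_space_glued)
  define g where "g v = fst (\<kappa> v)" for v
  define G where "G v = snd (\<kappa> v)" for v
  have gG: "\<kappa> v = (g v, G v)" for v by (simp add: g_def G_def)
  have mor: "ringed_mor (B v) T (g v) (G v)" and
    loc: "x \<in> pts v \<Longrightarrow> stalk_map (B v) (g v, G v) x \<in> local_ring_hom (stalk T (g v x)) (stalk (B v) x)"
    if "v \<in> V" for v x
    using \<kappa>[OF that] Hom_iff[OF B[OF that] T] by (auto simp: gG)
  have g_comp: "g v (k v p) = g w (k w p)" if "v \<in> V" "w \<in> V" "p \<in> D_pts" for v w p
    using arg_cong[OF compatible[OF that(1,2)], of "\<lambda>\<phi>. fst \<phi> p"] that(3)
    by (simp add: mor_comp_def gG compose_def)
  have G_comp: "K v (preim (B v) (g v) W) (G v W t) = K w (preim (B w) (g w) W) (G w W t)"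
    if "v \<in> V" "w \<in> V" "openin (base T) W" "t \<in> carrier (sec T W)" for v w W t
  proof -
    have "compose (carrier (sec T W)) (K v (preim (B v) (g v) W)) (G v W)
        = compose (carrier (sec T W)) (K w (preim (B w) (g w) W)) (G w W)"
      using arg_cong[OF compatible[OF that(1,2)], of "\<lambda>\<phi>. snd \<phi> W"] that(3)
      by (simp add: mor_comp_def gG)
    from fun_cong[OF this, of t] show ?thesis using that(4) by (simp add: compose_def)
  qed
  define h where "h = (\<lambda>x \<in> points. g (fst x) (snd x))"
  \<comment> \<open>Only points from \<open>D\<close> need an argument: they are represented in
    \<open>v0\<close>, and \<open>g_comp\<close> passes from \<open>v0\<close> to v.\<close>
  have h_inc: "h (inc v x) = g v x" if "v \<in> V" "x \<in> pts v" for v x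
  proof (cases "x \<in> k v ` D_pts")
    case True
    then obtain p where "p \<in> D_pts" "x = k v p" by blast
    then show ?thesis
      using that inc_closed[OF that] g_comp[OF v0 that(1)] by (simp add: h_def inc_k)
  qed (use that inc_closed[OF that] in \<open>simp add: h_def inc_outside\<close>)
  have piece_h: "piece v (preim glued h W) = preim (B v) (g v) W" if "v \<in> V" for v W
    using inc_closed[OF that] h_inc[OF that] by (auto simp: preim_def topspace_space)
  have h_open: "openin space (preim glued h W)" if "openin (base T) W" for W
    unfolding openin_space
    using piece_h ringed_mor.preim_open[OF mor that] by (auto simp: preim_def topspace_space)
  define H where "H = (\<lambda>W \<in> {W. openin (base T) W}. \<lambda>t \<in> carrier (sec T W). \<lambda>v \<in> V. G v W t)"
  have H_apply: "H W t = (\<lambda>v \<in> V. G v W t)" if "openin (base T) W" "t \<in> carrier (sec T W)" for W t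
    using that by (simp add: H_def)
  have H_closed: "H W t \<in> carrier (sections (preim glued h W))"
    if "openin (base T) W" "t \<in> carrier (sec T W)" for W t
  proof (rule sectionsI)
    fix v w assume v: "v \<in> V" and w: "w \<in> V"
    show "K v (piece v (preim glued h W)) (H W t v) = K w (piece w (preim glued h W)) (H W t w)"
      using G_comp[OF v w that] v w by (simp add: H_apply[OF that] piece_h)
  qed (use ringed_mor.F_closed[OF mor that] in \<open>simp_all add: H_apply[OF that] piece_h\<close>)
  have h_mor: "ringed_mor glued T h H"
  proof unfold_locales
    show "continuous_map (base glued) (base T) h"
      unfolding continuous_map_def
    proof (intro conjI allI impI)
      show "h \<in> topspace (base glued) \<rightarrow> topspace (base T)"
        using points_cover h_inc ringed_mor.f_closed[OF mor] by (fastforce simp: topspace_space)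
      show "openin (base glued) {x \<in> topspace (base glued). h x \<in> W}" if "openin (base T) W" for W
        using h_open[OF that] by (simp add: preim_def)
    qed
    show "h \<in> extensional (topspace (base glued))" by (simp add: h_def topspace_space)
    show "H \<in> extensional {W. openin (base T) W}" by (simp add: H_def)
    fix W assume W: "openin (base T) W"
    show "H W \<in> extensional (carrier (sec T W))" using W by (simp add: H_def)
    interpret TW: cring "sec T W" by (rule T.sec_cring[OF W])
    show "H W \<in> ring_hom (sec T W) (sec glued (preim glued h W))"
    proof (rule ring_hom_memI)
      note hom = ringed_mor.F_hom[OF mor W]
      fix s assume s: "s \<in> carrier (sec T W)"
      show "H W s \<in> carrier (sec glued (preim glued h W))" using H_closed[OF W s] by simp
      fix t assume t: "t \<in> carrier (sec T W)"
      show "H W (s \<otimes>\<^bsub>sec T W\<^esub> t) = H W s \<otimes>\<^bsub>sec glued (preim glued h W)\<^esub> H W t"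
        "H W (s \<oplus>\<^bsub>sec T W\<^esub> t) = H W s \<oplus>\<^bsub>sec glued (preim glued h W)\<^esub> H W t"
        using s t ring_hom_mult[OF hom] ring_hom_add[OF hom]
        by (auto simp: H_apply[OF W] piece_h intro!: restrict_ext)
    next
      show "H W \<one>\<^bsub>sec T W\<^esub> = \<one>\<^bsub>sec glued (preim glued h W)\<^esub>"
        using ring_hom_one[OF ringed_mor.F_hom[OF mor W]]
        by (auto simp: H_apply[OF W] piece_h intro!: restrict_ext)
    qed
    fix W' t assume W': "openin (base T) W'" "W' \<subseteq> W" and t: "t \<in> carrier (sec T W)"
    show "H W' (res T W W' t) = res glued (preim glued h W) (preim glued h W') (H W t)"
      using ringed_mor.F_res[OF mor W W' t] T.res_closed[OF W W' t]
      by (auto simp: H_apply[OF W t] H_apply[OF W'(1)] piece_h intro!: restrict_ext)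
  qed
  interpret h: ringed_mor glued T h H by (rule h_mor)
  have comp: "mor_comp (B v) glued T (h, H) (insertion v) = (g v, G v)" if v: "v \<in> V" for v
  proof -
    interpret g: ringed_mor "B v" T "g v" "G v" by (rule mor[OF v])
    have "compose (pts v) h (inc v) = g v"
      using g.f_ext h_inc[OF v] by (intro extensionalityI[of _ "pts v"]) (auto simp: compose_def)
    moreover have "(\<lambda>W \<in> {W. openin (base T) W}.
        compose (carrier (sec T W)) (inc_sec v (preim glued h W)) (H W)) = G v"
    proof (rule extensionalityI[of _ "{W. openin (base T) W}"])
      fix W assume "W \<in> {W. openin (base T) W}"
      then have W: "openin (base T) W" by simp
      have "compose (carrier (sec T W)) (inc_sec v (preim glued h W)) (H W) = G v W"
        using g.FV_ext[OF W] H_closed[OF W] inc_sec_apply[OF h_open[OF W]] v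
        by (intro extensionalityI[of _ "carrier (sec T W)"]) (auto simp: compose_def H_apply[OF W])
      then show "(\<lambda>W \<in> {W. openin (base T) W}.
          compose (carrier (sec T W)) (inc_sec v (preim glued h W)) (H W)) W = G v W"
        using W by simp
    qed (use g.F_ext in simp_all)
    ultimately show ?thesis by (simp add: mor_comp_def insertion_def)
  qed
  have "stalk_map glued (h, H) x \<in> local_ring_hom (stalk T (h x)) (stalk glued x)"
    if x: "x \<in> topspace (base glued)" for x
  proof -
    have "x \<in> points" using x by (simp add: topspace_space)
    then obtain v y where v: "v \<in> V" and y: "y \<in> pts v" "x = inc v y" using points_cover by blast
    interpret i: open_immersion "B v" glued "inc v" "inc_sec v" by (rule open_immersion_inc[OF v])
    let ?i = "stalk_map (B v) (inc v, inc_sec v) y"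
    have i: "?i \<in> ring_iso (stalk glued x) (stalk (B v) y)"
      using i.stalk_map_iso[OF y(1)] y(2) by simp
    have hx: "h x = g v y" using h_inc[OF v y(1)] y(2) by simp
    let ?S = "stalk glued x" and ?R = "stalk (B v) y"
    have S: "cring ?S" by (rule G.stalk_cring[OF x])
    have "stalk_map (B v) (g v, G v) y A = ?i (stalk_map glued (h, H) x A)"
      if "A \<in> carrier (stalk T (h x))" for A
      using stalk_map_comp[OF i.ringed_mor_axioms h_mor comp[OF v, unfolded insertion_def] y(1)] that
      by (simp add: y(2))
    \<comment> \<open>Functoriality writes the stalk map of \<open>\<kappa> v\<close> as that of h
      followed by the isomorphism \<open>?i\<close>. Cancelling \<open>?i\<close> exhibits the stalk
      map of h as a local homomorphism followed by an isomorphism.\<close>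
    moreover have "inv_into (carrier ?S) ?i (?i (stalk_map glued (h, H) x A)) = stalk_map glued (h, H) x A"
      if "A \<in> carrier (stalk T (h x))" for A
      using i ring_hom_closed[OF h.stalk_map_hom[OF x] that] by (simp add: ring_iso_def bij_betw_def)
    ultimately have "stalk_map glued (h, H) x A = inv_into (carrier ?S) ?i (stalk_map (B v) (g v, G v) y A)"
      if "A \<in> carrier (stalk T (h x))" for A
      using that by simp
    then show ?thesis
      using loc[OF v y(1)] i.X.stalk_cring[OF y(1)] S h.stalk_map_hom[OF x]
        ring_iso_set_sym[OF cring.axioms(1)[OF S] i]
      by (intro local_ring_hom_iso_comp[of _ _ ?R "inv_into (carrier ?S) ?i"]) (simp_all add: hx)
  qed
  then have "(h, H) \<in> Hom glued T" using Hom_iff[OF ringed_space_glued T] h_mor by blast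
  then show "\<exists>h. h \<in> Hom glued T \<and> (\<forall>v \<in> V. mor_comp (B v) glued T h (insertion v) = \<kappa> v)"
    using comp gG by (intro exI[of _ "(h, H)"]) simp
next
  fix \<phi> \<psi>
  assume \<phi>: "\<phi> \<in> Hom glued T \<and> (\<forall>v \<in> V. mor_comp (B v) glued T \<phi> (insertion v) = \<kappa> v)"
    and \<psi>: "\<psi> \<in> Hom glued T \<and> (\<forall>v \<in> V. mor_comp (B v) glued T \<psi> (insertion v) = \<kappa> v)"
  obtain f F f' F' where eqs: "\<phi> = (f, F)" "\<psi> = (f', F')" by fastforce
  interpret f: ringed_mor glued T f F
    using \<phi> Hom_iff[OF ringed_space_glued T] by (simp add: eqs)
  interpret f': ringed_mor glued T f' F'
    using \<psi> Hom_iff[OF ringed_space_glued T] by (simp add: eqs)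
  have same: "mor_comp (B v) glued T (f, F) (insertion v) = mor_comp (B v) glued T (f', F') (insertion v)"
    if "v \<in> V" for v
    using \<phi> \<psi> that by (simp add: eqs)
  have ff': "f = f'"
  proof (rule extensionalityI[OF f.f_ext f'.f_ext])
    fix x assume "x \<in> topspace (base glued)"
    then have "x \<in> points" by (simp add: topspace_space)
    then obtain v y where v: "v \<in> V" "y \<in> pts v" "x = inc v y" using points_cover by blast
    have "compose (pts v) f (inc v) = compose (pts v) f' (inc v)"
      using same[OF v(1)] by (simp add: mor_comp_def insertion_def)
    from fun_cong[OF this, of y] show "f x = f' x" using v by (simp add: compose_def)
  qed
  \<comment> \<open>Only after f = f' is known do the two values of a section of T lie over the same
    preimage, in one ring of sections.\<close>
  have "F = F'"
  proof (rule extensionalityI[OF f.F_ext f'.F_ext])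
    fix W assume "W \<in> {W. openin (base T) W}"
    then have W: "openin (base T) W" by simp
    have P: "openin space (preim glued f W)" using f.preim_open[OF W] by simp
    show "F W = F' W"
    proof (rule extensionalityI[OF f.FV_ext[OF W] f'.FV_ext[OF W]])
      fix t assume t: "t \<in> carrier (sec T W)"
      have c: "F W t \<in> carrier (sections (preim glued f W))" "F' W t \<in> carrier (sections (preim glued f W))"
        using f.F_closed[OF W t] f'.F_closed[OF W t] by (simp_all add: ff')
      show "F W t = F' W t"
      proof (rule sections_eqI[OF c])
        fix v assume v: "v \<in> V"
        let ?c = "\<lambda>F. (\<lambda>W \<in> {W. openin (base T) W}.
          compose (carrier (sec T W)) (inc_sec v (preim glued f W)) (F W))"
        have "?c F = ?c F'"
          using same[OF v] unfolding mor_comp_def insertion_def fst_conv snd_conv ff' by simp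
        from fun_cong[OF fun_cong[OF this, of W], of t] show "F W t v = F' W t v"
          using W t inc_sec_apply[OF P c(1)] inc_sec_apply[OF P c(2)] by (simp add: compose_def)
      qed
    qed
  qed
  with ff' show "\<phi> = \<psi>" by (simp add: eqs)
qed

end

section \<open>Monoid algebras\<close>

lemma monoid_algebra_simps [simp]:
  "x \<otimes>\<^bsub>monoid_algebra N\<^esub> y = x * y" "x \<oplus>\<^bsub>monoid_algebra N\<^esub> y = x + y"
  "\<one>\<^bsub>monoid_algebra N\<^esub> = 1" "\<zero>\<^bsub>monoid_algebra N\<^esub> = 0"
  "x \<in> carrier (monoid_algebra N) \<longleftrightarrow> Poly_Mapping.keys x \<subseteq> N"
  by (simp_all add: monoid_algebra_def)

lemma keys_mult_submonoid:
  assumes "add_submonoid N" "Poly_Mapping.keys x \<subseteq> N" "Poly_Mapping.keys y \<subseteq> N"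
  shows "Poly_Mapping.keys (x * y :: 'm::comm_monoid_add \<Rightarrow>\<^sub>0 int) \<subseteq> N"
proof
  fix z assume "z \<in> Poly_Mapping.keys (x * y)"
  then obtain a b where "a \<in> Poly_Mapping.keys x" "b \<in> Poly_Mapping.keys y" "z = a + b"
    using keys_mult[of x y] by blast
  then show "z \<in> N" using assms by (auto simp: add_submonoid_def)
qed

lemma cring_monoid_algebra:
  assumes N: "add_submonoid N"
  shows "cring (monoid_algebra N)"
proof (intro cringI abelian_groupI comm_monoidI)
  fix x y assume xy: "x \<in> carrier (monoid_algebra N)" "y \<in> carrier (monoid_algebra N)"
  show "x \<otimes>\<^bsub>monoid_algebra N\<^esub> y \<in> carrier (monoid_algebra N)"
    using xy keys_mult_submonoid[OF N] by simp
  show "x \<oplus>\<^bsub>monoid_algebra N\<^esub> y \<in> carrier (monoid_algebra N)"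
    using xy keys_add[of x y] by auto
next
  fix x assume "x \<in> carrier (monoid_algebra N)"
  then show "\<exists>y \<in> carrier (monoid_algebra N). y \<oplus>\<^bsub>monoid_algebra N\<^esub> x = \<zero>\<^bsub>monoid_algebra N\<^esub>"
    by (intro bexI[of _ "- x"]) simp_all
qed (use N in \<open>simp_all add: add_submonoid_def algebra_simps\<close>)

section \<open>Characters and denominators in group algebras\<close>

abbreviation character :: "'m \<Rightarrow> 'm::comm_monoid_add \<Rightarrow>\<^sub>0 int" where
  "character m \<equiv> Poly_Mapping.single m 1"

lemma character_add: "character (m + n) = character m * character n"
  by (simp add: mult_single)

lemma keys_character_mult:
  "Poly_Mapping.keys (character m * x) \<subseteq> (+) m ` Poly_Mapping.keys (x :: 'm::comm_monoid_add \<Rightarrow>\<^sub>0 int)"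
proof
  fix z assume "z \<in> Poly_Mapping.keys (character m * x)"
  then obtain a b where "a \<in> Poly_Mapping.keys (character m)" "b \<in> Poly_Mapping.keys x" "z = a + b"
    using keys_mult[of "character m" x] by blast
  then show "z \<in> (+) m ` Poly_Mapping.keys x" by simp
qed

lemma add_submonoid_sum:
  "\<lbrakk>add_submonoid N; \<And>i. i \<in> A \<Longrightarrow> f i \<in> N\<rbrakk> \<Longrightarrow> sum f A \<in> N"
  by (induction A rule: infinite_finite_induct) (auto simp: add_submonoid_def)

lemma add_submonoid_group_closure: "add_submonoid (group_closure N)"
  by (simp add: add_submonoid_def group_closure_add)

text \<open>Differences of elements of N are closed under subtraction, since (a - b) - (c - d) = (a
  + d) - (b + c). Stated as g + b = a, the fact says that b is a denominator for g.\<close>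

lemma group_closure_differences:
  assumes N: "add_submonoid N" and g: "g \<in> group_closure N"
  shows "\<exists>a \<in> N. \<exists>b \<in> N. g + b = a"
  using g
proof induction
  case (base g)
  then have "g \<in> N" using N by (auto simp: add_submonoid_def)
  moreover have "0 \<in> N" using N by (simp add: add_submonoid_def)
  ultimately show ?case by (intro bexI[of _ g] bexI[of _ 0]) simp_all
next
  case (diff g h)
  then obtain a b c d where *: "a \<in> N" "b \<in> N" "g + b = a" "c \<in> N" "d \<in> N" "h + d = c" by blast
  have "(g - h) + (b + c) = a + d" using *(3,6) by (simp add: algebra_simps)
  moreover have "b + c \<in> N" "a + d \<in> N" using * N by (auto simp: add_submonoid_def)
  ultimately show ?case by blast
qed

lemma common_denominator:
  fixes x :: "'m::ab_group_add \<Rightarrow>\<^sub>0 int"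
  assumes N: "add_submonoid N" and x: "Poly_Mapping.keys x \<subseteq> group_closure N"
  shows "\<exists>m \<in> N. Poly_Mapping.keys (character m * x) \<subseteq> N"
proof -
  have "\<forall>g \<in> Poly_Mapping.keys x. \<exists>b. b \<in> N \<and> g + b \<in> N"
    using group_closure_differences[OF N] x by blast
  then obtain b where b: "\<And>g. g \<in> Poly_Mapping.keys x \<Longrightarrow> b g \<in> N \<and> g + b g \<in> N"
    by metis
  \<comment> \<open>Supports are finite, so one denominator per exponent can be added up. For a
    given g the summand \<open>b g\<close> moves g into N, and the remaining summands keep it
    there.\<close>
  let ?m = "\<Sum>g \<in> Poly_Mapping.keys x. b g"
  have "?m + g \<in> N" if g: "g \<in> Poly_Mapping.keys x" for g
  proof -
    have "?m = b g + (\<Sum>h \<in> Poly_Mapping.keys x - {g}. b h)"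
      using g by (intro sum.remove) simp_all
    then have eq: "?m + g = (g + b g) + (\<Sum>h \<in> Poly_Mapping.keys x - {g}. b h)"
      by (simp add: algebra_simps)
    have "(\<Sum>h \<in> Poly_Mapping.keys x - {g}. b h) \<in> N"
      using b by (intro add_submonoid_sum[OF N]) simp
    then show ?thesis unfolding eq using b[OF g] N by (simp add: add_submonoid_def)
  qed
  then have "Poly_Mapping.keys (character ?m * x) \<subseteq> N"
    using keys_character_mult[of ?m x] by blast
  moreover have "?m \<in> N" using b by (intro add_submonoid_sum[OF N]) simp
  ultimately show ?thesis by blast
qed

text \<open>\<open>f\<close> is the sum of a finite set of generators, so that every \<open>m \<in> N\<close> divides a multiple
  of \<open>f\<close>.\<close>

lemma principal_localization_monoid_algebra:
  fixes N :: "'m::ab_group_add set"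
  assumes "fine_submonoid N"
  shows "\<exists>f. principal_localization (monoid_algebra N) (monoid_algebra (group_closure N)) (\<lambda>x. x)
    (character ` N) f"
proof -
  let ?R = "monoid_algebra N" and ?S = "monoid_algebra (group_closure N)"
  obtain S where N: "add_submonoid N" and S: "finite S" "N = add_submonoid hull S"
    using assms by (auto simp: fine_submonoid_def)
  have SN: "S \<subseteq> N" unfolding S(2) by (rule hull_subset)
  have NG: "N \<subseteq> group_closure N" by (auto intro: group_closure.base)
  have sum_mem: "\<Sum>A \<in> N" if "A \<subseteq> S" for A
    using that SN by (intro add_submonoid_sum[OF N]) auto
  interpret R: cring ?R by (rule cring_monoid_algebra[OF N])
  interpret S: cring ?S by (rule cring_monoid_algebra[OF add_submonoid_group_closure])
  have "principal_localization ?R ?S (\<lambda>x. x) (character ` N) (character (\<Sum>S))"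
  proof unfold_locales
    show "(\<lambda>x. x) \<in> ring_hom ?R ?S" using NG by (intro ring_hom_memI) auto
    show "inj_on (\<lambda>x. x) (carrier ?R)" by (rule inj_onI)
    show "character (\<Sum>S) \<in> character ` N" using sum_mem by blast
    fix g assume "g \<in> character ` N"
    then obtain m where m: "m \<in> N" "g = character m" by blast
    then show "g \<in> carrier ?R" by simp
    show "g \<in> Units ?S"
      using m NG by (auto simp: Units_def mult_single intro!: bexI[of _ "character (- m)"])
    show "g \<otimes>\<^bsub>?R\<^esub> h \<in> character ` N" if "h \<in> character ` N" for h
      using that m N by (auto simp: add_submonoid_def character_add[symmetric] simp del: single_add)
    fix p assume p: "primeideal p ?R" and f: "character (\<Sum>S) \<notin> p"
    interpret p: primeideal p ?R by (rule p)
    \<comment> \<open>Primeness makes this set a submonoid. It contains each generator s, because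
      the character of s divides that of the sum, which is not in p; minimality of the hull then
      gives all of N.\<close>
    let ?N = "{m \<in> N. character m \<notin> p}"
    have "add_submonoid ?N"
      unfolding add_submonoid_def
    proof (intro conjI ballI)
      show "0 \<in> ?N" using N p.one_notin by (simp add: add_submonoid_def)
      fix m n assume mn: "m \<in> ?N" "n \<in> ?N"
      then have "character m \<otimes>\<^bsub>?R\<^esub> character n \<notin> p" by (intro p.mult_notin) auto
      then show "m + n \<in> ?N" using mn N by (simp add: character_add add_submonoid_def)
    qed
    moreover have "S \<subseteq> ?N"
    proof
      fix s assume s: "s \<in> S"
      have "\<Sum>S = s + \<Sum>(S - {s})" using S(1) s by (rule sum.remove)
      then have "character (\<Sum>S) = character s \<otimes>\<^bsub>?R\<^esub> character (\<Sum>(S - {s}))"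
        by (simp add: character_add)
      moreover have "character (\<Sum>(S - {s})) \<in> carrier ?R" using sum_mem[of "S - {s}"] by auto
      ultimately have "character s \<notin> p"
        using f p.I_r_closed[of "character s" "character (\<Sum>(S - {s}))"] by auto
      then show "s \<in> ?N" using s SN by blast
    qed
    ultimately have "N \<subseteq> ?N" unfolding S(2) by (rule hull_minimal[rotated])
    then show "g \<notin> p" using m by blast
  next
    fix x assume "x \<in> carrier ?S"
    then have "Poly_Mapping.keys x \<subseteq> group_closure N" by simp
    then obtain m where "m \<in> N" "Poly_Mapping.keys (character m * x) \<subseteq> N"
      using common_denominator[OF N] by blast
    then show "\<exists>g \<in> character ` N. \<exists>r \<in> carrier ?R. g \<otimes>\<^bsub>?S\<^esub> x = r" by auto
  qed
  then show ?thesis by blast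
qed

section \<open>The colimit\<close>

lemma open_immersion_Spec_self:
  "cring R \<Longrightarrow> \<exists>f F. open_immersion (Spec R) (Spec R) f F \<and> f ` topspace (zariski R) = topspace (zariski R)"
  using open_immersion_mor_id[OF ringed_space_Spec] by (intro exI conjI) (auto simp: mor_id_def)

lemma scheme_Spec:
  fixes R :: "'r ring"
  assumes "cring R"
  shows "scheme (Spec R)"
proof (rule schemeI[OF ringed_space_Spec[OF assms]])
  \<comment> \<open>Only an injection of types is required here; the ring structure is transported
    along it afterwards.\<close>
  show "inj (\<lambda>r :: 'r. \<lambda>p :: 'r set. {(r, r)})" by (auto intro!: injI dest!: fun_cong)
  show "\<exists>(R' :: 'r ring) f F. cring R' \<and> open_immersion (Spec R') (Spec R) f F
      \<and> p \<in> f ` topspace (zariski R')" if "p \<in> topspace (base (Spec R))" for p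
    using that assms open_immersion_Spec_self[OF assms] by (intro exI[of _ R]) auto
qed

section \<open>The diagram as gluing data\<close>

definition vertex_scheme ::
    "('i \<Rightarrow> 'm set) \<Rightarrow> 'm::ab_group_add set \<Rightarrow> 'i option
      \<Rightarrow> (('m \<Rightarrow>\<^sub>0 int) set, ('m \<Rightarrow>\<^sub>0 int) spec_section) ringed" where
  "vertex_scheme N G v = (case v of None \<Rightarrow> D_scheme G | Some \<tau> \<Rightarrow> A_scheme (N \<tau>))"

text \<open>The arrows of the diagram, completed by the identity at \<open>None\<close> so that D(G)
  is attached in the same way as the other pieces.\<close>

definition vertex_immersion ::
    "('i \<Rightarrow> 'm set) \<Rightarrow> 'm::ab_group_add set \<Rightarrow> 'i option
      \<Rightarrow> (('m \<Rightarrow>\<^sub>0 int) set, ('m \<Rightarrow>\<^sub>0 int) spec_section, ('m \<Rightarrow>\<^sub>0 int) set, ('m \<Rightarrow>\<^sub>0 int) spec_section) mor" where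
  "vertex_immersion N G v = (case v of None \<Rightarrow> mor_id (D_scheme G)
    | Some \<tau> \<Rightarrow> Spec_map (monoid_algebra (N \<tau>)) (monoid_algebra G) (\<lambda>x. x))"

locale fine_family =
  fixes I :: "'i set" and N :: "'i \<Rightarrow> 'm::ab_group_add set" and G :: "'m set"
  assumes nonempty: "I \<noteq> {}"
    and fine: "\<tau> \<in> I \<Longrightarrow> fine_submonoid (N \<tau>)"
    and gp: "\<tau> \<in> I \<Longrightarrow> group_closure (N \<tau>) = G"
begin

lemma cring_G: "cring (monoid_algebra G)"
  using nonempty gp add_submonoid_group_closure cring_monoid_algebra by blast

lemma cring_N: "\<tau> \<in> I \<Longrightarrow> cring (monoid_algebra (N \<tau>))"
  using fine cring_monoid_algebra by (auto simp: fine_submonoid_def)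

text \<open>With \<open>None\<close> as distinguished vertex the points of D(G) are represented by
  themselves, and no choice of an index in I is needed.\<close>

sublocale gluing_data "D_scheme G" "insert None (Some ` I)" "vertex_scheme N G"
  "\<lambda>v. fst (vertex_immersion N G v)" "\<lambda>v. snd (vertex_immersion N G v)" None
proof (rule gluing_data.intro)
  fix v :: "'i option" assume v: "v \<in> insert None (Some ` I)"
  show "open_immersion (D_scheme G) (vertex_scheme N G v)
      (fst (vertex_immersion N G v)) (snd (vertex_immersion N G v))"
  proof (cases v)
    case None
    then show ?thesis
      using open_immersion_mor_id[OF ringed_space_Spec[OF cring_G]]
      by (simp add: vertex_scheme_def vertex_immersion_def D_scheme_def A_scheme_def)
  next
    case (Some \<tau>)
    then have \<tau>: "\<tau> \<in> I" using v by auto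
    obtain f where "principal_localization (monoid_algebra (N \<tau>)) (monoid_algebra G) (\<lambda>x. x)
        (character ` N \<tau>) f"
      using principal_localization_monoid_algebra[OF fine[OF \<tau>]] gp[OF \<tau>] by auto
    from principal_localization.open_immersion_Spec_map[OF this] show ?thesis
      by (simp add: Some vertex_scheme_def vertex_immersion_def D_scheme_def A_scheme_def)
  qed
qed simp

lemma vertex_Spec:
  assumes "v \<in> insert None (Some ` I)"
  obtains R :: "('m \<Rightarrow>\<^sub>0 int) ring" where "cring R" "vertex_scheme N G v = Spec R"
  using assms cring_G cring_N
  by (cases v) (auto simp: vertex_scheme_def D_scheme_def A_scheme_def)

lemma scheme_colimit: "scheme glued"
proof (rule scheme_glued)
  show "inj (\<lambda>r :: 'm \<Rightarrow>\<^sub>0 int. \<lambda>(v :: 'i option) (p :: ('m \<Rightarrow>\<^sub>0 int) set). {(r, r)})"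
    by (auto intro!: injI dest!: fun_cong)
  fix v :: "'i option" assume "v \<in> insert None (Some ` I)"
  then obtain R :: "('m \<Rightarrow>\<^sub>0 int) ring" where R: "cring R" "vertex_scheme N G v = Spec R"
    by (rule vertex_Spec)
  then show "\<exists>(R :: ('m \<Rightarrow>\<^sub>0 int) ring) f F. cring R \<and> open_immersion (Spec R) (vertex_scheme N G v) f F
      \<and> f ` topspace (zariski R) = topspace (base (vertex_scheme N G v))"
    using open_immersion_Spec_self[OF R(1)] by (intro exI[of _ R]) simp
qed

lemma diagram_simps:
  "verts (gluing_diagram I N G) = insert None (Some ` I)"
  "edges (gluing_diagram I N G) = I"
  "src (gluing_diagram I N G) \<tau> = None"
  "tgt (gluing_diagram I N G) = Some"
  "obj (gluing_diagram I N G) = vertex_scheme N G"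
  "arr (gluing_diagram I N G) \<tau> = vertex_immersion N G (Some \<tau>)"
  by (auto simp: gluing_diagram_def vertex_scheme_def vertex_immersion_def)

lemma vertex_None: "vertex_scheme N G None = D_scheme G"
  "vertex_immersion N G None = mor_id (D_scheme G)"
  by (simp_all add: vertex_scheme_def vertex_immersion_def)

lemma mor_comp_None:
  assumes "ringed_space T" "\<phi> \<in> Hom (D_scheme G) T"
  shows "mor_comp (D_scheme G) (D_scheme G) T \<phi> (mor_id (D_scheme G)) = \<phi>"
proof -
  obtain f F where "\<phi> = (f, F)" by fastforce
  then show ?thesis using mor_comp_mor_id Hom_iff[OF D assms(1)] assms(2) by metis
qed

text \<open>A cocone says that every composite with an arrow equals the leg at \<open>None\<close>;
  at \<open>None\<close> itself this is composition with the identity. So all composites from D(G)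
  coincide, which is the compatibility demanded by \<open>glued_universal\<close>.\<close>

lemma is_colimit_glued:
  "is_colimit TYPE('c) TYPE('d) (gluing_diagram I N G) glued insertion"
  unfolding is_colimit_def
proof (intro conjI allI impI)
  show "scheme_diagram (gluing_diagram I N G)"
    unfolding scheme_diagram_def diagram_simps
  proof (intro conjI ballI)
    show "scheme (vertex_scheme N G v)" if "v \<in> insert None (Some ` I)" for v
      using that by (rule vertex_Spec) (simp add: scheme_Spec)
    show "vertex_immersion N G (Some \<tau>) \<in> Hom (vertex_scheme N G None) (vertex_scheme N G (Some \<tau>))"
      if "\<tau> \<in> I" for \<tau>
      using open_immersion.in_Hom[OF immersion[of "Some \<tau>"]] that by (simp add: vertex_None)
  qed auto
  show "cocone (gluing_diagram I N G) glued insertion"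
    unfolding cocone_def diagram_simps
  proof (intro conjI ballI)
    show "scheme glued" by (rule scheme_colimit)
    show "insertion v \<in> Hom (vertex_scheme N G v) glued" if "v \<in> insert None (Some ` I)" for v
      using that by (rule insertion_Hom)
    fix \<tau> assume "\<tau> \<in> I"
    then show "mor_comp (vertex_scheme N G None) (vertex_scheme N G (Some \<tau>)) glued
        (insertion (Some \<tau>)) (vertex_immersion N G (Some \<tau>)) = insertion None"
      using insertion_compatible[of "Some \<tau>" None] insertion_Hom[of None]
        mor_comp_None[OF ringed_space_glued] by (simp add: vertex_None)
  qed
  fix T :: "('c, 'd) ringed"
    and \<kappa> :: "'i option \<Rightarrow> (('m \<Rightarrow>\<^sub>0 int) set, ('m \<Rightarrow>\<^sub>0 int) spec_section, 'c, 'd) mor"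
  assume "cocone (gluing_diagram I N G) T \<kappa>"
  then have T: "scheme T" and \<kappa>: "\<And>v. v \<in> insert None (Some ` I) \<Longrightarrow> \<kappa> v \<in> Hom (vertex_scheme N G v) T"
    and compatible: "\<And>\<tau>. \<tau> \<in> I \<Longrightarrow> mor_comp (D_scheme G) (vertex_scheme N G (Some \<tau>)) T (\<kappa> (Some \<tau>))
      (vertex_immersion N G (Some \<tau>)) = \<kappa> None"
    unfolding cocone_def diagram_simps by (auto simp: vertex_None)
  have T': "ringed_space T"
    using T by (simp add: scheme_def locally_ringed_space_def)
  have "mor_comp (D_scheme G) (vertex_scheme N G v) T (\<kappa> v)
      (fst (vertex_immersion N G v), snd (vertex_immersion N G v)) = \<kappa> None"
    if "v \<in> insert None (Some ` I)" for v
  proof (cases v)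
    case None
    then show ?thesis using mor_comp_None[OF T'] \<kappa>[of None] by (simp add: vertex_None)
  next
    case (Some \<tau>)
    then have "\<tau> \<in> I" using that by auto
    then show ?thesis using compatible by (simp add: Some)
  qed
  then show "\<exists>!h. h \<in> Hom glued T \<and> (\<forall>v \<in> verts (gluing_diagram I N G).
      mor_comp (obj (gluing_diagram I N G) v) glued T h (insertion v) = \<kappa> v)"
    unfolding diagram_simps by (intro glued_universal[OF T' \<kappa>]) simp_all
qed

end

theorem proposition3p1:
  fixes I :: "'i set"
    and N :: "'i \<Rightarrow> 'm::ab_group_add set"
    and Ngp :: "'m set"
  assumes "\<exists>S :: 'm set. finite S \<and> group_closure S = UNIV"
    and "I \<noteq> {}"
    and "\<And>\<tau>. \<tau> \<in> I \<Longrightarrow> fine_submonoid (N \<tau>)"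
    and "\<And>\<tau>. \<tau> \<in> I \<Longrightarrow> group_closure (N \<tau>) = Ngp"
  shows "\<exists>(X :: (('i option, ('m \<Rightarrow>\<^sub>0 int) set) glued_point,
                 ('i option, ('m \<Rightarrow>\<^sub>0 int) spec_section) glued_section) ringed) \<iota>.
           is_colimit TYPE(('i option, ('m \<Rightarrow>\<^sub>0 int) set) glued_point)
             TYPE(('i option, ('m \<Rightarrow>\<^sub>0 int) spec_section) glued_section)
             (gluing_diagram I N Ngp) X \<iota> \<and>
           is_colimit TYPE('c) TYPE('d) (gluing_diagram I N Ngp) X \<iota>"
proof -
  have "fine_family I N Ngp" using assms(2-4) by unfold_locales
  note colimit = fine_family.is_colimit_glued[OF this]
  \<comment> \<open>The glued scheme and its insertions mention neither type of the target, so the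
    same pair serves both instances of the universal property.\<close>
  show ?thesis by (intro exI conjI; rule colimit)
qed

end
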